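(* Let $\mathcal{P}$ be a simple thin polyomino and let $K$ be a field. Then $\mathcal{P}$ is of König type, i.e. its polyomino ideal $I_{\mathcal{P}}\subset S=K[x_a\mid a\in V(\mathcal{P})]$ is of König type.
   Context: $\mathbb{N}$ is the set of nonnegative integers, and $(i,j)\le (k,l)$ in $\mathbb{N}^2$ means $i\le k$ and $j\le l$. For $a=(i,j)\le b=(k,l)$ put $[a,b]=\{m\in\mathbb{N}^2: a\le m\le b\}$; it is a proper interval if $i<k$ and $j<l$. The diagonal vertices of a proper interval are $a$ (lower-left) and $b$ (upper-right), and its anti-diagonal vertices are $(i,l)$ (upper-left) and $(k,j)$ (lower-right). A cell is $C=[a,a+(1,1)]$; $V(C)$ is the set of its four vertices and its edges are the four pairs of adjacent vertices. For a finite collection of cells $\mathcal{P}$, $V(\mathcal{P})=\bigcup_{C\in\mathcal{P}}V(C)$. A path of cells from $C$ to $D$ is a sequence of distinct cells $C=C_1,\dots,C_m=D$ such that $C_i\cap C_{i+1}$ is an edge of both for all $i$. A polyomino is a non-empty finite collection of cells in $(\mathbb{N}\setminus\{0\})\times(\mathbb{N}\setminus\{0\})$ such that any two of its cells are joined by a path of cells of the collection. $\mathcal{P}$ is simple if any two cells not in $\mathcal{P}$ are joined by a path of cells not in $\mathcal{P}$. $\mathcal{P}$ is thin if it does not contain four cells forming a $2\times 2$ square. An inner interval of $\mathcal{P}$ is a proper interval $[a,b]$ with $a,b\in V(\mathcal{P})$ all of whose cells belong to $\mathcal{P}$. $I_{\mathcal{P}}$ is the ideal of $S=K[x_a\mid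 a\in V(\mathcal{P})]$ generated by all binomials $x_ax_b-x_cx_d$, where $[a,b]$ ranges over the inner intervals of $\mathcal{P}$ and $c,d$ are the anti-diagonal vertices of $[a,b]$. König type: a homogeneous ideal $I\subset S$ of height $h$ is of König type if there exist homogeneous polynomials $f_1,\dots,f_h$ forming part of a minimal system of homogeneous generators of $I$ and a monomial order $<$ on $S$ such that $\operatorname{in}_<(f_1),\dots,\operatorname{in}_<(f_h)$ is a regular sequence. *)

theory Defs
  imports
    "HOL-Algebra.Ideal"
    "HOL-Library.Poly_Mapping"
    "HOL-Library.Product_Order"
    "HOL-Library.Extended_Nat"
begin

section \<open>Polynomial rings in a set of variables\<close>

type_synonym 'v monomial = "'v \<Rightarrow>\<^sub>0 nat"
type_synonym ('v, 'k) mpoly = "'v monomial \<Rightarrow>\<^sub>0 'k"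

definition monomials :: "'v set \<Rightarrow> 'v monomial set" where
  "monomials V = {m. Poly_Mapping.keys m \<subseteq> V}"

definition poly_ring :: "'v set \<Rightarrow> ('v, 'k::field) mpoly ring" where
  "poly_ring V = \<lparr>carrier = {p. Poly_Mapping.keys p \<subseteq> monomials V},
     mult = (*), one = 1, zero = 0, add = (+)\<rparr>"

definition monomial_poly :: "'v monomial \<Rightarrow> ('v, 'k::field) mpoly" where
  "monomial_poly m = Poly_Mapping.single m 1"

definition var :: "'v \<Rightarrow> ('v, 'k::field) mpoly" where
  "var v = monomial_poly (Poly_Mapping.single v 1)"

definition monomial_degree :: "'v monomial \<Rightarrow> nat" where
  "monomial_degree m = (\<Sum>v\<in>Poly_Mapping.keys m. Poly_Mapping.lookup m v)"

definition homogeneous :: "('v, 'k::field) mpoly \<Rightarrow> bool" where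
  "homogeneous f \<longleftrightarrow> (\<exists>d. \<forall>m\<in>Poly_Mapping.keys f. monomial_degree m = d)"

lemma poly_ring_cring: "cring (poly_ring V :: ('v, 'k::field) mpoly ring)"
proof (rule cringI)
  have add: "Poly_Mapping.keys (x + y) \<subseteq> monomials V"
    if "Poly_Mapping.keys x \<subseteq> monomials V" "Poly_Mapping.keys y \<subseteq> monomials V"
    for x y :: "('v, 'k) mpoly"
    using that Poly_Mapping.keys_add[of x y] by blast
  have minus: "\<exists>y. Poly_Mapping.keys y \<subseteq> monomials V \<and> x + y = 0"
    if "Poly_Mapping.keys x \<subseteq> monomials V" for x :: "('v, 'k) mpoly"
    using that by (intro exI[of _ "- x"]) simp
  show "abelian_group (poly_ring V :: ('v, 'k) mpoly ring)"
    by (rule abelian_groupI) (auto simp: poly_ring_def add minus add.assoc add.commute)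
  have closed: "Poly_Mapping.keys (x * y) \<subseteq> monomials V"
    if "Poly_Mapping.keys x \<subseteq> monomials V" "Poly_Mapping.keys y \<subseteq> monomials V"
    for x y :: "('v, 'k) mpoly"
  proof
    fix m assume "m \<in> Poly_Mapping.keys (x * y)"
    then obtain a b where "m = a + b" "a \<in> Poly_Mapping.keys x" "b \<in> Poly_Mapping.keys y"
      using keys_mult[of x y] by blast
    then show "m \<in> monomials V"
      using that keys_add[of a b] unfolding monomials_def by blast
  qed
  have one: "0 \<in> monomials V"
    by (simp add: monomials_def)
  show "comm_monoid (poly_ring V :: ('v, 'k) mpoly ring)"
    by (rule comm_monoidI)
      (auto simp: poly_ring_def closed one mult.assoc mult.commute)
qed (auto simp: poly_ring_def algebra_simps)


section \<open>Height, regular sequences and Koenig type\<close>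

definition prime_height :: "('a, 'b) ring_scheme \<Rightarrow> 'a set \<Rightarrow> enat" where
  "prime_height R p = Sup {enat n | n. \<exists>c :: nat \<Rightarrow> 'a set.
     (\<forall>i\<le>n. primeideal (c i) R) \<and> (\<forall>i<n. c i \<subset> c (Suc i)) \<and> c n = p}"

definition ideal_height :: "('a, 'b) ring_scheme \<Rightarrow> 'a set \<Rightarrow> enat" where
  "ideal_height R I = (INF p \<in> {p. primeideal p R \<and> I \<subseteq> p}. prime_height R p)"

definition regular_sequence :: "('a, 'b) ring_scheme \<Rightarrow> 'a list \<Rightarrow> bool" where
  "regular_sequence R gs \<longleftrightarrow> set gs \<subseteq> carrier R \<and>
     Idl\<^bsub>R\<^esub> (set gs) \<noteq> carrier R \<and>
     (\<forall>i<length gs. \<forall>p\<in>carrier R.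
        gs ! i \<otimes>\<^bsub>R\<^esub> p \<in> Idl\<^bsub>R\<^esub> (set (take i gs)) \<longrightarrow> p \<in> Idl\<^bsub>R\<^esub> (set (take i gs)))"

text \<open>The pair \<open>(u, v) \<in> r\<close> stands for \<open>u \<le> v\<close>. Strict compatibility with
  multiplication follows from the weak one since exponents can be cancelled.\<close>

definition monomial_order :: "'v set \<Rightarrow> 'v monomial rel \<Rightarrow> bool" where
  "monomial_order V r \<longleftrightarrow> linear_order_on (monomials V) r \<and>
     (\<forall>u\<in>monomials V. (0, u) \<in> r) \<and>
     (\<forall>u v. \<forall>w\<in>monomials V. (u, v) \<in> r \<longrightarrow> (u + w, v + w) \<in> r)"

definition initial :: "'v monomial rel \<Rightarrow> ('v, 'k::field) mpoly \<Rightarrow> ('v, 'k) mpoly" where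
  "initial r f = (if f = 0 then 0
     else monomial_poly (THE m. m \<in> Poly_Mapping.keys f \<and> (\<forall>u\<in>Poly_Mapping.keys f. (u, m) \<in> r)))"

definition homogeneous_generators ::
  "'v set \<Rightarrow> ('v, 'k::field) mpoly set \<Rightarrow> ('v, 'k) mpoly set \<Rightarrow> bool" where
  "homogeneous_generators V I G \<longleftrightarrow> G \<subseteq> carrier (poly_ring V) \<and>
     (\<forall>g\<in>G. homogeneous g) \<and> Idl\<^bsub>poly_ring V\<^esub> G = I"

definition homogeneous_ideal :: "'v set \<Rightarrow> ('v, 'k::field) mpoly set \<Rightarrow> bool" where
  "homogeneous_ideal V I \<longleftrightarrow> ideal I (poly_ring V) \<and> (\<exists>G. homogeneous_generators V I G)"

definition minimal_homogeneous_generators ::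
  "'v set \<Rightarrow> ('v, 'k::field) mpoly set \<Rightarrow> ('v, 'k) mpoly set \<Rightarrow> bool" where
  "minimal_homogeneous_generators V I G \<longleftrightarrow> homogeneous_generators V I G \<and>
     (\<forall>H. H \<subset> G \<longrightarrow> Idl\<^bsub>poly_ring V\<^esub> H \<noteq> I)"

definition konig_type :: "'v set \<Rightarrow> ('v, 'k::field) mpoly set \<Rightarrow> bool" where
  "konig_type V I \<longleftrightarrow> homogeneous_ideal V I \<and>
     (\<exists>fs G r. ideal_height (poly_ring V) I = enat (length fs) \<and>
        minimal_homogeneous_generators V I G \<and> distinct fs \<and> set fs \<subseteq> G \<and>
        monomial_order V r \<and> regular_sequence (poly_ring V) (map (initial r) fs))"


section \<open>Polyominoes\<close>

text \<open>The order on points is the componentwise one. An interval is the set of its lattice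
  points, so a cell is the set of its four vertices.\<close>

type_synonym point = "nat \<times> nat"
type_synonym cell = "point set"

definition proper :: "point \<Rightarrow> point \<Rightarrow> bool" where
  "proper a b \<longleftrightarrow> fst a < fst b \<and> snd a < snd b"

definition cell_at :: "point \<Rightarrow> cell" where
  "cell_at a = {a..a + (1, 1)}"

definition cells :: "cell set" where
  "cells = range cell_at"

definition adjacent :: "point \<Rightarrow> point \<Rightarrow> bool" where
  "adjacent a b \<longleftrightarrow> b = a + (1, 0) \<or> b = a + (0, 1) \<or> a = b + (1, 0) \<or> a = b + (0, 1)"

definition edges :: "cell \<Rightarrow> point set set" where
  "edges C = {{a, b} | a b. a \<in> C \<and> b \<in> C \<and> adjacent a b}"

definition vertices :: "cell set \<Rightarrow> point set" where
  "vertices P = \<Union>P"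

definition cell_path :: "cell list \<Rightarrow> cell \<Rightarrow> cell \<Rightarrow> bool" where
  "cell_path Cs C D \<longleftrightarrow> Cs \<noteq> [] \<and> set Cs \<subseteq> cells \<and> hd Cs = C \<and> last Cs = D \<and> distinct Cs \<and>
     (\<forall>i. Suc i < length Cs \<longrightarrow>
        Cs ! i \<inter> Cs ! Suc i \<in> edges (Cs ! i) \<and> Cs ! i \<inter> Cs ! Suc i \<in> edges (Cs ! Suc i))"

definition path_connected_cells :: "cell set \<Rightarrow> bool" where
  "path_connected_cells Q \<longleftrightarrow> (\<forall>C\<in>Q. \<forall>D\<in>Q. \<exists>Cs. cell_path Cs C D \<and> set Cs \<subseteq> Q)"

definition polyomino :: "cell set \<Rightarrow> bool" where
  "polyomino P \<longleftrightarrow> P \<noteq> {} \<and> finite P \<and> P \<subseteq> cells \<and> vertices P \<subseteq> {1..} \<times> {1..} \<and>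
     path_connected_cells P"

definition simple_polyomino :: "cell set \<Rightarrow> bool" where
  "simple_polyomino P \<longleftrightarrow> polyomino P \<and> path_connected_cells (cells - P)"

definition thin :: "cell set \<Rightarrow> bool" where
  "thin P \<longleftrightarrow> \<not> (\<exists>a. {cell_at a, cell_at (a + (1, 0)), cell_at (a + (0, 1)), cell_at (a + (1, 1))} \<subseteq> P)"

definition inner_interval :: "cell set \<Rightarrow> point \<Rightarrow> point \<Rightarrow> bool" where
  "inner_interval P a b \<longleftrightarrow> proper a b \<and> a \<in> vertices P \<and> b \<in> vertices P \<and>
     (\<forall>C\<in>cells. C \<subseteq> {a..b} \<longrightarrow> C \<in> P)"

definition inner_binomial :: "point \<Rightarrow> point \<Rightarrow> (point, 'k::field) mpoly" where
  "inner_binomial a b = var a * var b - var (fst a, snd b) * var (fst b, snd a)"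

definition polyomino_ideal :: "cell set \<Rightarrow> (point, 'k::field) mpoly set" where
  "polyomino_ideal P =
     Idl\<^bsub>poly_ring (vertices P)\<^esub> {inner_binomial a b | a b. inner_interval P a b}"

end

theory Submission
  imports Defs
begin

text \<open>
  Cut the polyomino into its maximal vertical and horizontal strips of cells, and let a vertical
  strip select the two diagonal vertices of its interval, a horizontal strip the two anti-diagonal
  ones. Around a vertex, the selections correspond to the places where, turning clockwise, one passes
  from a cell of the polyomino to a cell outside. Hence in a thin polyomino whose cells never touch
  in a corner only, no vertex is selected twice, and the corresponding quadratic monomials are
  pairwise coprime.

  The cells are the edges of the bipartite graph that joins the two strips through each cell. This graph
  is connected, so signs can be distributed on the cells such that, after one strip has been removed,
  all the selected monomials are initial for one monomial order. Simplicity enters through discrete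
  planar duality: a cycle of adjacent cells is the boundary of a set of vertices, and connectedness of
  the complement forbids such cycles and forbids corner contacts. It follows that \<open>n\<close> cells are covered
  by at least \<open>n + 1\<close> strips.

  So the ideal contains \<open>n\<close> of its generators with pairwise coprime initial monomials. These form a
  regular sequence, which bounds the height from below by \<open>n\<close>. The upper bound comes from a toric
  prime ideal containing the polyomino ideal, by counting linearly independent
  polynomials of bounded degree along a chain of primes.
\<close>

section \<open>Prime ideals and regular sequences\<close>

text \<open>The choice of the monomial order is a problem about signs. If the weight of a vertex is
  the double prefix sum of a function \<open>\<delta>\<close> on the cells, then the weights of the
  two diagonals of a strip differ by the sum of \<open>\<delta>\<close> over the strip. A vertical
  strip wants this sum positive, a horizontal one negative. Not all strips can be satisfied: the
  vertical strips and the horizontal strips both partition the cells, so their sums have the same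
  total. Giving up one strip resolves this. Seen from there, every other strip has a neighbour
  closer to the root, and the cell shared with that neighbour can be spent on the wish of the
  farther strip.

  The count leaves no slack. There are \<open>2 * n\<close> minus the number of adjacencies strips,
  and excluding cycles leaves at most \<open>n - 1\<close> adjacencies; \<open>n\<close> strips
  survive the removal, which is exactly the height.\<close>

lemma (in cring) ideal_add_cgenideal:
  assumes "ideal I R" "x \<in> carrier R"
  shows "ideal (set_add R I (PIdl x)) R" "I \<subseteq> set_add R I (PIdl x)" "x \<in> set_add R I (PIdl x)"
proof -
  interpret I: ideal I R by fact
  interpret X: ideal "PIdl x" R using assms cgenideal_ideal by blast
  show "ideal (set_add R I (PIdl x)) R" using assms add_ideals cgenideal_ideal by blast
  show "I \<subseteq> set_add R I (PIdl x)"
  proof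
    fix a assume "a \<in> I"
    then have "a = a \<oplus> \<zero>" using I.Icarr by simp
    then show "a \<in> set_add R I (PIdl x)" unfolding set_add_def' using \<open>a \<in> I\<close> X.zero_closed by blast
  qed
  have "x = \<zero> \<oplus> x" using assms by simp
  then show "x \<in> set_add R I (PIdl x)"
    unfolding set_add_def' using I.zero_closed cgenideal_self[OF assms(2)] by blast
qed

lemma (in cring) ideal_add_cgenidealE:
  assumes "y \<in> set_add R I (PIdl x)"
  obtains a r where "a \<in> I" "r \<in> carrier R" "y = a \<oplus> r \<otimes> x"
  using assms unfolding set_add_def' cgenideal_def by blast

lemma (in cring) genideal_insert:
  assumes "X \<subseteq> carrier R" "x \<in> carrier R"
  shows "Idl (insert x X) = set_add R (Idl X) (PIdl x)"
proof
  have I: "ideal (Idl X) R" using assms genideal_ideal by blast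
  note J = ideal_add_cgenideal[OF I assms(2)]
  show "Idl (insert x X) \<subseteq> set_add R (Idl X) (PIdl x)"
    using J genideal_self[OF assms(1)] by (intro genideal_minimal) auto
  have "ideal (Idl (insert x X)) R" using assms by (intro genideal_ideal) auto
  then interpret K: ideal "Idl (insert x X)" R .
  have xin: "x \<in> Idl (insert x X)" "X \<subseteq> Idl (insert x X)"
    using genideal_self[of "insert x X"] assms by auto
  have "Idl X \<subseteq> Idl (insert x X)" using xin by (intro genideal_minimal K.is_ideal)
  then show "set_add R (Idl X) (PIdl x) \<subseteq> Idl (insert x X)"
    by (auto elim!: ideal_add_cgenidealE intro!: K.a_closed K.I_l_closed xin)
qed

lemma (in ring) ideal_Union_chain:
  assumes "C \<noteq> {}" "subset.chain {I. ideal I R} C"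
  shows "ideal (\<Union>C) R"
proof (rule idealI)
  have C: "ideal I R" if "I \<in> C" for I
    using that assms(2) by (auto simp: subset_chain_def)
  have sub: "additive_subgroup I R" if "I \<in> C" for I
    using C[OF that] by (rule ideal.axioms(1))
  show "subgroup (\<Union>C) (add_monoid R)"
  proof (rule add.subgroupI)
    show "\<Union>C \<subseteq> carrier R" using C by (auto dest: ideal.Icarr)
    obtain I where "I \<in> C" using assms(1) by blast
    then show "\<Union>C \<noteq> {}" using additive_subgroup.zero_closed[OF sub[OF \<open>I \<in> C\<close>]] by blast
    show "\<ominus> a \<in> \<Union>C" if "a \<in> \<Union>C" for a
      using that additive_subgroup.a_inv_closed[OF sub] by blast
    show "a \<oplus> b \<in> \<Union>C" if "a \<in> \<Union>C" "b \<in> \<Union>C" for a b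
    proof -
      obtain I J where IJ: "I \<in> C" "J \<in> C" "a \<in> I" "b \<in> J" using \<open>a \<in> \<Union>C\<close> \<open>b \<in> \<Union>C\<close> by blast
      then have "I \<subseteq> J \<or> J \<subseteq> I" using assms(2) by (auto simp: subset_chain_def)
      then obtain K where K: "K \<in> C" "a \<in> K" "b \<in> K" using IJ by blast
      then show ?thesis using additive_subgroup.a_closed[OF sub[OF K(1)]] by blast
    qed
  qed
  show "x \<otimes> a \<in> \<Union>C" "a \<otimes> x \<in> \<Union>C" if "a \<in> \<Union>C" "x \<in> carrier R" for a x
    using that ideal.I_l_closed[OF C] ideal.I_r_closed[OF C] by blast+
qed (rule ring_axioms)

text \<open>An ideal that is maximal among those containing \<open>J\<close> and missing
  \<open>S\<close> is prime: enlarging it by an \<open>x\<close> or a \<open>y\<close> outside it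
  meets \<open>S\<close>, and the product of the two meeting points, a member of \<open>S\<close>,
  would lie in the ideal if \<open>x \<otimes> y\<close> did.\<close>

lemma (in cring) exists_prime_disjoint:
  assumes J: "ideal J R" and S: "S \<subseteq> carrier R" "\<one> \<in> S" "\<And>s t. s \<in> S \<Longrightarrow> t \<in> S \<Longrightarrow> s \<otimes> t \<in> S"
    and disj: "J \<inter> S = {}"
  shows "\<exists>q. primeideal q R \<and> J \<subseteq> q \<and> q \<inter> S = {}"
proof -
  let ?F = "{I. ideal I R \<and> J \<subseteq> I \<and> I \<inter> S = {}}"
  have "\<exists>M\<in>?F. \<forall>X\<in>?F. M \<subseteq> X \<longrightarrow> X = M"
  proof (rule subset_Zorn_nonempty)
    show "?F \<noteq> {}" using J disj by auto
    fix C assume C: "C \<noteq> {}" "subset.chain ?F C"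
    then have "subset.chain {I. ideal I R} C" by (auto simp: subset_chain_def)
    then have "ideal (\<Union>C) R" using C(1) ideal_Union_chain by blast
    moreover have F: "C \<subseteq> ?F" using C(2) by (auto simp: subset_chain_def)
    have "J \<subseteq> \<Union>C" using F C(1) by blast
    moreover have "\<Union>C \<inter> S = {}" using F by blast
    ultimately show "\<Union>C \<in> ?F" by blast
  qed
  then obtain M where M: "ideal M R" "J \<subseteq> M" "M \<inter> S = {}"
    and max: "\<And>X. ideal X R \<Longrightarrow> J \<subseteq> X \<Longrightarrow> X \<inter> S = {} \<Longrightarrow> M \<subseteq> X \<Longrightarrow> X = M"
    by auto
  interpret M: ideal M R by fact
  have meet: "\<exists>a\<in>M. \<exists>r\<in>carrier R. a \<oplus> r \<otimes> x \<in> S" if "x \<in> carrier R" "x \<notin> M" for x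
  proof -
    note I = ideal_add_cgenideal[OF M(1) that(1)]
    have "(set_add R M (PIdl x)) \<inter> S \<noteq> {}" using max[OF I(1)] I M(2) that by blast
    then show ?thesis by (blast elim: ideal_add_cgenidealE)
  qed
  have "primeideal M R"
  proof (rule primeidealI[OF M(1) is_cring])
    show "carrier R \<noteq> M" using M(3) S by blast
    fix x y assume xy: "x \<in> carrier R" "y \<in> carrier R" "x \<otimes> y \<in> M"
    show "x \<in> M \<or> y \<in> M"
    proof (rule ccontr)
      assume "\<not> (x \<in> M \<or> y \<in> M)"
      then obtain a r b s where ab: "a \<in> M" "r \<in> carrier R" "a \<oplus> r \<otimes> x \<in> S"
         "b \<in> M" "s \<in> carrier R" "b \<oplus> s \<otimes> y \<in> S" using meet xy by metis
      have car: "a \<in> carrier R" "b \<in> carrier R" using ab M.Icarr by auto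
      have "(a \<oplus> r \<otimes> x) \<otimes> (b \<oplus> s \<otimes> y) = (b \<oplus> s \<otimes> y) \<otimes> a \<oplus> ((r \<otimes> x) \<otimes> b \<oplus> (r \<otimes> s) \<otimes> (x \<otimes> y))"
        using car ab(2,5) xy by algebra
      also have "\<dots> \<in> M"
        by (intro M.a_closed M.I_l_closed[of a] M.I_l_closed[of b] M.I_l_closed[of "x \<otimes> y"])
          (use car ab xy in auto)
      finally show False using S(3)[OF ab(3,6)] M(3) by blast
    qed
  qed
  then show ?thesis using M by blast
qed

text \<open>The prime is found by avoiding all products \<open>s \<otimes> x [^] k\<close> with
  \<open>s\<close> outside \<open>p\<close>. The ideal \<open>J\<close> avoids them, since
  cancelling the powers of \<open>x\<close> would put \<open>s\<close> into \<open>J\<close> and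
  thus into \<open>p\<close>.\<close>

lemma (in cring) prime_strictly_below:
  assumes J: "ideal J R" and p: "primeideal p R" "J \<subseteq> p" and x: "x \<in> p"
    and reg: "\<And>y. y \<in> carrier R \<Longrightarrow> x \<otimes> y \<in> J \<Longrightarrow> y \<in> J"
  shows "\<exists>q. primeideal q R \<and> J \<subseteq> q \<and> q \<subset> p"
proof -
  interpret p: primeideal p R by fact
  interpret J: ideal J R by fact
  have xc: "x \<in> carrier R" using x p.Icarr by blast
  \<comment> \<open>Missing the members with \<open>k = 0\<close> keeps \<open>q\<close> inside
    \<open>p\<close>; missing the one with \<open>s = \<one>\<close> and \<open>k = 1\<close> keeps
    \<open>x\<close> out of \<open>q\<close>.\<close>
  define S where "S = {s \<otimes> (x [^] k) | s k. s \<in> carrier R - p \<and> k \<in> (UNIV :: nat set)}"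
  have onep: "\<one> \<notin> p" using p.one_imp_carrier p.I_notcarr by blast
  have SI: "s \<otimes> (x [^] k) \<in> S" if "s \<in> carrier R" "s \<notin> p" for s and k :: nat
    using that unfolding S_def by blast
  have pow: "y \<in> J" if "x [^] (k::nat) \<otimes> y \<in> J" "y \<in> carrier R" for k y
    using that
  proof (induction k)
    case 0 then show ?case by simp
  next
    case (Suc k)
    have "x \<otimes> (x [^] k \<otimes> y) = x [^] Suc k \<otimes> y"
      unfolding nat_pow_Suc2[OF xc] using xc Suc.prems(2) by (simp add: m_assoc)
    then show ?case using reg[of "x [^] k \<otimes> y"] Suc xc by simp
  qed
  have "\<exists>q. primeideal q R \<and> J \<subseteq> q \<and> q \<inter> S = {}"
  proof (rule exists_prime_disjoint[OF J])
    show "S \<subseteq> carrier R" unfolding S_def using xc by auto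
    show "\<one> \<in> S" using SI[of \<one> 0] onep by simp
    show "s \<otimes> t \<in> S" if "s \<in> S" "t \<in> S" for s t
    proof -
      obtain a and k :: nat where a: "a \<in> carrier R" "a \<notin> p" "s = a \<otimes> x [^] k"
        using \<open>s \<in> S\<close> unfolding S_def by blast
      obtain b and l :: nat where b: "b \<in> carrier R" "b \<notin> p" "t = b \<otimes> x [^] l"
        using \<open>t \<in> S\<close> unfolding S_def by blast
      have "s \<otimes> t = (a \<otimes> b) \<otimes> (x [^] k \<otimes> x [^] l)"
        unfolding a(3) b(3) using a(1) b(1) xc by (simp add: m_ac)
      also have "\<dots> = (a \<otimes> b) \<otimes> x [^] (k + l)" using xc by (simp add: nat_pow_mult)
      moreover have "a \<otimes> b \<notin> p" using p.I_prime[of a b] a(1,2) b(1,2) by blast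
      ultimately show ?thesis using SI[of "a \<otimes> b" "k + l"] a(1) b(1) by simp
    qed
    show "J \<inter> S = {}"
    proof (rule ccontr)
      assume "J \<inter> S \<noteq> {}"
      then obtain s and k :: nat where s: "s \<in> carrier R" "s \<notin> p" "s \<otimes> x [^] k \<in> J"
        unfolding S_def by blast
      then have "x [^] k \<otimes> s \<in> J" using xc by (simp add: m_comm)
      then show False using pow s p(2) by blast
    qed
  qed
  then obtain q where q: "primeideal q R" "J \<subseteq> q" "q \<inter> S = {}" by blast
  interpret q: primeideal q R by fact
  have "y \<in> p" if "y \<in> q" for y
  proof (rule ccontr)
    assume "y \<notin> p"
    then have "y \<otimes> x [^] (0::nat) \<in> S" using SI q.Icarr that by blast
    then show False using q(3) q.Icarr[OF that] that by auto
  qed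
  moreover have "\<one> \<otimes> x [^] (1::nat) \<in> S" using SI onep by blast
  then have "x \<notin> q" using q(3) xc by auto
  ultimately show ?thesis using q x by blast
qed

lemma prime_heightI:
  assumes "\<And>i. i \<le> n \<Longrightarrow> primeideal (c i) R" "\<And>i. i < n \<Longrightarrow> c i \<subset> c (Suc i)"
  shows "enat n \<le> prime_height R (c n)"
  unfolding prime_height_def by (rule Sup_upper) (use assms in blast)

text \<open>The chain is built downwards from \<open>p\<close>: the last member of the sequence
  cancels modulo the ideal of the others, so \<open>prime_strictly_below\<close> yields a smaller
  prime that still contains the others.\<close>

lemma (in cring) regular_chain:
  assumes "set gs \<subseteq> p" "primeideal p R"
    and "\<And>i y. i < length gs \<Longrightarrow> y \<in> carrier R \<Longrightarrow> gs ! i \<otimes> y \<in> Idl (set (take i gs)) \<Longrightarrow>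
      y \<in> Idl (set (take i gs))"
  shows "\<exists>c. (\<forall>i\<le>length gs. primeideal (c i) R) \<and> (\<forall>i<length gs. c i \<subset> c (Suc i)) \<and> c (length gs) = p"
  using assms
proof (induction gs arbitrary: p rule: rev_induct)
  case Nil
  then show ?case by (intro exI[of _ "\<lambda>_. p"]) auto
next
  case (snoc x gs)
  interpret p: primeideal p R by fact
  have car: "set gs \<subseteq> carrier R" using snoc.prems(1) p.Icarr by auto
  have "\<exists>q. primeideal q R \<and> Idl (set gs) \<subseteq> q \<and> q \<subset> p"
  proof (rule prime_strictly_below)
    show "ideal (Idl (set gs)) R" by (rule genideal_ideal[OF car])
    show "Idl (set gs) \<subseteq> p" using snoc.prems(1) by (intro genideal_minimal p.is_ideal) auto
    show "y \<in> Idl (set gs)" if "y \<in> carrier R" "x \<otimes> y \<in> Idl (set gs)" for y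
      using snoc.prems(3)[of "length gs" y] that by simp
  qed (use snoc.prems in auto)
  then obtain q where q: "primeideal q R" "set gs \<subseteq> q" "q \<subset> p"
    using genideal_self[OF car] by blast
  have reg: "y \<in> Idl (set (take i gs))"
    if "i < length gs" "y \<in> carrier R" "gs ! i \<otimes> y \<in> Idl (set (take i gs))" for i y
    using snoc.prems(3)[of i y] that by (simp add: nth_append)
  obtain c where c: "\<forall>i\<le>length gs. primeideal (c i) R" "\<forall>i<length gs. c i \<subset> c (Suc i)" "c (length gs) = q"
    using snoc.IH[OF q(2,1) reg] by blast
  have "\<forall>i\<le>Suc (length gs). primeideal ((c(Suc (length gs) := p)) i) R"
    using c snoc.prems(2) by auto
  moreover have "\<forall>i<Suc (length gs). (c(Suc (length gs) := p)) i \<subset> (c(Suc (length gs) := p)) (Suc i)"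
    using c q by (auto simp: less_Suc_eq)
  ultimately show ?case by (intro exI[of _ "c(Suc (length gs) := p)"]) simp
qed

lemma (in cring) regular_sequence_le_ideal_height:
  assumes "set gs \<subseteq> I"
    and "\<And>i y. i < length gs \<Longrightarrow> y \<in> carrier R \<Longrightarrow> gs ! i \<otimes> y \<in> Idl (set (take i gs)) \<Longrightarrow>
      y \<in> Idl (set (take i gs))"
  shows "enat (length gs) \<le> ideal_height R I"
  unfolding ideal_height_def
proof (rule INF_greatest)
  fix p assume "p \<in> {p. primeideal p R \<and> I \<subseteq> p}"
  then have "\<exists>c. (\<forall>i\<le>length gs. primeideal (c i) R) \<and> (\<forall>i<length gs. c i \<subset> c (Suc i)) \<and> c (length gs) = p"
    using assms by (intro regular_chain) auto
  then obtain c where c: "\<And>i. i \<le> length gs \<Longrightarrow> primeideal (c i) R"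
    "\<And>i. i < length gs \<Longrightarrow> c i \<subset> c (Suc i)" "c (length gs) = p" by auto
  show "enat (length gs) \<le> prime_height R p" using prime_heightI[of "length gs" c R] c by simp
qed

section \<open>Polynomials with coprime leading monomials\<close>

lemma poly_ring_simps [simp]:
  "carrier (poly_ring V) = {p. Poly_Mapping.keys p \<subseteq> monomials V}"
  "mult (poly_ring V) = (*)" "one (poly_ring V) = 1" "zero (poly_ring V) = 0" "add (poly_ring V) = (+)"
  by (simp_all add: poly_ring_def)

lemma keys_add_nat: "Poly_Mapping.keys (u + v :: 'v monomial) = Poly_Mapping.keys u \<union> Poly_Mapping.keys v"
  by (auto simp: in_keys_iff lookup_add)

lemma zero_in_monomials [simp]: "0 \<in> monomials V"
  by (simp add: monomials_def)

lemma add_in_monomials [simp]: "u + v \<in> monomials V \<longleftrightarrow> u \<in> monomials V \<and> v \<in> monomials V"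
  by (auto simp: monomials_def keys_add_nat)

lemma single_in_monomials [simp]: "Poly_Mapping.single v n \<in> monomials V \<longleftrightarrow> n = 0 \<or> v \<in> V"
  by (simp add: monomials_def)

lemma single_eq_0_iff [simp]: "Poly_Mapping.single t c = 0 \<longleftrightarrow> c = 0"
  by (metis lookup_single_eq lookup_zero single_zero)

lemma single_in_poly_ring:
  "t \<in> monomials V \<Longrightarrow> Poly_Mapping.single t (c::'k::field) \<in> carrier (poly_ring V)"
  by (simp split: if_splits)

lemma poly_ring_closed:
  fixes f g :: "('v, 'k::field) mpoly"
  assumes "f \<in> carrier (poly_ring V)" "g \<in> carrier (poly_ring V)"
  shows "f + g \<in> carrier (poly_ring V)" "f * g \<in> carrier (poly_ring V)"
    "- f \<in> carrier (poly_ring V)" "f - g \<in> carrier (poly_ring V)"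
proof -
  interpret cring "poly_ring V :: ('v, 'k) mpoly ring" by (rule poly_ring_cring)
  show "f + g \<in> carrier (poly_ring V)" "f * g \<in> carrier (poly_ring V)"
    using add.m_closed[OF assms] m_closed[OF assms] by simp_all
  show "- f \<in> carrier (poly_ring V)" using assms by simp
  show "f - g \<in> carrier (poly_ring V)"
    using assms keys_diff[of f g] by auto
qed

lemma poly_ring_ideal_closed:
  fixes f g :: "('v, 'k::field) mpoly"
  assumes I: "ideal I (poly_ring V)"
  shows "f \<in> I \<Longrightarrow> g \<in> I \<Longrightarrow> f + g \<in> I" "f \<in> I \<Longrightarrow> - f \<in> I" "f \<in> I \<Longrightarrow> g \<in> I \<Longrightarrow> f - g \<in> I"
    "f \<in> I \<Longrightarrow> g \<in> carrier (poly_ring V) \<Longrightarrow> g * f \<in> I"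
    "f \<in> I \<Longrightarrow> g \<in> carrier (poly_ring V) \<Longrightarrow> f * g \<in> I" "0 \<in> I" "f \<in> I \<Longrightarrow> f \<in> carrier (poly_ring V)"
proof -
  interpret I: ideal I "poly_ring V" by fact
  show a: "f + g \<in> I" if "f \<in> I" "g \<in> I" for f g using additive_subgroup.a_closed[OF ideal.axioms(1)[OF I] that] by simp
  show m: "g * f \<in> I" "f * g \<in> I" if "f \<in> I" "g \<in> carrier (poly_ring V)" for f g
    using I.I_l_closed[OF that] I.I_r_closed[OF that] by simp_all
  show u: "- f \<in> I" if "f \<in> I" for f
  proof -
    have "- 1 \<in> carrier (poly_ring V :: ('v, 'k) mpoly ring)" by simp
    then show ?thesis using m(1)[OF that, of "- 1"] by simp
  qed
  show "f - g \<in> I" if "f \<in> I" "g \<in> I" for f g using a[OF that(1) u[OF that(2)]] by simp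
  show "0 \<in> I" using additive_subgroup.zero_closed[OF ideal.axioms(1)[OF I]] by simp
  show "f \<in> I \<Longrightarrow> f \<in> carrier (poly_ring V)" using I.Icarr by blast
qed

lemma genideal_poly_ring_insert:
  fixes X :: "('v, 'k::field) mpoly set"
  assumes "X \<subseteq> carrier (poly_ring V)" "x \<in> carrier (poly_ring V)" "g \<in> Idl\<^bsub>poly_ring V\<^esub> (insert x X)"
  obtains a y where "a \<in> Idl\<^bsub>poly_ring V\<^esub> X" "y \<in> carrier (poly_ring V)" "g = a + y * x"
proof -
  interpret cring "poly_ring V :: ('v, 'k) mpoly ring" by (rule poly_ring_cring)
  show ?thesis
    using assms(3) that unfolding genideal_insert[OF assms(1,2)]
    by (elim ideal_add_cgenidealE) simp
qed

lemma poly_eq_sum_single: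
  fixes f :: "'a \<Rightarrow>\<^sub>0 'b::comm_monoid_add"
  shows "f = (\<Sum>t\<in>Poly_Mapping.keys f. Poly_Mapping.single t (Poly_Mapping.lookup f t))"
  by (rule poly_mapping_eqI)
    (auto simp: lookup_sum lookup_single when_def in_keys_iff)

text \<open>The term of \<open>f\<close> at \<open>a\<close> and that of \<open>g\<close> at
  \<open>b\<close> are split off; what remains of the product cannot reach the exponent
  \<open>a + b\<close>.\<close>

lemma lookup_mult_unique:
  fixes f g :: "'a::comm_monoid_add \<Rightarrow>\<^sub>0 'k::comm_ring_1"
  assumes uniq: "\<And>u v. u \<in> Poly_Mapping.keys f \<Longrightarrow> v \<in> Poly_Mapping.keys g \<Longrightarrow> u + v = a + b \<Longrightarrow> u = a \<and> v = b"
  shows "Poly_Mapping.lookup (f * g) (a + b) = Poly_Mapping.lookup f a * Poly_Mapping.lookup g b"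
proof -
  define c d where "c = Poly_Mapping.lookup f a" and "d = Poly_Mapping.lookup g b"
  define f' g' where "f' = f - Poly_Mapping.single a c" and "g' = g - Poly_Mapping.single b d"
  have kf: "Poly_Mapping.keys f' = Poly_Mapping.keys f - {a}"
    and kg: "Poly_Mapping.keys g' = Poly_Mapping.keys g - {b}"
    by (auto simp: f'_def g'_def c_def d_def in_keys_iff lookup_minus lookup_single when_def split: if_splits)
  have f: "f = Poly_Mapping.single a c + f'" and g: "g = Poly_Mapping.single b d + g'"
    by (simp_all add: f'_def g'_def)
  have 1: "a + b \<notin> Poly_Mapping.keys (f' * g)"
  proof
    assume "a + b \<in> Poly_Mapping.keys (f' * g)"
    then obtain u v where "u \<in> Poly_Mapping.keys f'" "v \<in> Poly_Mapping.keys g" "a + b = u + v"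
      using keys_mult[of f' g] by blast
    then show False using uniq[of u v] kf by auto
  qed
  have 2: "a + b \<notin> Poly_Mapping.keys (Poly_Mapping.single a c * g')"
  proof
    assume "a + b \<in> Poly_Mapping.keys (Poly_Mapping.single a c * g')"
    then obtain v where v: "v \<in> Poly_Mapping.keys g'" "a + b = a + v" "c \<noteq> 0"
      using keys_mult[of "Poly_Mapping.single a c" g'] by (auto split: if_splits)
    then have "a \<in> Poly_Mapping.keys f" by (simp add: c_def in_keys_iff)
    then show False using uniq[of a v] v kg by auto
  qed
  have "f * g = Poly_Mapping.single a c * g + f' * g"
    by (subst f) (rule distrib_right)
  also have "Poly_Mapping.single a c * g = Poly_Mapping.single a c * Poly_Mapping.single b d + Poly_Mapping.single a c * g'"
    by (subst g) (rule distrib_left)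
  finally have "Poly_Mapping.lookup (f * g) (a + b) =
      Poly_Mapping.lookup (Poly_Mapping.single (a + b) (c * d)) (a + b)
      + Poly_Mapping.lookup (Poly_Mapping.single a c * g') (a + b) + Poly_Mapping.lookup (f' * g) (a + b)"
    by (simp only: lookup_add mult_single)
  also have "\<dots> = c * d" using 1 2 by (simp only: in_keys_iff not_not lookup_single_eq add_0_right)
  finally show ?thesis by (simp only: c_def d_def)
qed

section \<open>Leading monomials, division with remainder and regular sequences\<close>

definition leading_monomial :: "'v monomial rel \<Rightarrow> ('v, 'k::field) mpoly \<Rightarrow> 'v monomial" where
  "leading_monomial r f = (THE m. m \<in> Poly_Mapping.keys f \<and> (\<forall>u\<in>Poly_Mapping.keys f. (u, m) \<in> r))"

lemma initial_nonzero: "f \<noteq> 0 \<Longrightarrow> initial r f = monomial_poly (leading_monomial r f)"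
  by (simp add: initial_def leading_monomial_def)

definition mdvd :: "'v monomial \<Rightarrow> 'v monomial \<Rightarrow> bool" where
  "mdvd m t \<longleftrightarrow> (\<forall>v. Poly_Mapping.lookup m v \<le> Poly_Mapping.lookup t v)"

lemma mdvdE:
  assumes "mdvd m t" obtains s where "t = s + m"
proof
  show "t = (t - m) + m"
    by (rule poly_mapping_eqI) (use assms in \<open>simp add: mdvd_def lookup_add lookup_minus\<close>)
qed

lemma mdvd_add: "mdvd m (s + m)"
  by (simp add: mdvd_def lookup_add)

lemma mdvd_coprime_add:
  assumes "mdvd m (s + m')" "Poly_Mapping.keys m \<inter> Poly_Mapping.keys m' = {}"
  shows "mdvd m s"
  unfolding mdvd_def
proof
  fix v
  show "Poly_Mapping.lookup m v \<le> Poly_Mapping.lookup s v"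
  proof (cases "v \<in> Poly_Mapping.keys m")
    case True
    then have "Poly_Mapping.lookup m' v = 0" using assms(2) by (auto simp: in_keys_iff)
    then show ?thesis using assms(1) by (auto simp: mdvd_def lookup_add dest: spec[of _ v])
  qed (simp add: in_keys_iff)
qed

text \<open>For finite \<open>V\<close> well-foundedness is Dickson's lemma. It is a separate
  assumption here because \<open>weight_order_exists\<close> obtains it directly for the order that
  is actually used.\<close>

locale monomial_well_order =
  fixes V :: "'v set" and r :: "'v monomial rel"
  assumes order: "monomial_order V r" and wf: "wf (r - Id)"
begin

lemma antisymD: "(u, v) \<in> r \<Longrightarrow> (v, u) \<in> r \<Longrightarrow> u = v"
  using order unfolding monomial_order_def order_on_defs by (meson antisymD)

lemma transD: "(u, v) \<in> r \<Longrightarrow> (v, w) \<in> r \<Longrightarrow> (u, w) \<in> r"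
  using order unfolding monomial_order_def order_on_defs by (meson transD)

lemma reflD: "u \<in> monomials V \<Longrightarrow> (u, u) \<in> r"
  using order unfolding monomial_order_def order_on_defs by (meson refl_onD)

lemma total: "u \<in> monomials V \<Longrightarrow> v \<in> monomials V \<Longrightarrow> (u, v) \<in> r \<or> (v, u) \<in> r"
  using order reflD unfolding monomial_order_def order_on_defs total_on_def by metis

lemma add_mono_r: "(u, v) \<in> r \<Longrightarrow> w \<in> monomials V \<Longrightarrow> (u + w, v + w) \<in> r"
  using order unfolding monomial_order_def by simp

lemma greatest_exists:
  assumes "finite X" "X \<noteq> {}" "X \<subseteq> monomials V"
  shows "\<exists>m\<in>X. \<forall>u\<in>X. (u, m) \<in> r"
  using assms
proof (induction X rule: finite_ne_induct)
  case (singleton x)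
  then show ?case using reflD by auto
next
  case (insert x F)
  then obtain m where m: "m \<in> F" "\<forall>u\<in>F. (u, m) \<in> r" by auto
  then consider "(x, m) \<in> r" | "(m, x) \<in> r" using total insert.prems by blast
  then show ?case
  proof cases
    case 1 then show ?thesis using m by auto
  next
    case 2
    then have "\<forall>u\<in>insert x F. (u, x) \<in> r" using m transD reflD insert.prems by blast
    then show ?thesis by blast
  qed
qed

lemma leading_monomial_eqI:
  assumes "m \<in> Poly_Mapping.keys f" "\<And>u. u \<in> Poly_Mapping.keys f \<Longrightarrow> (u, m) \<in> r"
  shows "leading_monomial r f = m"
  unfolding leading_monomial_def
  by (rule the_equality) (use assms antisymD in blast)+

lemma leading_monomial:
  fixes f :: "('v, 'k::field) mpoly"
  assumes "f \<in> carrier (poly_ring V)" "f \<noteq> 0"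
  shows "leading_monomial r f \<in> Poly_Mapping.keys f" (is ?A)
    and "u \<in> Poly_Mapping.keys f \<Longrightarrow> (u, leading_monomial r f) \<in> r"
    and "leading_monomial r f \<in> monomials V"
proof -
  have "Poly_Mapping.keys f \<noteq> {}" using assms(2) by simp
  then obtain m where m: "m \<in> Poly_Mapping.keys f" "\<And>u. u \<in> Poly_Mapping.keys f \<Longrightarrow> (u, m) \<in> r"
    using greatest_exists[OF finite_keys, of f] assms(1) unfolding poly_ring_simps by blast
  then have eq: "leading_monomial r f = m" by (rule leading_monomial_eqI)
  have "Poly_Mapping.keys f \<subseteq> monomials V" using assms(1) by simp
  then show ?A "leading_monomial r f \<in> monomials V" unfolding eq using m(1) by blast+
  show "u \<in> Poly_Mapping.keys f \<Longrightarrow> (u, leading_monomial r f) \<in> r" unfolding eq by (rule m(2))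
qed

lemma leading_monomial_single:
  "t \<in> monomials V \<Longrightarrow> c \<noteq> (0::'k::field) \<Longrightarrow> leading_monomial r (Poly_Mapping.single t c) = t"
  by (rule leading_monomial_eqI) (auto intro: reflD)

lemma leading_monomial_mult:
  fixes f g :: "('v, 'k::field) mpoly"
  assumes f: "f \<in> carrier (poly_ring V)" "f \<noteq> 0" and g: "g \<in> carrier (poly_ring V)" "g \<noteq> 0"
  defines "a \<equiv> leading_monomial r f" and "b \<equiv> leading_monomial r g"
  shows "leading_monomial r (f * g) = a + b"
    and "Poly_Mapping.lookup (f * g) (a + b) = Poly_Mapping.lookup f a * Poly_Mapping.lookup g b"
    and "f * g \<noteq> 0"
proof -
  note F = leading_monomial[OF f, folded a_def] and G = leading_monomial[OF g, folded b_def]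
  have le: "(u + v, a + v) \<in> r" "(a + v, a + b) \<in> r" if "u \<in> Poly_Mapping.keys f" "v \<in> Poly_Mapping.keys g" for u v
    using add_mono_r[OF F(2)[OF that(1)], of v] add_mono_r[OF G(2)[OF that(2)] F(3)] that g
    by (auto simp: add.commute)
  have "u = a \<and> v = b" if "u \<in> Poly_Mapping.keys f" "v \<in> Poly_Mapping.keys g" "u + v = a + b" for u v
  proof -
    have "a + v = a + b" using le[OF that(1,2)] antisymD unfolding that(3) by blast
    then show ?thesis using that(3) by simp
  qed
  then show eq: "Poly_Mapping.lookup (f * g) (a + b) = Poly_Mapping.lookup f a * Poly_Mapping.lookup g b"
    by (rule lookup_mult_unique)
  then have key: "a + b \<in> Poly_Mapping.keys (f * g)" using F(1) G(1) by (simp add: in_keys_iff)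
  then show "f * g \<noteq> 0" by auto
  show "leading_monomial r (f * g) = a + b"
    by (rule leading_monomial_eqI[OF key]) (use keys_mult[of f g] le transD in blast)
qed

lemma leading_monomial_add:
  fixes f g :: "('v, 'k::field) mpoly"
  assumes f: "f \<in> carrier (poly_ring V)" "f \<noteq> 0" and g: "g \<in> carrier (poly_ring V)" "g \<noteq> 0"
    and less: "(leading_monomial r f, leading_monomial r g) \<in> r" "leading_monomial r f \<noteq> leading_monomial r g"
  shows "leading_monomial r (f + g) = leading_monomial r g"
proof (rule leading_monomial_eqI)
  have "leading_monomial r g \<notin> Poly_Mapping.keys f" using leading_monomial(2)[OF f] less antisymD by blast
  then show "leading_monomial r g \<in> Poly_Mapping.keys (f + g)"
    using leading_monomial(1)[OF g] by (auto simp: in_keys_iff lookup_add)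
  show "(u, leading_monomial r g) \<in> r" if "u \<in> Poly_Mapping.keys (f + g)" for u
    using that Poly_Mapping.keys_add[of f g] leading_monomial(2)[OF f] leading_monomial(2)[OF g] less transD by blast
qed

text \<open>Division with remainder. The polynomials that have a remainder are closed under
  addition, so single terms suffice. These are treated by well-founded induction: a term divisible
  by a leading monomial is replaced by smaller terms.\<close>

lemma reduce:
  fixes F :: "('v, 'k::field) mpoly set"
  assumes F: "F \<subseteq> carrier (poly_ring V)" "0 \<notin> F" and u: "u \<in> carrier (poly_ring V)"
  shows "\<exists>w\<in>carrier (poly_ring V). u - w \<in> Idl\<^bsub>poly_ring V\<^esub> F \<and>
    (\<forall>t\<in>Poly_Mapping.keys w. \<forall>f\<in>F. \<not> mdvd (leading_monomial r f) t)"
proof -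
  interpret cring "poly_ring V :: ('v, 'k) mpoly ring" by (rule poly_ring_cring)
  have J: "ideal (Idl\<^bsub>poly_ring V\<^esub> F) (poly_ring V)" by (rule genideal_ideal[OF F(1)])
  note Jc = poly_ring_ideal_closed[OF J]
  define R where "R = {u \<in> carrier (poly_ring V). \<exists>w\<in>carrier (poly_ring V). u - w \<in> Idl\<^bsub>poly_ring V\<^esub> F \<and>
    (\<forall>t\<in>Poly_Mapping.keys w. \<forall>f\<in>F. \<not> mdvd (leading_monomial r f) t)}"
  have R_add: "u1 + u2 \<in> R" if u12: "u1 \<in> R" "u2 \<in> R" for u1 u2
  proof -
    obtain w1 where w1: "u1 \<in> carrier (poly_ring V)" "w1 \<in> carrier (poly_ring V)" "u1 - w1 \<in> Idl\<^bsub>poly_ring V\<^esub> F"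
      "\<forall>t\<in>Poly_Mapping.keys w1. \<forall>f\<in>F. \<not> mdvd (leading_monomial r f) t" using u12(1) unfolding R_def by blast
    obtain w2 where w2: "u2 \<in> carrier (poly_ring V)" "w2 \<in> carrier (poly_ring V)" "u2 - w2 \<in> Idl\<^bsub>poly_ring V\<^esub> F"
      "\<forall>t\<in>Poly_Mapping.keys w2. \<forall>f\<in>F. \<not> mdvd (leading_monomial r f) t" using u12(2) unfolding R_def by blast
    have "(u1 + u2) - (w1 + w2) = (u1 - w1) + (u2 - w2)" by simp
    then have "(u1 + u2) - (w1 + w2) \<in> Idl\<^bsub>poly_ring V\<^esub> F" using Jc(1)[OF w1(3) w2(3)] by (simp only:)
    moreover have "\<forall>t\<in>Poly_Mapping.keys (w1 + w2). \<forall>f\<in>F. \<not> mdvd (leading_monomial r f) t"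
      using Poly_Mapping.keys_add[of w1 w2] w1(4) w2(4) by blast
    ultimately show ?thesis unfolding R_def using poly_ring_closed(1) w1(1,2) w2(1,2) by blast
  qed
  have R0: "0 \<in> R" unfolding R_def using Jc(6) by (intro CollectI conjI bexI[of _ 0]) auto
  have R_sum: "h \<in> R" if "\<And>t. t \<in> Poly_Mapping.keys h \<Longrightarrow> Poly_Mapping.single t (Poly_Mapping.lookup h t) \<in> R" for h
  proof -
    have "(\<Sum>t\<in>X. Poly_Mapping.single t (Poly_Mapping.lookup h t)) \<in> R" if "finite X" "X \<subseteq> Poly_Mapping.keys h" for X
      using that by (induction X) (auto intro: R0 R_add \<open>\<And>t. t \<in> Poly_Mapping.keys h \<Longrightarrow> _\<close>)
    from this[of "Poly_Mapping.keys h"] show ?thesis using poly_eq_sum_single[of h] by simp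
  qed
  have single: "Poly_Mapping.single t c \<in> R" if "t \<in> monomials V" for t c
    using wf that
  proof (induction t arbitrary: c rule: wf_induct_rule)
    case (less t)
    have car: "Poly_Mapping.single t c \<in> carrier (poly_ring V)" using less.prems by (rule single_in_poly_ring)
    show ?case
    proof (cases "\<exists>f\<in>F. mdvd (leading_monomial r f) t")
      case False
      then show ?thesis unfolding R_def using car Jc(6)
        by (intro CollectI conjI bexI[of _ "Poly_Mapping.single t c"]) (auto split: if_splits)
    next
      case True
      then obtain f s where f: "f \<in> F" and t: "t = s + leading_monomial r f" by (auto elim: mdvdE)
      have fc: "f \<in> carrier (poly_ring V)" "f \<noteq> 0" using F f by auto
      define d where "d = Poly_Mapping.lookup f (leading_monomial r f)"
      have d: "d \<noteq> 0" using leading_monomial(1)[OF fc] by (simp add: d_def in_keys_iff)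
      show ?thesis
      proof (cases "c = 0")
        case True then show ?thesis using R0 by simp
      next
        case False
        \<comment> \<open>The factor is chosen such that \<open>q * f\<close> has leading term
          \<open>Poly_Mapping.single t c\<close>; the difference \<open>h\<close> then involves only
          monomials below \<open>t\<close>.\<close>
        define q where "q = Poly_Mapping.single s (c / d)"
        have sV: "s \<in> monomials V" using less.prems t by simp
        have q: "q \<in> carrier (poly_ring V)" "q \<noteq> 0" "leading_monomial r q = s" "Poly_Mapping.lookup q s = c / d"
          unfolding q_def using sV d False
          by (rule_tac single_in_poly_ring, simp_all add: leading_monomial_single del: poly_ring_simps)
        note qf = leading_monomial_mult[OF q(1,2) fc, unfolded q(3), folded t]
        have qfc: "q * f \<in> carrier (poly_ring V)" by (rule poly_ring_closed(2)[OF q(1) fc(1)])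
        define h where "h = Poly_Mapping.single t c - q * f"
        have hc: "h \<in> carrier (poly_ring V)" unfolding h_def by (rule poly_ring_closed(4)[OF car qfc])
        have "h \<in> R"
        proof (rule R_sum)
          fix v assume v: "v \<in> Poly_Mapping.keys h"
          have "Poly_Mapping.lookup h t = 0"
            using qf(2) d unfolding h_def by (simp add: lookup_minus d_def q(4))
          then have "v \<noteq> t" using v by (auto simp: in_keys_iff)
          then have "v \<in> Poly_Mapping.keys (q * f)"
            using v unfolding h_def by (simp add: in_keys_iff lookup_minus lookup_single)
          then have "(v, t) \<in> r" using leading_monomial(2)[OF qfc qf(3)] qf(1) by simp
          moreover have "v \<in> monomials V" using v hc by auto
          ultimately show "Poly_Mapping.single v (Poly_Mapping.lookup h v) \<in> R"
            using less.IH \<open>v \<noteq> t\<close> by simp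
        qed
        moreover have "f \<in> Idl\<^bsub>poly_ring V\<^esub> F" using f genideal_self[OF F(1)] by blast
        then have qfJ: "q * f \<in> Idl\<^bsub>poly_ring V\<^esub> F" by (rule Jc(4)[OF _ q(1)])
        ultimately obtain w where w: "w \<in> carrier (poly_ring V)" "h - w \<in> Idl\<^bsub>poly_ring V\<^esub> F"
          "\<forall>t\<in>Poly_Mapping.keys w. \<forall>f\<in>F. \<not> mdvd (leading_monomial r f) t" unfolding R_def by blast
        have "Poly_Mapping.single t c - w = (h - w) + q * f" by (simp add: h_def)
        then have "Poly_Mapping.single t c - w \<in> Idl\<^bsub>poly_ring V\<^esub> F" using Jc(1)[OF w(2) qfJ] by (simp only:)
        then show ?thesis unfolding R_def using w car by blast
      qed
    qed
  qed
  have "u \<in> R" by (rule R_sum, rule single) (use u in auto)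
  then show ?thesis unfolding R_def by blast
qed

text \<open>The relation is symmetric, so \<open>sorted_wrt\<close> expresses coprimality for any
  two positions, in a form that prefixes inherit.\<close>

definition leading_coprime :: "('v, 'k::field) mpoly list \<Rightarrow> bool" where
  "leading_coprime gs \<longleftrightarrow> set gs \<subseteq> carrier (poly_ring V) - {0} \<and>
    sorted_wrt (\<lambda>f g. Poly_Mapping.keys (leading_monomial r f) \<inter> Poly_Mapping.keys (leading_monomial r g) = {}) gs"

text \<open>The Groebner basis property and regularity are proved in one induction: after reducing a cofactor \<open>y\<close> of the new
  generator \<open>x\<close> modulo the old ones, the leading monomial of \<open>y * x\<close> is not divisible by any of
  the old leading monomials, hence cannot be cancelled.\<close>

lemma leading_coprime_step:
  fixes gs :: "('v, 'k::field) mpoly list"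
  assumes gs: "leading_coprime (gs @ [x])"
    and GB: "\<And>g. g \<in> Idl\<^bsub>poly_ring V\<^esub> (set gs) \<Longrightarrow> g \<noteq> 0 \<Longrightarrow> \<exists>f\<in>set gs. mdvd (leading_monomial r f) (leading_monomial r g)"
  shows "y \<in> carrier (poly_ring V) \<Longrightarrow> x * y \<in> Idl\<^bsub>poly_ring V\<^esub> (set gs) \<Longrightarrow> y \<in> Idl\<^bsub>poly_ring V\<^esub> (set gs)"
    and "g \<in> Idl\<^bsub>poly_ring V\<^esub> (set (gs @ [x])) \<Longrightarrow> g \<noteq> 0 \<Longrightarrow>
      \<exists>f\<in>set (gs @ [x]). mdvd (leading_monomial r f) (leading_monomial r g)"
proof -
  interpret cring "poly_ring V :: ('v, 'k) mpoly ring" by (rule poly_ring_cring)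
  have car: "set gs \<subseteq> carrier (poly_ring V)" "0 \<notin> set gs" and x: "x \<in> carrier (poly_ring V)" "x \<noteq> 0"
    and cop: "\<And>f. f \<in> set gs \<Longrightarrow> Poly_Mapping.keys (leading_monomial r f) \<inter> Poly_Mapping.keys (leading_monomial r x) = {}"
    using gs unfolding leading_coprime_def by (auto simp: sorted_wrt_append)
  define J where "J = Idl\<^bsub>poly_ring V\<^esub> (set gs)"
  have J: "ideal J (poly_ring V)" unfolding J_def by (rule genideal_ideal[OF car(1)])
  note Jc = poly_ring_ideal_closed[OF J]
  have nodvd: "\<not> mdvd (leading_monomial r f) (leading_monomial r (w * x))"
    if w: "w \<in> carrier (poly_ring V)" "w \<noteq> 0"
      "\<forall>t\<in>Poly_Mapping.keys w. \<forall>f\<in>set gs. \<not> mdvd (leading_monomial r f) t" and "f \<in> set gs" for w f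
    using mdvd_coprime_add[OF _ cop[OF that(4)]] leading_monomial_mult(1)[OF w(1,2) x] leading_monomial(1)[OF w(1,2)] w(3) that(4)
    by metis
  show "y \<in> Idl\<^bsub>poly_ring V\<^esub> (set gs)" if y: "y \<in> carrier (poly_ring V)" "x * y \<in> Idl\<^bsub>poly_ring V\<^esub> (set gs)"
  proof -
    obtain w where w: "w \<in> carrier (poly_ring V)" "y - w \<in> J"
      "\<forall>t\<in>Poly_Mapping.keys w. \<forall>f\<in>set gs. \<not> mdvd (leading_monomial r f) t"
      using reduce[OF car y(1)] unfolding J_def by blast
    have "w * x = x * y - x * (y - w)" by (simp add: algebra_simps)
    then have "w * x \<in> J" using Jc(3)[OF y(2)[folded J_def] Jc(4)[OF w(2) x(1)]] by simp
    then have "w = 0" using GB[folded J_def, of "w * x"] nodvd[OF w(1) _ w(3)] leading_monomial_mult(3)[OF w(1) _ x] by blast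
    then show ?thesis using w(2) unfolding J_def by simp
  qed
  show "\<exists>f\<in>set (gs @ [x]). mdvd (leading_monomial r f) (leading_monomial r g)"
    if g: "g \<in> Idl\<^bsub>poly_ring V\<^esub> (set (gs @ [x]))" "g \<noteq> 0"
  proof -
    have "g \<in> Idl\<^bsub>poly_ring V\<^esub> (insert x (set gs))" using g(1) by simp
    then obtain a y where a: "a \<in> J" and y: "y \<in> carrier (poly_ring V)" and gay: "g = a + y * x"
      using genideal_poly_ring_insert[OF car(1) x(1)] unfolding J_def by blast
    obtain w where w: "w \<in> carrier (poly_ring V)" "y - w \<in> J"
      "\<forall>t\<in>Poly_Mapping.keys w. \<forall>f\<in>set gs. \<not> mdvd (leading_monomial r f) t"
      using reduce[OF car y(1)] unfolding J_def by blast
    define b where "b = a + (y - w) * x"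
    have b: "b \<in> J" unfolding b_def by (rule Jc(1)[OF a Jc(5)[OF w(2) x(1)]])
    have gb: "g = b + w * x" unfolding gay b_def by (simp add: algebra_simps)
    consider "w = 0" | "w \<noteq> 0" "b = 0" | "w \<noteq> 0" "b \<noteq> 0" by blast
    then show ?thesis
    proof cases
      case 1
      then show ?thesis using GB[folded J_def, of g] b g(2) gb by auto
    next
      case 2
      then have "leading_monomial r g = leading_monomial r w + leading_monomial r x"
        using gb leading_monomial_mult(1)[OF w(1) _ x] by simp
      then show ?thesis using mdvd_add[of "leading_monomial r x"] by auto
    next
      case 3
      note wx = leading_monomial_mult[OF w(1) 3(1) x]
      have wxc: "w * x \<in> carrier (poly_ring V)" by (rule poly_ring_closed(2)[OF w(1) x(1)])
      obtain f where f: "f \<in> set gs" "mdvd (leading_monomial r f) (leading_monomial r b)"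
        using GB[folded J_def, OF b 3(2)] by blast
      have ne: "leading_monomial r b \<noteq> leading_monomial r (w * x)"
        using nodvd[OF w(1) 3(1) w(3) f(1)] f(2) by auto
      have bc: "b \<in> carrier (poly_ring V)" using Jc(7)[OF b] .
      have "leading_monomial r b \<in> monomials V" "leading_monomial r (w * x) \<in> monomials V"
        using leading_monomial(3)[OF bc 3(2)] leading_monomial(3)[OF wxc wx(3)] .
      then consider "(leading_monomial r b, leading_monomial r (w * x)) \<in> r"
        | "(leading_monomial r (w * x), leading_monomial r b) \<in> r" using total by blast
      then show ?thesis
      proof cases
        case 1
        then have "leading_monomial r g = leading_monomial r w + leading_monomial r x"
          using leading_monomial_add[OF bc 3(2) wxc wx(3)] ne gb wx(1) by simp
        then show ?thesis using mdvd_add[of "leading_monomial r x"] by auto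
      next
        case 2
        then have "leading_monomial r g = leading_monomial r b"
          using leading_monomial_add[OF wxc wx(3) bc 3(2)] ne gb by (simp add: add.commute)
        then show ?thesis using f by auto
      qed
    qed
  qed
qed

lemma leading_coprime_append: "leading_coprime (gs @ hs) \<Longrightarrow> leading_coprime gs"
  by (auto simp: leading_coprime_def sorted_wrt_append)

lemma leading_coprime_groebner:
  fixes gs :: "('v, 'k::field) mpoly list"
  assumes "leading_coprime gs" "g \<in> Idl\<^bsub>poly_ring V\<^esub> (set gs)" "g \<noteq> 0"
  shows "\<exists>f\<in>set gs. mdvd (leading_monomial r f) (leading_monomial r g)"
  using assms
proof (induction gs arbitrary: g rule: rev_induct)
  case Nil
  interpret cring "poly_ring V :: ('v, 'k) mpoly ring" by (rule poly_ring_cring)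
  have "Idl\<^bsub>poly_ring V\<^esub> ({} :: ('v, 'k) mpoly set) \<subseteq> {\<zero>\<^bsub>poly_ring V\<^esub>}" by (rule genideal_minimal[OF zeroideal]) simp
  then show ?case using Nil by auto
next
  case (snoc x gs)
  show ?case
    by (rule leading_coprime_step(2)[OF snoc.prems(1) _ snoc.prems(2,3)])
      (rule snoc.IH[OF leading_coprime_append[OF snoc.prems(1)]])
qed

lemma leading_coprime_regular:
  fixes gs :: "('v, 'k::field) mpoly list"
  assumes gs: "leading_coprime gs" and i: "i < length gs" and y: "y \<in> carrier (poly_ring V)"
    "gs ! i * y \<in> Idl\<^bsub>poly_ring V\<^esub> (set (take i gs))"
  shows "y \<in> Idl\<^bsub>poly_ring V\<^esub> (set (take i gs))"
proof -
  have eq: "take i gs @ [gs ! i] = take (Suc i) gs" using i by (simp add: take_Suc_conv_app_nth)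
  have step: "leading_coprime (take i gs @ [gs ! i])"
    unfolding eq using gs leading_coprime_append[of "take (Suc i) gs" "drop (Suc i) gs"] by simp
  show ?thesis
    by (rule leading_coprime_step(1)[OF step leading_coprime_groebner[OF leading_coprime_append[OF step]] y])
qed

text \<open>This lets the regularity result serve twice: for the polynomials themselves, which lie
  in the ideal and bound its height, and for their initial monomials, as the Koenig property
  demands.\<close>

lemma leading_coprime_initial:
  fixes gs :: "('v, 'k::field) mpoly list"
  assumes "leading_coprime gs"
  shows "leading_coprime (map (initial r) gs)"
    and "g \<in> set gs \<Longrightarrow> leading_monomial r (initial r g) = leading_monomial r g"
proof -
  have init: "initial r g \<in> carrier (poly_ring V) - {0} \<and> leading_monomial r (initial r g) = leading_monomial r g"
    if "g \<in> set gs" for g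
  proof -
    have g: "g \<in> carrier (poly_ring V)" "g \<noteq> 0" using assms that unfolding leading_coprime_def by auto
    have m: "leading_monomial r g \<in> monomials V" by (rule leading_monomial(3)[OF g])
    show ?thesis
      unfolding initial_nonzero[OF g(2)] monomial_poly_def
      using single_in_poly_ring[OF m, of 1] leading_monomial_single[OF m, of 1]
      by (simp del: poly_ring_simps)
  qed
  then show "g \<in> set gs \<Longrightarrow> leading_monomial r (initial r g) = leading_monomial r g" by blast
  show "leading_coprime (map (initial r) gs)"
    using assms init unfolding leading_coprime_def
    by (simp add: sorted_wrt_iff_nth_less image_subset_iff del: poly_ring_simps)
qed

lemma leading_coprime_regular_sequence:
  fixes gs :: "('v, 'k::field) mpoly list"
  assumes gs: "leading_coprime gs" and nz: "\<And>g. g \<in> set gs \<Longrightarrow> leading_monomial r g \<noteq> 0"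
  shows "regular_sequence (poly_ring V) (map (initial r) gs)"
proof -
  note hs = leading_coprime_initial[OF gs]
  let ?hs = "map (initial r) gs"
  \<comment> \<open>The leading monomial of \<open>1\<close> is \<open>0\<close>, and no other
    monomial divides it.\<close>
  have "1 \<notin> Idl\<^bsub>poly_ring V\<^esub> (set ?hs)"
  proof
    assume "1 \<in> Idl\<^bsub>poly_ring V\<^esub> (set ?hs)"
    then obtain f where "f \<in> set ?hs" "mdvd (leading_monomial r f) (leading_monomial r (1 :: ('v, 'k) mpoly))"
      using leading_coprime_groebner[OF hs(1)] by force
    then obtain g where g: "g \<in> set gs" "mdvd (leading_monomial r g) (leading_monomial r (1 :: ('v, 'k) mpoly))"
      using hs(2) by auto
    have "leading_monomial r (1 :: ('v, 'k) mpoly) = 0"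
      using leading_monomial_single[of 0 1] by simp
    then have "leading_monomial r g = 0"
      using g(2) by (auto simp: mdvd_def intro: poly_mapping_eqI)
    then show False using nz g(1) by blast
  qed
  then have "Idl\<^bsub>poly_ring V\<^esub> (set ?hs) \<noteq> carrier (poly_ring V)" by auto
  moreover have "set ?hs \<subseteq> carrier (poly_ring V)" using hs(1) unfolding leading_coprime_def by blast
  ultimately show ?thesis
    unfolding regular_sequence_def using leading_coprime_regular[OF hs(1)] by simp
qed

lemma leading_coprime_le_ideal_height:
  fixes gs :: "('v, 'k::field) mpoly list"
  assumes gs: "leading_coprime gs" and I: "set gs \<subseteq> I"
  shows "enat (length gs) \<le> ideal_height (poly_ring V) I"
proof -
  interpret cring "poly_ring V :: ('v, 'k) mpoly ring" by (rule poly_ring_cring)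
  show ?thesis
    by (rule regular_sequence_le_ideal_height[OF I]) (use leading_coprime_regular[OF gs] in simp)
qed

end

section \<open>Height of toric prime ideals\<close>

text \<open>The additive extension of \<open>E\<close> from variables to monomials. The semiring
  provides multiples by \<open>of_nat\<close>; the same map yields total degrees, weights and, with
  vectors as values, toric exponents.\<close>

definition exponent_map :: "('v \<Rightarrow> 'g::comm_semiring_1) \<Rightarrow> 'v monomial \<Rightarrow> 'g" where
  "exponent_map E m = (\<Sum>v\<in>Poly_Mapping.keys m. of_nat (Poly_Mapping.lookup m v) * E v)"

lemma exponent_map_superset:
  assumes "finite K" "Poly_Mapping.keys m \<subseteq> K"
  shows "exponent_map E m = (\<Sum>v\<in>K. of_nat (Poly_Mapping.lookup m v) * E v)"
  unfolding exponent_map_def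
  by (rule sum.mono_neutral_left) (use assms in \<open>auto simp: in_keys_iff\<close>)

lemma exponent_map_add: "exponent_map E (u + v) = exponent_map E u + exponent_map E v"
proof -
  let ?K = "Poly_Mapping.keys u \<union> Poly_Mapping.keys v"
  have "exponent_map E (u + v) = (\<Sum>x\<in>?K. of_nat (Poly_Mapping.lookup (u + v) x) * E x)"
    by (rule exponent_map_superset) (simp_all add: keys_add_nat)
  also have "\<dots> = exponent_map E u + exponent_map E v"
    by (simp add: exponent_map_superset[of ?K] lookup_add algebra_simps sum.distrib)
  finally show ?thesis .
qed

lemma exponent_map_zero [simp]: "exponent_map E 0 = 0"
  by (simp add: exponent_map_def)

lemma exponent_map_single [simp]: "exponent_map E (Poly_Mapping.single v n) = of_nat n * E v"
  by (simp add: exponent_map_def)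

lemma monomial_degree_exponent_map: "monomial_degree m = exponent_map (\<lambda>_. 1) m"
  by (simp add: monomial_degree_def exponent_map_def)

lemma monomial_degree_add: "monomial_degree (u + v) = monomial_degree u + monomial_degree v"
  by (simp add: monomial_degree_exponent_map exponent_map_add)

text \<open>For additive \<open>h\<close> this is the homomorphism of monoid algebras induced by
  \<open>h\<close>, see \<open>push_mult\<close>.\<close>

definition push :: "('a \<Rightarrow> 'b) \<Rightarrow> ('a \<Rightarrow>\<^sub>0 'k::comm_ring_1) \<Rightarrow> ('b \<Rightarrow>\<^sub>0 'k)" where
  "push h f = (\<Sum>m\<in>Poly_Mapping.keys f. Poly_Mapping.single (h m) (Poly_Mapping.lookup f m))"

lemma push_superset:
  assumes "finite K" "Poly_Mapping.keys f \<subseteq> K"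
  shows "push h f = (\<Sum>m\<in>K. Poly_Mapping.single (h m) (Poly_Mapping.lookup f m))"
  unfolding push_def
  by (rule sum.mono_neutral_left) (use assms in \<open>auto simp: in_keys_iff\<close>)

lemma push_add: "push h (f + g) = push h f + push h g"
proof -
  let ?K = "Poly_Mapping.keys f \<union> Poly_Mapping.keys g"
  have "push h (f + g) = (\<Sum>m\<in>?K. Poly_Mapping.single (h m) (Poly_Mapping.lookup (f + g) m))"
    by (rule push_superset) (use Poly_Mapping.keys_add[of f g] in auto)
  also have "\<dots> = push h f + push h g"
    by (simp add: push_superset[of ?K] lookup_add single_add sum.distrib)
  finally show ?thesis .
qed

lemma push_zero [simp]: "push h 0 = 0"
  by (simp add: push_def)

lemma push_single [simp]: "push h (Poly_Mapping.single m c) = Poly_Mapping.single (h m) c"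
  by (cases "c = 0") (simp_all add: push_def)

lemma push_sum: "push h (sum f A) = (\<Sum>a\<in>A. push h (f a))"
  by (induction A rule: infinite_finite_induct) (simp_all add: push_add)

lemma push_uminus: "push h (- f) = - push h f"
  by (metis add.inverse_unique push_add push_zero right_minus)

lemma push_mult:
  fixes h :: "'a::comm_monoid_add \<Rightarrow> 'b::comm_monoid_add"
  assumes h: "\<And>a b. h (a + b) = h a + h b"
  shows "push h (f * g) = push h f * push h g"
proof -
  have "push h (f * g) = push h ((\<Sum>t\<in>Poly_Mapping.keys f. Poly_Mapping.single t (Poly_Mapping.lookup f t)) *
      (\<Sum>t\<in>Poly_Mapping.keys g. Poly_Mapping.single t (Poly_Mapping.lookup g t)))"
    using poly_eq_sum_single[of f] poly_eq_sum_single[of g] by simp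
  also have "\<dots> = (\<Sum>s\<in>Poly_Mapping.keys f. \<Sum>t\<in>Poly_Mapping.keys g.
      Poly_Mapping.single (h s + h t) (Poly_Mapping.lookup f s * Poly_Mapping.lookup g t))"
    by (simp only: sum_product push_sum push_single mult_single h)
  also have "\<dots> = push h f * push h g"
    by (simp only: push_def sum_product mult_single)
  finally show ?thesis .
qed

text \<open>The monoid algebra of a linearly ordered cancellative monoid has no zero divisors, since
  the largest exponents of two factors cannot cancel. The kernel of a homomorphism into it is
  therefore prime.\<close>

lemma primeideal_push_kernel:
  fixes h :: "'v monomial \<Rightarrow> 'g::{ordered_cancel_comm_monoid_add, linorder}"
  assumes h: "\<And>a b. h (a + b) = h a + h b" "h 0 = 0"
  shows "primeideal {f \<in> carrier (poly_ring V). push h f = (0 :: 'g \<Rightarrow>\<^sub>0 'k::field)} (poly_ring V)"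
    (is "primeideal ?p _")
proof -
  interpret cring "poly_ring V :: ('v, 'k) mpoly ring" by (rule poly_ring_cring)
  have inv: "\<ominus>\<^bsub>poly_ring V\<^esub> f = - f" if "f \<in> carrier (poly_ring V)" for f :: "('v, 'k) mpoly"
    by (rule minus_equality) (use that in auto)
  have one: "push h (1 :: ('v, 'k) mpoly) = 1"
    using push_single[of h 0 "1 :: 'k"] h(2) by simp
  show ?thesis
  proof (rule primeidealI[OF idealI])
    show "subgroup ?p (add_monoid (poly_ring V))"
    proof (rule add.subgroupI)
      show "?p \<subseteq> carrier (poly_ring V)" by blast
      show "?p \<noteq> {}" by (auto intro!: exI[of _ 0])
      show "\<ominus>\<^bsub>poly_ring V\<^esub> f \<in> ?p" if "f \<in> ?p" for f
        using that inv[of f] by (auto simp: push_uminus)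
      show "f \<oplus>\<^bsub>poly_ring V\<^esub> g \<in> ?p" if "f \<in> ?p" "g \<in> ?p" for f g
        using that poly_ring_closed(1)[of f V g] by (simp add: push_add)
    qed
    show "x \<otimes>\<^bsub>poly_ring V\<^esub> a \<in> ?p" if "a \<in> ?p" "x \<in> carrier (poly_ring V)" for a x
      using that poly_ring_closed(2)[of x V a] by (simp add: push_mult h)
    show "a \<otimes>\<^bsub>poly_ring V\<^esub> x \<in> ?p" if "a \<in> ?p" "x \<in> carrier (poly_ring V)" for a x
      using that poly_ring_closed(2)[of a V x] by (simp add: push_mult h)
    show "carrier (poly_ring V) \<noteq> ?p"
    proof -
      have "1 \<in> carrier (poly_ring V :: ('v, 'k) mpoly ring)" "1 \<notin> ?p" using one by simp_all
      then show ?thesis by blast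
    qed
    show "a \<in> ?p \<or> b \<in> ?p" if "a \<in> carrier (poly_ring V)" "b \<in> carrier (poly_ring V)" "a \<otimes>\<^bsub>poly_ring V\<^esub> b \<in> ?p" for a b
      using that by (simp add: push_mult h)
  qed (rule ring_axioms is_cring)+
qed

section \<open>Linear independence modulo the primes of a chain\<close>

definition indep_mod :: "('v, 'k::field) mpoly set \<Rightarrow> 'i set \<Rightarrow> ('i \<Rightarrow> ('v, 'k) mpoly) \<Rightarrow> bool" where
  "indep_mod p I g \<longleftrightarrow>
     (\<forall>c. (\<Sum>i\<in>I. Poly_Mapping.single 0 (c i) * g i) \<in> p \<longrightarrow> (\<forall>i\<in>I. c i = 0))"

lemma indep_mod_reindex:
  assumes "indep_mod p I g" "bij_betw e J I"
  shows "indep_mod p J (g \<circ> e)"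
  unfolding indep_mod_def
proof (intro allI impI ballI)
  fix c j assume c: "(\<Sum>j\<in>J. Poly_Mapping.single 0 (c j) * (g \<circ> e) j) \<in> p" and j: "j \<in> J"
  have inj: "inj_on e J" using assms(2) bij_betw_imp_inj_on by blast
  have "(\<Sum>i\<in>I. Poly_Mapping.single 0 (c (inv_into J e i)) * g i) =
      (\<Sum>j\<in>J. Poly_Mapping.single 0 (c (inv_into J e (e j))) * g (e j))"
    by (rule sum.reindex_bij_betw[OF assms(2), symmetric])
  also have "\<dots> = (\<Sum>j\<in>J. Poly_Mapping.single 0 (c j) * (g \<circ> e) j)"
    by (rule sum.cong) (simp_all add: inj)
  finally have "(\<Sum>i\<in>I. Poly_Mapping.single 0 (c (inv_into J e i)) * g i) \<in> p" using c by (simp only:)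
  then have "\<forall>i\<in>I. c (inv_into J e i) = 0"
    using assms(1)[unfolded indep_mod_def, THEN spec, of "\<lambda>i. c (inv_into J e i)"] by blast
  then show "c j = 0" using assms(2) j inj by (auto simp: bij_betw_def)
qed

lemma const_in_poly_ring: "Poly_Mapping.single 0 (c::'k::field) \<in> carrier (poly_ring V)"
  by (rule single_in_poly_ring) simp

lemma poly_ring_sum_closed:
  fixes f :: "'i \<Rightarrow> ('v, 'k::field) mpoly"
  assumes "\<And>i. i \<in> I \<Longrightarrow> f i \<in> carrier (poly_ring V)"
  shows "sum f I \<in> carrier (poly_ring V)"
  using assms
proof (induction I rule: infinite_finite_induct)
  case (insert x F)
  then show ?case using poly_ring_closed(1)[of "f x" V "sum f F"] by (simp del: poly_ring_simps)
qed simp_all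

lemma poly_ring_power_closed:
  fixes x :: "('v, 'k::field) mpoly"
  assumes "x \<in> carrier (poly_ring V)"
  shows "x ^ n \<in> carrier (poly_ring V)"
proof (induction n)
  case (Suc n) then show ?case using poly_ring_closed(2)[OF assms Suc] by simp
qed simp

text \<open>Modulo \<open>q\<close> only the terms with \<open>k = 0\<close> of a vanishing
  combination survive, so their coefficients are zero. The rest is a multiple of \<open>x\<close>,
  which can be cancelled modulo the prime \<open>p\<close>, and the argument repeats.\<close>

lemma indep_mod_powers:
  fixes p q :: "('v, 'k::field) mpoly set" and I :: "'i set"
  assumes p: "primeideal p (poly_ring V)" and q: "ideal q (poly_ring V)" and "p \<subseteq> q" and x: "x \<in> q" "x \<notin> p"
    and g: "indep_mod q I g" "\<And>i. i \<in> I \<Longrightarrow> g i \<in> carrier (poly_ring V)"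
  shows "indep_mod p ({..<D::nat} \<times> I) (\<lambda>(k, i). x ^ k * g i)"
proof -
  interpret p: primeideal p "poly_ring V" by fact
  note qc = poly_ring_ideal_closed[OF q]
  have xc: "x \<in> carrier (poly_ring V)" by (rule qc(7)[OF x(1)])
  define G where "G c k = (\<Sum>i\<in>I. Poly_Mapping.single 0 (c k i) * g i)" for c :: "nat \<Rightarrow> 'i \<Rightarrow> 'k" and k :: nat
  have Gc: "G c k \<in> carrier (poly_ring V)" for c k
    unfolding G_def by (intro poly_ring_sum_closed poly_ring_closed(2) const_in_poly_ring g(2))
  have main: "\<forall>k<D. \<forall>i\<in>I. c k i = 0" if "(\<Sum>k<D. x ^ k * G c k) \<in> p" for c
    using that
  proof (induction D arbitrary: c)
    case 0 then show ?case by simp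
  next
    case (Suc D)
    define c' where "c' k = c (Suc k)" for k
    define S where "S = (\<Sum>k<D. x ^ k * G c' k)"
    have Sc: "S \<in> carrier (poly_ring V)"
      unfolding S_def by (intro poly_ring_sum_closed poly_ring_closed(2) poly_ring_power_closed xc Gc)
    have "(\<Sum>k<Suc D. x ^ k * G c k) = G c 0 + (\<Sum>k<D. x ^ Suc k * G c (Suc k))"
      by (subst sum.lessThan_Suc_shift) simp
    also have "(\<Sum>k<D. x ^ Suc k * G c (Suc k)) = x * S"
      unfolding S_def by (simp add: sum_distrib_left mult.assoc G_def c'_def)
    finally have eq: "(\<Sum>k<Suc D. x ^ k * G c k) = G c 0 + x * S" .
    then have in_q: "G c 0 + x * S \<in> q" using Suc.prems \<open>p \<subseteq> q\<close> by auto
    have "G c 0 = (G c 0 + x * S) - x * S" by simp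
    then have "G c 0 \<in> q" using qc(3)[OF in_q qc(5)[OF x(1) Sc]] by simp
    then have c0: "\<forall>i\<in>I. c 0 i = 0" using g(1) unfolding G_def indep_mod_def by auto
    then have "G c 0 = 0" unfolding G_def by simp
    then have "x * S \<in> p" using Suc.prems eq by simp
    then have "S \<in> p" using p.I_prime[OF xc Sc] x(2) by simp
    then have "\<forall>k<D. \<forall>i\<in>I. c' k i = 0" unfolding S_def by (rule Suc.IH)
    then show ?case using c0 unfolding c'_def by (metis less_Suc_eq_0_disj)
  qed
  show ?thesis
    unfolding indep_mod_def
  proof (intro allI impI ballI)
    fix c ki assume c: "(\<Sum>i\<in>{..<D} \<times> I. Poly_Mapping.single 0 (c i) * (case i of (k, i) \<Rightarrow> x ^ k * g i)) \<in> p"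
      and ki: "ki \<in> {..<D} \<times> I"
    have "(\<Sum>i\<in>{..<D} \<times> I. Poly_Mapping.single 0 (c i) * (case i of (k, i) \<Rightarrow> x ^ k * g i)) =
        (\<Sum>k<D. x ^ k * G (curry c) k)"
      unfolding G_def sum_distrib_left sum.cartesian_product
      by (rule sum.cong) (auto simp: mult_ac)
    then show "c ki = 0" using main[of "curry c"] c ki by auto
  qed
qed

definition degree_le :: "'v set \<Rightarrow> nat \<Rightarrow> ('v, 'k::field) mpoly set" where
  "degree_le V T = {f \<in> carrier (poly_ring V). \<forall>m\<in>Poly_Mapping.keys f. monomial_degree m \<le> T}"

lemma degree_le_mult:
  fixes f g :: "('v, 'k::field) mpoly"
  assumes "f \<in> degree_le V S" "g \<in> degree_le V T"
  shows "f * g \<in> degree_le V (S + T)"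
proof -
  have "f * g \<in> carrier (poly_ring V)"
    using assms poly_ring_closed(2) unfolding degree_le_def by blast
  moreover have "monomial_degree m \<le> S + T" if "m \<in> Poly_Mapping.keys (f * g)" for m
    using that keys_mult[of f g] assms unfolding degree_le_def by (force simp: monomial_degree_add)
  ultimately show ?thesis unfolding degree_le_def by blast
qed

lemma degree_le_mono: "S \<le> T \<Longrightarrow> degree_le V S \<subseteq> degree_le V T"
  unfolding degree_le_def by fastforce

lemma degree_le_power:
  fixes f :: "('v, 'k::field) mpoly"
  assumes "f \<in> degree_le V S"
  shows "f ^ n \<in> degree_le V (n * S)"
proof (induction n)
  case 0 then show ?case by (simp add: degree_le_def monomial_degree_def)
next
  case (Suc n) then show ?case using degree_le_mult[OF assms Suc] by simp
qed

lemma degree_le_exists: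
  fixes f :: "('v, 'k::field) mpoly"
  assumes "f \<in> carrier (poly_ring V)"
  shows "\<exists>T. f \<in> degree_le V T"
proof -
  have "\<forall>m\<in>Poly_Mapping.keys f. monomial_degree m \<le> Max (monomial_degree ` Poly_Mapping.keys f)" by simp
  then show ?thesis using assms unfolding degree_le_def by blast
qed

text \<open>Each step down the chain multiplies the number of independent polynomials by
  \<open>D\<close> and raises the degree by at most \<open>D\<close> times that of the separating
  element \<open>x\<close>. It is essential that \<open>e\<close> is fixed before \<open>D\<close>:
  the degrees grow only linearly in \<open>D\<close>.\<close>

lemma indep_mod_chain:
  fixes c :: "nat \<Rightarrow> ('v, 'k::field) mpoly set"
  assumes "\<And>i. i \<le> m \<Longrightarrow> primeideal (c i) (poly_ring V)" "\<And>i. i < m \<Longrightarrow> c i \<subset> c (Suc i)"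
  shows "\<exists>e. \<forall>D N T g. indep_mod (c m) {..<N::nat} g \<and> g ` {..<N} \<subseteq> degree_le V T \<longrightarrow>
     (\<exists>g'. indep_mod (c 0) {..<D ^ m * N} g' \<and> g' ` {..<D ^ m * N} \<subseteq> degree_le V (T + D * e))"
  using assms
proof (induction m arbitrary: c)
  case 0
  show ?case by (rule exI[of _ 0]) auto
next
  case (Suc m)
  have "\<exists>e. \<forall>D N T g. indep_mod (c (Suc m)) {..<N::nat} g \<and> g ` {..<N} \<subseteq> degree_le V T \<longrightarrow>
     (\<exists>g'. indep_mod (c (Suc 0)) {..<D ^ m * N} g' \<and> g' ` {..<D ^ m * N} \<subseteq> degree_le V (T + D * e))"
    by (rule Suc.IH) (use Suc.prems in auto)
  then obtain e where "\<forall>D N T g. indep_mod (c (Suc m)) {..<N::nat} g \<and> g ` {..<N} \<subseteq> degree_le V T \<longrightarrow>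
     (\<exists>g'. indep_mod (c (Suc 0)) {..<D ^ m * N} g' \<and> g' ` {..<D ^ m * N} \<subseteq> degree_le V (T + D * e))" ..
  note e = this[rule_format, OF conjI, folded One_nat_def]
  have c0: "primeideal (c 0) (poly_ring V)" and c1: "ideal (c 1) (poly_ring V)" and sub: "c 0 \<subset> c 1"
    using Suc.prems(1)[of 0] Suc.prems(1)[of 1] Suc.prems(2)[of 0] primeideal.axioms(1) by auto
  then obtain x where x: "x \<in> c 1" "x \<notin> c 0" by blast
  obtain s where s: "x \<in> degree_le V s" using degree_le_exists poly_ring_ideal_closed(7)[OF c1 x(1)] by blast
  show ?case
  proof (intro exI[of _ "e + s"] allI impI, elim conjE)
    fix D N T g assume g: "indep_mod (c (Suc m)) {..<N::nat} g" "g ` {..<N} \<subseteq> degree_le V T"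
    obtain g' where g': "indep_mod (c 1) {..<D ^ m * N} g'" "g' ` {..<D ^ m * N} \<subseteq> degree_le V (T + D * e)"
      using e[OF g] by blast
    define F where "F = (\<lambda>(k, i). x ^ k * g' i)"
    have ind: "indep_mod (c 0) ({..<D} \<times> {..<D ^ m * N}) F"
      unfolding F_def
      by (rule indep_mod_powers[OF c0 c1 _ x g'(1)]) (use sub g'(2) in \<open>auto simp: degree_le_def\<close>)
    have deg: "F ki \<in> degree_le V (T + D * (e + s))" if ki: "ki \<in> {..<D} \<times> {..<D ^ m * N}" for ki
    proof -
      obtain k i where k: "ki = (k, i)" "k < D" "i < D ^ m * N" using ki by auto
      have "x ^ k * g' i \<in> degree_le V (k * s + (T + D * e))"
        using degree_le_mult[OF degree_le_power[OF s]] g'(2) k by blast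
      moreover have "k * s + (T + D * e) \<le> T + D * (e + s)" using k by (simp add: algebra_simps)
      ultimately have "x ^ k * g' i \<in> degree_le V (T + D * (e + s))" using degree_le_mono by blast
      then show ?thesis unfolding F_def k(1) by simp
    qed
    have "card {..<D ^ Suc m * N} = card ({..<D} \<times> {..<D ^ m * N})"
      by (simp add: card_cartesian_product)
    then obtain b where b: "bij_betw b {..<D ^ Suc m * N} ({..<D} \<times> {..<D ^ m * N})"
      using finite_same_card_bij[of "{..<D ^ Suc m * N}" "{..<D} \<times> {..<D ^ m * N}"] by auto
    show "\<exists>g'. indep_mod (c 0) {..<D ^ Suc m * N} g' \<and> g' ` {..<D ^ Suc m * N} \<subseteq> degree_le V (T + D * (e + s))"
    proof (intro exI conjI)
      show "indep_mod (c 0) {..<D ^ Suc m * N} (F \<circ> b)" by (rule indep_mod_reindex[OF ind b])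
      show "(F \<circ> b) ` {..<D ^ Suc m * N} \<subseteq> degree_le V (T + D * (e + s))"
        unfolding image_comp[symmetric] bij_betw_imp_surj_on[OF b] using deg by blast
    qed
  qed
qed

text \<open>Bounding every exponent instead of the degree makes the count an exact power, which
  serves both for the lower bound in \<open>U\<close> and for the upper bound in
  \<open>V\<close>.\<close>

lemma card_monomials_bounded:
  assumes "finite V"
  shows "finite {m \<in> monomials V. \<forall>v. Poly_Mapping.lookup m v < T}"
    and "card {m \<in> monomials V. \<forall>v. Poly_Mapping.lookup m v < T} \<le> T ^ card V"
    and "T > 0 \<Longrightarrow> card {m \<in> monomials V. \<forall>v. Poly_Mapping.lookup m v < T} = T ^ card V"
proof -
  let ?M = "{m \<in> monomials V. \<forall>v. Poly_Mapping.lookup m v < T}"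
  let ?P = "PiE V (\<lambda>_. {..<T})"
  let ?f = "\<lambda>m. restrict (Poly_Mapping.lookup m) V"
  have fin: "finite ?P" and card: "card ?P = T ^ card V" using assms by (simp_all add: finite_PiE card_PiE)
  have inj: "inj_on ?f ?M"
  proof (rule inj_onI)
    fix m n assume mn: "m \<in> ?M" "n \<in> ?M" "?f m = ?f n"
    show "m = n"
    proof (rule poly_mapping_eqI)
      fix v show "Poly_Mapping.lookup m v = Poly_Mapping.lookup n v"
      proof (cases "v \<in> V")
        case True then show ?thesis using fun_cong[OF mn(3), of v] by simp
      next
        case False
        then have "v \<notin> Poly_Mapping.keys m" "v \<notin> Poly_Mapping.keys n"
          using mn(1,2) unfolding monomials_def by auto
        then show ?thesis by (simp add: in_keys_iff)
      qed
    qed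
  qed
  have sub: "?f ` ?M \<subseteq> ?P" by auto
  show "finite ?M" using inj sub fin by (rule inj_on_finite)
  show "card ?M \<le> T ^ card V" using card_inj_on_le[OF inj sub fin] card by simp
  assume T: "T > 0"
  have "?P \<subseteq> ?f ` ?M"
  proof
    fix a assume a: "a \<in> ?P"
    define m where "m = Abs_poly_mapping (\<lambda>v. if v \<in> V then a v else 0)"
    have l: "Poly_Mapping.lookup m = (\<lambda>v. if v \<in> V then a v else 0)"
      unfolding m_def by (rule lookup_Abs_poly_mapping) (use assms in auto)
    have "m \<in> ?M" using a T by (auto simp: l monomials_def in_keys_iff split: if_splits)
    moreover have "a = ?f m" using a by (auto simp: l fun_eq_iff PiE_def extensional_def)
    ultimately show "a \<in> ?f ` ?M" by blast
  qed
  then have "?f ` ?M = ?P" using sub by blast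
  then show "card ?M = T ^ card V" using card_image[OF inj] card by simp
qed

lemma monomial_degree_ge: "Poly_Mapping.lookup m v \<le> monomial_degree m"
proof (cases "v \<in> Poly_Mapping.keys m")
  case True
  then show ?thesis unfolding monomial_degree_def by (intro member_le_sum) auto
qed (simp add: in_keys_iff)

text \<open>As \<open>0\<close> lies in \<open>p\<close>, independence modulo \<open>p\<close>
  implies independence. The polynomials live in the span of the monomials whose exponents are all at
  most \<open>T\<close>, and the dimension of that span bounds their number.\<close>

lemma indep_mod_card_le:
  fixes g :: "nat \<Rightarrow> ('v, 'k::field) mpoly"
  assumes V: "finite V" and p: "0 \<in> p" and ind: "indep_mod p {..<N} g" and g: "g ` {..<N} \<subseteq> degree_le V T"
  shows "N \<le> Suc T ^ card V"
proof -
  interpret vs: vector_space "\<lambda>(c::'k) f. Poly_Mapping.single 0 c * (f :: ('v, 'k) mpoly)"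
    by standard (simp_all add: algebra_simps single_add mult_single flip: mult.assoc)
  have ind0: "\<forall>i<N. c i = 0" if "(\<Sum>i<N. Poly_Mapping.single 0 (c i) * g i) = 0" for c
    using ind[unfolded indep_mod_def, THEN spec, of c] p unfolding that by blast
  have inj: "inj_on g {..<N}"
  \<comment> \<open>Independence in \<open>vector_space\<close> is about sets, so repetitions in the
    family are excluded first, by the combination with coefficients \<open>1\<close> and
    \<open>- 1\<close>.\<close>
  proof (rule inj_onI, rule ccontr)
    fix i j assume ij: "i \<in> {..<N}" "j \<in> {..<N}" "g i = g j" "i \<noteq> j"
    define c where "c = (\<lambda>k. if k = i then (1::'k) else if k = j then - 1 else 0)"
    have "(\<Sum>k<N. Poly_Mapping.single 0 (c k) * g k) = (\<Sum>k\<in>{i, j}. Poly_Mapping.single 0 (c k) * g k)"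
      by (rule sum.mono_neutral_right) (use ij in \<open>auto simp: c_def\<close>)
    also have "\<dots> = 0" using ij by (simp add: c_def single_uminus)
    finally show False using ind0[of c] ij by (auto simp: c_def)
  qed
  have indep: "vs.independent (g ` {..<N})"
  proof
    assume "vs.dependent (g ` {..<N})"
    then obtain u where u: "\<exists>v\<in>g ` {..<N}. u v \<noteq> 0" "(\<Sum>v\<in>g ` {..<N}. Poly_Mapping.single 0 (u v) * v) = 0"
      using vs.dependent_finite[of "g ` {..<N}"] by auto
    then have "(\<Sum>i<N. Poly_Mapping.single 0 (u (g i)) * g i) = 0" by (simp add: sum.reindex[OF inj])
    then show False using ind0[of "u \<circ> g"] u(1) by auto
  qed
  let ?M = "{m \<in> monomials V. \<forall>v. Poly_Mapping.lookup m v < Suc T}"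
  let ?B = "(\<lambda>m. Poly_Mapping.single m (1::'k)) ` ?M"
  have span: "g ` {..<N} \<subseteq> vs.span ?B"
  proof
    fix f assume "f \<in> g ` {..<N}"
    then have f: "f \<in> degree_le V T" using g by blast
    have "Poly_Mapping.single t (Poly_Mapping.lookup f t) \<in> vs.span ?B" if "t \<in> Poly_Mapping.keys f" for t
    proof -
      have "t \<in> ?M" using f that monomial_degree_ge[of t]
        unfolding degree_le_def by (auto simp: less_Suc_eq_le intro: order_trans)
      then have "Poly_Mapping.single 0 (Poly_Mapping.lookup f t) * Poly_Mapping.single t 1 \<in> vs.span ?B"
        by (intro vs.span_scale vs.span_base) blast
      then show ?thesis by (simp add: mult_single)
    qed
    then show "f \<in> vs.span ?B" by (subst poly_eq_sum_single[of f]) (rule vs.span_sum)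
  qed
  have "card (g ` {..<N}) \<le> card ?B"
    using vs.independent_span_bound[OF finite_imageI[OF card_monomials_bounded(1)[OF V]] indep span] ..
  also have "\<dots> \<le> card ?M" by (rule card_image_le[OF card_monomials_bounded(1)[OF V]])
  also have "\<dots> \<le> Suc T ^ card V" by (rule card_monomials_bounded(2)[OF V])
  finally show ?thesis using card_image[OF inj] by simp
qed

lemma monomial_degree_le:
  assumes "finite U" "m \<in> monomials U" "\<And>v. Poly_Mapping.lookup m v < D"
  shows "monomial_degree m \<le> card U * D"
proof -
  have "monomial_degree m \<le> (\<Sum>v\<in>Poly_Mapping.keys m. D)"
    unfolding monomial_degree_def by (rule sum_mono) (simp add: assms(3) less_imp_le)
  also have "\<dots> = card (Poly_Mapping.keys m) * D" by simp
  also have "\<dots> \<le> card U * D"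
    using assms by (intro mult_right_mono card_mono) (auto simp: monomials_def)
  finally show ?thesis .
qed

text \<open>Growth argument: \<open>D ^ (m + card U)\<close> polynomials of degree \<open>O(D)\<close> are linearly independent
  modulo the bottom prime, but the polynomials of degree at most \<open>T\<close> form a space of dimension
  at most \<open>(T + 1) ^ card V\<close>.\<close>

lemma prime_height_push_kernel_le:
  fixes h :: "'v monomial \<Rightarrow> 'g" and V U :: "'v set"
  assumes V: "finite V" "U \<subseteq> V" and h: "inj_on h (monomials U)"
  defines "p \<equiv> {f \<in> carrier (poly_ring V). push h f = (0 :: 'g \<Rightarrow>\<^sub>0 'k::field)}"
  shows "prime_height (poly_ring V) p \<le> enat (card V - card U)"
  unfolding prime_height_def
proof (rule Sup_least)
  fix x assume "x \<in> {enat n |n. \<exists>c. (\<forall>i\<le>n. primeideal (c i) (poly_ring V)) \<and> (\<forall>i<n. c i \<subset> c (Suc i)) \<and> c n = p}"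
  then obtain m c where x: "x = enat m" and prime: "\<And>i. i \<le> m \<Longrightarrow> primeideal (c i) (poly_ring V)"
    and strict: "\<And>i. i < m \<Longrightarrow> c i \<subset> c (Suc i)" and cm: "c m = p" by auto
  have U: "finite U" using V finite_subset by blast
  obtain e where "\<forall>D N T g. indep_mod p {..<N::nat} g \<and> g ` {..<N} \<subseteq> degree_le V T \<longrightarrow>
     (\<exists>g'. indep_mod (c 0) {..<D ^ m * N} g' \<and> g' ` {..<D ^ m * N} \<subseteq> degree_le V (T + D * e))"
    using indep_mod_chain[of m c V, OF prime strict] unfolding cm ..
  note e = this[rule_format, OF conjI]
  have bound: "D ^ (m + card U) \<le> Suc (D * (card U + e)) ^ card V" if D: "D > 0" for D
  proof -
    let ?M = "{t \<in> monomials U. \<forall>v. Poly_Mapping.lookup t v < D}"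
    note M = card_monomials_bounded(1)[OF U, of D] card_monomials_bounded(3)[OF U D]
    \<comment> \<open>The monomials of the box have distinct images under \<open>h\<close>, so
      nothing cancels in the image of a linear combination.\<close>
    have ind: "indep_mod p ?M (\<lambda>t. Poly_Mapping.single t 1)"
      unfolding indep_mod_def
    proof (intro allI impI ballI)
      fix a :: "'v monomial \<Rightarrow> 'k" and s
      assume a: "(\<Sum>t\<in>?M. Poly_Mapping.single 0 (a t) * Poly_Mapping.single t 1) \<in> p" and s: "s \<in> ?M"
      have "(\<Sum>t\<in>?M. Poly_Mapping.single (h t) (a t)) = 0"
        using a unfolding p_def by (simp add: push_sum mult_single)
      then have "(\<Sum>t\<in>?M. Poly_Mapping.lookup (Poly_Mapping.single (h t) (a t)) (h s)) = 0"
        by (simp only: lookup_sum[symmetric] lookup_zero)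
      moreover have "(\<Sum>t\<in>?M. Poly_Mapping.lookup (Poly_Mapping.single (h t) (a t)) (h s))
          = (\<Sum>t\<in>?M. if t = s then a s else 0)"
      proof (rule sum.cong)
        fix t assume "t \<in> ?M"
        then have "h t = h s \<longleftrightarrow> t = s" using s by (intro inj_on_eq_iff[OF h]) auto
        then show "Poly_Mapping.lookup (Poly_Mapping.single (h t) (a t)) (h s) = (if t = s then a s else 0)"
          by (auto simp: lookup_single when_def)
      qed simp
      ultimately show "a s = 0" using s M(1) by (simp add: sum.delta)
    qed
    have deg: "Poly_Mapping.single t (1::'k) \<in> degree_le V (card U * D)" if "t \<in> ?M" for t
      using that monomial_degree_le[OF U, of t D] V(2) unfolding degree_le_def by (auto simp: monomials_def)
    obtain b where b: "bij_betw b {..<D ^ card U} ?M"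
      using finite_same_card_bij[OF finite_lessThan M(1), of "D ^ card U"] M(2) by auto
    let ?g = "(\<lambda>t. Poly_Mapping.single t (1::'k)) \<circ> b"
    have g: "indep_mod p {..<D ^ card U} ?g" by (rule indep_mod_reindex[OF ind b])
    have gd: "?g ` {..<D ^ card U} \<subseteq> degree_le V (card U * D)"
      unfolding image_comp[symmetric] bij_betw_imp_surj_on[OF b] using deg by blast
    obtain g' where g': "indep_mod (c 0) {..<D ^ m * D ^ card U} g'"
        "g' ` {..<D ^ m * D ^ card U} \<subseteq> degree_le V (card U * D + D * e)"
      using e[OF g gd, of D] by blast
    have "0 \<in> c 0" using poly_ring_ideal_closed(6)[OF primeideal.axioms(1)[OF prime[of 0]]] by simp
    from indep_mod_card_le[OF V(1) this g'] show ?thesis by (simp add: power_add algebra_simps)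
  qed
  have "m + card U \<le> card V"
  proof (rule ccontr)
    assume *: "\<not> m + card U \<le> card V"
    \<comment> \<open>The successor in \<open>C\<close> absorbs the one in \<open>bound\<close>,
      because \<open>D\<close> is positive. Comparing powers of \<open>D\<close> then gives
      \<open>D \<le> C ^ card V\<close>, and \<open>D\<close> is chosen one larger than
      that.\<close>
    define C where "C = Suc (card U + e)"
    define D where "D = Suc (C ^ card V)"
    have "D * D ^ card V = D ^ Suc (card V)" by simp
    also have "\<dots> \<le> D ^ (m + card U)" by (rule power_increasing) (use * in \<open>auto simp: D_def\<close>)
    also have "\<dots> \<le> Suc (D * (card U + e)) ^ card V" by (rule bound) (simp add: D_def)
    also have "\<dots> \<le> (D * C) ^ card V" by (rule power_mono) (simp_all add: C_def D_def)
    also have "\<dots> = C ^ card V * D ^ card V" by (simp add: power_mult_distrib)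
    finally have "D \<le> C ^ card V" by (simp add: D_def)
    then show False by (simp add: D_def)
  qed
  then show "x \<le> enat (card V - card U)" using x by simp
qed

section \<open>Cycles of adjacent cells\<close>

lemma cell_at_eq: "cell_at (i, j) = {(i, j), (Suc i, j), (i, Suc j), (Suc i, Suc j)}"
  by (auto simp: cell_at_def less_eq_prod_def)

lemma in_cell_at: "(x, y) \<in> cell_at (i, j) \<longleftrightarrow> i \<le> x \<and> x \<le> Suc i \<and> j \<le> y \<and> y \<le> Suc j"
  by (auto simp: cell_at_def less_eq_prod_def)

lemma inj_cell_at: "inj cell_at"
proof (rule injI)
  fix a b :: point assume eq: "cell_at a = cell_at b"
  have "a \<in> cell_at a" "b \<in> cell_at b" by (auto simp: cell_at_def less_eq_prod_def)
  then have "a \<in> cell_at b" "b \<in> cell_at a" using eq by simp_all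
  then show "a = b" by (cases a; cases b) (auto simp: in_cell_at)
qed

lemma edgesE:
  assumes "E \<in> edges C"
  obtains p q where "p \<in> C" "q \<in> C" "p \<noteq> q" "adjacent p q" "E = {p, q}"
  using assms unfolding edges_def adjacent_def by (auto simp: prod_eq_iff)

lemma adjacent_iff:
  "adjacent (i, j) (k, l) \<longleftrightarrow> i = k \<and> (l = Suc j \<or> j = Suc l) \<or> j = l \<and> (k = Suc i \<or> i = Suc k)"
  by (auto simp: adjacent_def)

lemma cell_at_common_edge:
  assumes "cell_at a \<inter> cell_at b \<in> edges (cell_at a)" "a \<noteq> b"
  shows "adjacent a b"
proof -
  obtain i j k l where ab: "a = (i, j)" "b = (k, l)" by (cases a, cases b)
  obtain p q where pq: "p \<in> cell_at a \<inter> cell_at b" "q \<in> cell_at a \<inter> cell_at b" "adjacent p q"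
    using assms(1) by (elim edgesE) auto
  obtain x y x' y' where xy: "p = (x, y)" "q = (x', y')" by (cases p, cases q)
  have b: "i \<le> x" "x \<le> Suc i" "j \<le> y" "y \<le> Suc j" "k \<le> x" "x \<le> Suc k" "l \<le> y" "y \<le> Suc l"
    "i \<le> x'" "x' \<le> Suc i" "j \<le> y'" "y' \<le> Suc j" "k \<le> x'" "x' \<le> Suc k" "l \<le> y'" "y' \<le> Suc l"
    using pq(1,2) unfolding ab xy by (simp_all add: in_cell_at)
  have ne: "i \<noteq> k \<or> j \<noteq> l" using assms(2) ab by simp
  from pq(3) consider "x = x'" "y' = Suc y \<or> y = Suc y'" | "y = y'" "x' = Suc x \<or> x = Suc x'"
    unfolding xy adjacent_iff by blast
  then show ?thesis
  proof cases
    case 1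
    then have "j = l" using b by linarith
    moreover have "k = Suc i \<or> i = Suc k" using ne \<open>j = l\<close> b(1,2,5,6) by linarith
    ultimately show ?thesis unfolding ab adjacent_iff by simp
  next
    case 2
    then have "i = k" using b by linarith
    moreover have "l = Suc j \<or> j = Suc l" using ne \<open>i = k\<close> b(3,4,7,8) by linarith
    ultimately show ?thesis unfolding ab adjacent_iff by simp
  qed
qed

section \<open>Cycles modulo 2 and their potentials\<close>

text \<open>A set of adjacencies between cells is given by two sets of points: \<open>a \<in> H\<close> stands for the pair
  of the cell at \<open>a\<close> and the one below, \<open>a \<in> W\<close> for the pair of the cell at \<open>a\<close> and the one to its
  left. Dually, these are the lattice edges from \<open>a\<close> to the right and from \<open>a\<close> upwards.\<close>

definition vert_adj :: "point set \<Rightarrow> point set" where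
  "vert_adj A = {(i, Suc j) | i j. (i, j) \<in> A \<and> (i, Suc j) \<in> A}"

definition horiz_adj :: "point set \<Rightarrow> point set" where
  "horiz_adj A = {(Suc i, j) | i j. (i, j) \<in> A \<and> (Suc i, j) \<in> A}"

text \<open>The boundary modulo 2: the four memberships belong to the lower, upper, left and right
  side of the cell at \<open>(i, j)\<close>. A pair \<open>H\<close>, \<open>W\<close> for which
  this is nowhere true is a cycle.\<close>

fun odd_deg :: "point set \<Rightarrow> point set \<Rightarrow> point \<Rightarrow> bool" where
  "odd_deg H W (i, j) \<longleftrightarrow> (((i, j) \<in> H) \<noteq> ((i, Suc j) \<in> H)) \<noteq> (((i, j) \<in> W) \<noteq> ((Suc i, j) \<in> W))"

text \<open>The parity of the members of \<open>H\<close> among the lattice edges from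
  \<open>(0, j)\<close> to \<open>(i, j)\<close>. It tells on which side of the cycle a vertex
  lies.\<close>

primrec potential :: "point set \<Rightarrow> nat \<Rightarrow> nat \<Rightarrow> bool" where
  "potential H 0 j \<longleftrightarrow> False"
| "potential H (Suc i) j \<longleftrightarrow> potential H i j \<noteq> ((i, j) \<in> H)"

text \<open>Even degree means that the changes along the four sides of each cell cancel. Starting
  from the left margin, where nothing changes, the vertical changes are forced column by
  column.\<close>

lemma potential_up:
  assumes "\<And>a. \<not> odd_deg H W a" "\<And>j. (0, j) \<notin> W"
  shows "(potential H i j \<noteq> potential H i (Suc j)) \<longleftrightarrow> (i, j) \<in> W"
proof (induction i)
  case 0 then show ?case using assms(2) by simp
next
  case (Suc i)
  then show ?case using assms(1)[of "(i, j)"] by auto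
qed

text \<open>A cycle of adjacencies is the boundary of the set of vertices on which \<open>u\<close> is true.\<close>

lemma cycle_potential:
  assumes "\<And>a. \<not> odd_deg H W a" "H \<subseteq> vert_adj A" "W \<subseteq> horiz_adj A"
  shows "\<exists>u :: point \<Rightarrow> bool. (\<forall>i j. (u (i, j) \<noteq> u (Suc i, j)) \<longleftrightarrow> (i, j) \<in> H) \<and>
    (\<forall>i j. (u (i, j) \<noteq> u (i, Suc j)) \<longleftrightarrow> (i, j) \<in> W) \<and>
    (\<forall>c x y. c \<notin> A \<longrightarrow> x \<in> cell_at c \<longrightarrow> y \<in> cell_at c \<longrightarrow> u x = u y)"
proof -
  let ?u = "\<lambda>(i, j). potential H i j"
  have W0: "(0, j) \<notin> W" for j using assms(3) by (auto simp: horiz_adj_def)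
  have H: "(?u (i, j) \<noteq> ?u (Suc i, j)) \<longleftrightarrow> (i, j) \<in> H" for i j by auto
  have W: "(?u (i, j) \<noteq> ?u (i, Suc j)) \<longleftrightarrow> (i, j) \<in> W" for i j
    using potential_up[OF assms(1) W0] by simp
  have "?u x = ?u y" if c: "c \<notin> A" and "x \<in> cell_at c" "y \<in> cell_at c" for c x y
  proof -
    obtain i j where ij: "c = (i, j)" by (cases c)
    \<comment> \<open>Both cells of an adjacency are in \<open>A\<close>, so no side of a cell
      outside \<open>A\<close> is an edge of the cycle.\<close>
    have "(i, j) \<notin> H" "(i, Suc j) \<notin> H" "(i, j) \<notin> W" "(Suc i, j) \<notin> W"
      using c assms(2,3) unfolding ij vert_adj_def horiz_adj_def by auto
    then have "?u (i, j) = ?u (Suc i, j)" "?u (i, Suc j) = ?u (Suc i, Suc j)"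
      "?u (i, j) = ?u (i, Suc j)" "?u (Suc i, j) = ?u (Suc i, Suc j)"
      using H[of i j] H[of i "Suc j"] W[of i j] W[of "Suc i" j] by blast+
    then show ?thesis using that(2,3) unfolding ij cell_at_eq by auto
  qed
  then show ?thesis using H W by blast
qed

lemma chain_constant:
  assumes "\<And>i. Suc i < length Cs \<Longrightarrow> Cs ! i \<inter> Cs ! Suc i \<noteq> {}"
    and "\<And>C x y. C \<in> set Cs \<Longrightarrow> x \<in> C \<Longrightarrow> y \<in> C \<Longrightarrow> u x = u y"
    and "n < length Cs" "x \<in> Cs ! 0" "y \<in> Cs ! n"
  shows "u x = u y"
  using assms(3,5)
proof (induction n arbitrary: y)
  case 0
  show ?case by (rule assms(2)[OF nth_mem[OF 0(1)] assms(4) 0(2)])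
next
  case (Suc n)
  obtain z where z: "z \<in> Cs ! n" "z \<in> Cs ! Suc n" using assms(1)[OF Suc.prems(1)] by blast
  have "u x = u z" by (rule Suc.IH[OF Suc_lessD[OF Suc.prems(1)] z(1)])
  also have "u z = u y" by (rule assms(2)[OF nth_mem[OF Suc.prems(1)] z(2) Suc.prems(2)])
  finally show ?case .
qed

text \<open>Two common points are recorded because \<open>separated_contradiction\<close> needs one
  that differs from a given vertex.\<close>

lemma cell_path_inter:
  assumes "cell_path Cs C D" "Suc i < length Cs"
  obtains p q where "p \<noteq> q" "p \<in> Cs ! i" "q \<in> Cs ! i" "p \<in> Cs ! Suc i" "q \<in> Cs ! Suc i"
proof -
  have E: "Cs ! i \<inter> Cs ! Suc i \<in> edges (Cs ! i)" using assms unfolding cell_path_def by blast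
  then obtain p q where "p \<noteq> q" "Cs ! i \<inter> Cs ! Suc i = {p, q}" by (elim edgesE)
  then show ?thesis using that by blast
qed

text \<open>The potential is constant on each cell outside \<open>A\<close> and hence, by
  connectedness of the complement, on their union. This union contains every lattice point: thinness
  supplies a cell of the complement around an inner point, positivity around a point on an axis. A
  constant potential has no boundary.\<close>

lemma no_cycle:
  assumes conn: "path_connected_cells (cells - P)" and thin: "thin P"
    and A: "A = {a. cell_at a \<in> P}" and pos: "A \<subseteq> {1..} \<times> {1..}"
    and Z: "\<And>a. \<not> odd_deg H W a" "H \<subseteq> vert_adj A" "W \<subseteq> horiz_adj A"
  shows "H = {} \<and> W = {}"
proof -
  obtain u :: "point \<Rightarrow> bool" where "\<forall>i j. (u (i, j) \<noteq> u (Suc i, j)) \<longleftrightarrow> (i, j) \<in> H"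
    "\<forall>i j. (u (i, j) \<noteq> u (i, Suc j)) \<longleftrightarrow> (i, j) \<in> W"
    "\<forall>c x y. c \<notin> A \<longrightarrow> x \<in> cell_at c \<longrightarrow> y \<in> cell_at c \<longrightarrow> u x = u y"
    using cycle_potential[OF Z] by blast
  note u = this[rule_format]
  have out: "\<exists>c. c \<notin> A \<and> x \<in> cell_at c" for x
  proof -
    obtain i j where x: "x = (i, j)" by (cases x)
    show ?thesis
    proof (cases "i = 0 \<or> j = 0")
      case True
      then have "x \<notin> A" using pos x by auto
      then show ?thesis using x by (auto simp: cell_at_eq)
    next
      case False
      then obtain k l where kl: "i = Suc k" "j = Suc l" by (auto simp: gr0_conv_Suc)
      have "\<not> {cell_at (k, l), cell_at ((k, l) + (1, 0)), cell_at ((k, l) + (0, 1)), cell_at ((k, l) + (1, 1))} \<subseteq> P"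
        using thin unfolding thin_def by blast
      then have "(k, l) \<notin> A \<or> (Suc k, l) \<notin> A \<or> (k, Suc l) \<notin> A \<or> (Suc k, Suc l) \<notin> A" by (auto simp: A)
      then show ?thesis unfolding x kl by (elim disjE) (rule exI, rule conjI, assumption, simp add: cell_at_eq)+
    qed
  qed
  have const: "u x = u y" for x y
  proof -
    obtain c d where c: "c \<notin> A" "x \<in> cell_at c" and d: "d \<notin> A" "y \<in> cell_at d" using out by blast
    then have "cell_at c \<in> cells - P" "cell_at d \<in> cells - P" unfolding A cells_def by auto
    then obtain Cs where Cs: "cell_path Cs (cell_at c) (cell_at d)" "set Cs \<subseteq> cells - P"
      using conn unfolding path_connected_cells_def by blast
    have ne: "Cs \<noteq> []" "Cs ! 0 = cell_at c" "Cs ! (length Cs - 1) = cell_at d"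
      using Cs(1) unfolding cell_path_def by (auto simp: hd_conv_nth last_conv_nth)
    show ?thesis
    proof (rule chain_constant[of Cs u "length Cs - 1" x y])
      show "Cs ! i \<inter> Cs ! Suc i \<noteq> {}" if "Suc i < length Cs" for i
        using cell_path_inter[OF Cs(1) that] by blast
      show "u x = u y" if C: "C \<in> set Cs" "x \<in> C" "y \<in> C" for C x y
      proof -
        obtain a where "C = cell_at a" "a \<notin> A" using C(1) Cs(2) unfolding cells_def A by auto
        then show ?thesis using u(3) C by blast
      qed
    qed (use ne c d in auto)
  qed
  show ?thesis using u(1,2) const by auto
qed

section \<open>Fewer adjacencies than cells\<close>

lemma adj_subset: "vert_adj A \<subseteq> A" "horiz_adj A \<subseteq> A"
  by (auto simp: vert_adj_def horiz_adj_def)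

text \<open>Summing the degrees of all cells counts every adjacency twice, once from either
  cell.\<close>

lemma handshake:
  assumes A: "finite A" and H: "H \<subseteq> vert_adj A" and W: "W \<subseteq> horiz_adj A"
  shows "even (card {a \<in> A. odd_deg H W a})"
proof -
  have HA: "H \<subseteq> A" and WA: "W \<subseteq> A" using H W adj_subset by blast+
  then have fin: "finite H" "finite W" using A finite_subset by blast+
  let ?f = "\<lambda>(i, j). of_bool ((i, j) \<in> H) + of_bool ((i, Suc j) \<in> H) + of_bool ((i, j) \<in> W) + of_bool ((Suc i, j) \<in> W) :: nat"
  \<comment> \<open>An adjacency in \<open>H\<close> is indexed by its upper cell; the shift by one
    recounts \<open>H\<close> from the lower cells. The same is done for \<open>W\<close> with right
    and left cells.\<close>
  have below: "(\<Sum>a\<in>A. of_bool ((fst a, Suc (snd a)) \<in> H) :: nat) = card H"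
  proof -
    have "H = (\<lambda>a. (fst a, Suc (snd a))) ` {a \<in> A. (fst a, Suc (snd a)) \<in> H}"
      using H unfolding vert_adj_def by force
    moreover have "inj (\<lambda>a :: point. (fst a, Suc (snd a)))" by (auto simp: inj_def prod_eq_iff)
    ultimately have "card {a \<in> A. (fst a, Suc (snd a)) \<in> H} = card H"
      by (metis (no_types, lifting) card_image inj_on_subset subset_UNIV)
    then show ?thesis using A by (simp add: Int_def)
  qed
  have left: "(\<Sum>a\<in>A. of_bool ((Suc (fst a), snd a) \<in> W) :: nat) = card W"
  proof -
    have "W = (\<lambda>a. (Suc (fst a), snd a)) ` {a \<in> A. (Suc (fst a), snd a) \<in> W}"
      using W unfolding horiz_adj_def by force
    moreover have "inj (\<lambda>a :: point. (Suc (fst a), snd a))" by (auto simp: inj_def prod_eq_iff)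
    ultimately have "card {a \<in> A. (Suc (fst a), snd a) \<in> W} = card W"
      by (metis (no_types, lifting) card_image inj_on_subset subset_UNIV)
    then show ?thesis using A by (simp add: Int_def)
  qed
  have self: "(\<Sum>a\<in>A. of_bool (a \<in> X) :: nat) = card X" if "X \<subseteq> A" for X
    using A that by (simp add: Int_absorb1)
  have "(\<Sum>a\<in>A. ?f a) = (\<Sum>a\<in>A. of_bool (a \<in> H) + of_bool ((fst a, Suc (snd a)) \<in> H)
      + of_bool (a \<in> W) + of_bool ((Suc (fst a), snd a) \<in> W))"
    by (rule sum.cong) auto
  also have "\<dots> = 2 * (card H + card W)"
    unfolding sum.distrib self[OF HA] self[OF WA] below left by simp
  finally have "even (\<Sum>a\<in>A. ?f a)" by simp
  then have "even (card {a \<in> A. odd (?f a)})" by (subst (asm) even_sum_iff[OF A])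
  moreover have "{a \<in> A. odd (?f a)} = {a \<in> A. odd_deg H W a}" by auto
  ultimately show ?thesis by simp
qed

text \<open>If there were at least as many adjacencies as cells, then two sets of adjacencies would have the
  same boundary modulo 2 and their symmetric difference would be a cycle.\<close>

lemma card_adj_less:
  assumes conn: "path_connected_cells (cells - P)" and thin: "thin P"
    and A: "A = {a. cell_at a \<in> P}" "finite A" "A \<noteq> {}" and pos: "A \<subseteq> {1..} \<times> {1..}"
  shows "card (vert_adj A) + card (horiz_adj A) < card A"
proof (rule ccontr)
  assume less: "\<not> ?thesis"
  have fin: "finite (vert_adj A)" "finite (horiz_adj A)"
    using finite_subset[OF adj_subset(1) A(2)] finite_subset[OF adj_subset(2) A(2)] .
  obtain a0 where a0: "a0 \<in> A" using A(3) by blast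
  let ?S = "Pow (vert_adj A) \<times> Pow (horiz_adj A)"
  \<comment> \<open>The parity at \<open>a0\<close> follows from the others by
    \<open>handshake\<close>. Leaving it out halves the number of possible boundaries, which makes
    the pigeonhole principle apply when adjacencies and cells are equally many.\<close>
  define f where "f = (\<lambda>(H, W). {a \<in> A - {a0}. odd_deg H W a})"
  have "card (Pow (A - {a0})) = 2 ^ (card A - 1)" using A(2) a0 by (simp add: card_Pow)
  also have "\<dots> < 2 ^ card A" using A(2,3) by (simp add: card_gt_0_iff)
  also have "\<dots> \<le> 2 ^ (card (vert_adj A) + card (horiz_adj A))" by (rule power_increasing) (use less in auto)
  also have "\<dots> = card ?S" using fin by (simp add: card_cartesian_product card_Pow power_add)
  finally have less_card: "card (Pow (A - {a0})) < card ?S" .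
  have sub: "f ` ?S \<subseteq> Pow (A - {a0})" by (auto simp: f_def)
  have "\<not> inj_on f ?S"
  proof
    assume "inj_on f ?S"
    then have "card ?S \<le> card (Pow (A - {a0}))" using card_inj_on_le[OF _ sub] A(2) by blast
    then show False using less_card by linarith
  qed
  then obtain s t where st: "s \<in> ?S" "t \<in> ?S" "s \<noteq> t" "f s = f t" unfolding inj_on_def by blast
  obtain H1 W1 H2 W2 where eqs: "s = (H1, W1)" "t = (H2, W2)" by (cases s, cases t)
  have HW: "H1 \<subseteq> vert_adj A" "W1 \<subseteq> horiz_adj A" "H2 \<subseteq> vert_adj A" "W2 \<subseteq> horiz_adj A"
    "(H1, W1) \<noteq> (H2, W2)" and eq: "{a \<in> A - {a0}. odd_deg H1 W1 a} = {a \<in> A - {a0}. odd_deg H2 W2 a}"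
    using st unfolding eqs f_def by simp_all
  define H W where "H = (H1 - H2) \<union> (H2 - H1)" and "W = (W1 - W2) \<union> (W2 - W1)"
  have sub: "H \<subseteq> vert_adj A" "W \<subseteq> horiz_adj A" using HW unfolding H_def W_def by blast+
  have add: "odd_deg H W a \<longleftrightarrow> odd_deg H1 W1 a \<noteq> odd_deg H2 W2 a" for a
    by (cases a) (auto simp: H_def W_def)
  have outside: "\<not> odd_deg H W a" if "a \<notin> A" for a
    using that sub unfolding vert_adj_def horiz_adj_def by (cases a) auto
  have other: "\<not> odd_deg H W a" if "a \<in> A" "a \<noteq> a0" for a
    using eq that unfolding add by blast
  have "\<not> odd_deg H W a0"
  proof
    assume "odd_deg H W a0"
    then have "{a \<in> A. odd_deg H W a} = {a0}" using other a0 by blast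
    then show False using handshake[OF A(2) sub] by simp
  qed
  then have "\<not> odd_deg H W a" for a using outside other by blast
  then have "H = {} \<and> W = {}" by (rule no_cycle[OF conn thin A(1) pos _ sub])
  then show False using HW(5) unfolding H_def W_def by blast
qed

section \<open>Paths and corner contacts\<close>

definition adj_rel :: "point set \<Rightarrow> point rel" where
  "adj_rel A = {(a, b). a \<in> A \<and> b \<in> A \<and> adjacent a b}"

lemma adjacent_cases:
  assumes "adjacent a b"
  obtains i j where "a = (i, j)" "b = (Suc i, j)" | i j where "a = (i, j)" "b = (i, Suc j)"
    | i j where "b = (i, j)" "a = (Suc i, j)" | i j where "b = (i, j)" "a = (i, Suc j)"
  using assms by (cases a; cases b) (auto simp: adjacent_def)

text \<open>The adjacencies of a walk are added modulo 2, since a walk may use one repeatedly; the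
  contributions at its inner cells cancel. For \<open>c = d\<close> nothing is odd.\<close>

lemma path_boundary:
  assumes "(c, d) \<in> (adj_rel A)\<^sup>*"
  shows "\<exists>H W. H \<subseteq> vert_adj A \<and> W \<subseteq> horiz_adj A \<and> (\<forall>a. odd_deg H W a \<longleftrightarrow> (a = c) \<noteq> (a = d))"
  using assms
proof (induction rule: rtrancl_induct)
  case base
  have "odd_deg {} {} a \<longleftrightarrow> False" for a by (cases a) simp
  then show ?case by (intro exI[of _ "{}"]) auto
next
  case (step d e)
  then obtain H W where HW: "H \<subseteq> vert_adj A" "W \<subseteq> horiz_adj A" "\<And>a. odd_deg H W a \<longleftrightarrow> (a = c) \<noteq> (a = d)" by blast
  have toggle: "\<exists>H' W'. H' \<subseteq> vert_adj A \<and> W' \<subseteq> horiz_adj A \<and> (\<forall>a. odd_deg H' W' a \<longleftrightarrow> (a = c) \<noteq> (a = e))"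
    if X: "X \<subseteq> vert_adj A" and Y: "Y \<subseteq> horiz_adj A" and XY: "\<And>a. odd_deg X Y a \<longleftrightarrow> a = d \<or> a = e" and "d \<noteq> e" for X Y
  proof (intro exI conjI allI)
    show "(H - X) \<union> (X - H) \<subseteq> vert_adj A" "(W - Y) \<union> (Y - W) \<subseteq> horiz_adj A" using HW X Y by blast+
    fix a
    have "odd_deg ((H - X) \<union> (X - H)) ((W - Y) \<union> (Y - W)) a \<longleftrightarrow> odd_deg H W a \<noteq> odd_deg X Y a"
      by (cases a) auto
    then show "odd_deg ((H - X) \<union> (X - H)) ((W - Y) \<union> (Y - W)) a \<longleftrightarrow> (a = c) \<noteq> (a = e)"
      unfolding HW(3) XY using \<open>d \<noteq> e\<close> by blast
  qed
  have de: "d \<in> A" "e \<in> A" "adjacent d e" using step.hyps(2) by (auto simp: adj_rel_def)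
  from de(3) show ?case
  proof (cases rule: adjacent_cases)
    case (1 i j)
    show ?thesis
      by (rule toggle[of "{}" "{(Suc i, j)}"]) (use 1 de in \<open>auto simp: horiz_adj_def\<close>)
  next
    case (2 i j)
    show ?thesis
      by (rule toggle[of "{(i, Suc j)}" "{}"]) (use 2 de in \<open>auto simp: vert_adj_def\<close>)
  next
    case (3 i j)
    show ?thesis
      by (rule toggle[of "{}" "{(Suc i, j)}"]) (use 3 de in \<open>auto simp: horiz_adj_def\<close>)
  next
    case (4 i j)
    show ?thesis
      by (rule toggle[of "{(i, Suc j)}" "{}"]) (use 4 de in \<open>auto simp: vert_adj_def\<close>)
  qed
qed

text \<open>On the way from \<open>Y\<close> the function keeps the value \<open>u v\<close> until
  the path enters \<open>X\<close>. It enters through two points, one of which is not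
  \<open>v\<close>; there \<open>u\<close> has the other value. The cells of a path are distinct, so
  \<open>X\<close> is not visited earlier.\<close>

lemma separated_contradiction:
  assumes conn: "path_connected_cells Q" and X: "X \<in> Q" and Y: "Y \<in> Q" "Y \<noteq> X" and v: "v \<in> Y"
    and const: "\<And>C x y. C \<in> Q \<Longrightarrow> C \<noteq> X \<Longrightarrow> x \<in> C \<Longrightarrow> y \<in> C \<Longrightarrow> u x = (u y :: bool)"
    and jump: "\<And>x. x \<in> X \<Longrightarrow> x \<noteq> v \<Longrightarrow> u x \<noteq> u v"
  shows False
proof -
  obtain Cs where Cs: "cell_path Cs Y X" "set Cs \<subseteq> Q"
    using conn X Y unfolding path_connected_cells_def by blast
  have ne: "Cs \<noteq> []" "Cs ! 0 = Y" "Cs ! (length Cs - 1) = X" "distinct Cs"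
    using Cs(1) unfolding cell_path_def by (auto simp: hd_conv_nth last_conv_nth)
  have "length Cs \<noteq> Suc 0" using ne Y(2) by auto
  then obtain n where n: "length Cs = Suc (Suc n)" using ne(1) by (metis length_0_conv not0_implies_Suc)
  have last: "Cs ! Suc n = X" "Suc n < length Cs" using ne(3) n by simp_all
  obtain p q where pq: "p \<noteq> q" "p \<in> Cs ! n" "q \<in> Cs ! n" "p \<in> X" "q \<in> X"
    using cell_path_inter[OF Cs(1) last(2)] unfolding last(1) .
  define Ds where "Ds = take (Suc n) Cs"
  have D: "length Ds = Suc n" "\<And>i. i < Suc n \<Longrightarrow> Ds ! i = Cs ! i" using n by (simp_all add: Ds_def)
  have "u v = u x" if "x \<in> Cs ! n" for x
  proof (rule chain_constant[of Ds u n v x])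
    show "Ds ! i \<inter> Ds ! Suc i \<noteq> {}" if "Suc i < length Ds" for i
    proof -
      have i: "Suc i < length Cs" "Ds ! i = Cs ! i" "Ds ! Suc i = Cs ! Suc i" using that D n by simp_all
      show ?thesis unfolding i(2,3) using cell_path_inter[OF Cs(1) i(1)] by blast
    qed
    show "u x = u y" if "C \<in> set Ds" "x \<in> C" "y \<in> C" for C x y
    proof (rule const[OF _ _ that(2,3)])
      show "C \<in> Q" using that(1) Cs(2) set_take_subset[of "Suc n" Cs] unfolding Ds_def by blast
      have "\<exists>i<length Ds. Ds ! i = C" using that(1) by (simp only: in_set_conv_nth)
      then obtain i where i': "i < length Ds" "Ds ! i = C" by (elim exE conjE)
      have i: "i < Suc n" using i'(1) D(1) by simp
      have "C = Cs ! i" using i'(2) D(2)[OF i] by simp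
      then
      show "C \<noteq> X" unfolding last(1)[symmetric] using nth_eq_iff_index_eq[OF ne(4), of i "Suc n"] last(2) i by simp
    qed
  qed (use that D ne v in auto)
  then show False using jump[of p] jump[of q] pq by metis
qed

text \<open>If two cells of \<open>A\<close> met only in \<open>v\<close>, a path in
  \<open>A\<close> between them could be closed to a cycle through one missing cell \<open>c\<close>
  at \<open>v\<close>. Its potential separates \<open>v\<close> from the other three vertices of
  \<open>c\<close>. The other missing cell \<open>d\<close> also contains \<open>v\<close>, so no
  path outside \<open>A\<close> could join \<open>d\<close> to \<open>c\<close>, against
  connectedness of the complement.\<close>

lemma no_pinch:
  assumes conn: "path_connected_cells (cells - P)" and A: "A = {a. cell_at a \<in> P}"
    and connA: "\<And>a b. a \<in> A \<Longrightarrow> b \<in> A \<Longrightarrow> (a, b) \<in> (adj_rel A)\<^sup>*"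
  shows "(i, j) \<in> A \<Longrightarrow> (Suc i, Suc j) \<in> A \<Longrightarrow> (Suc i, j) \<in> A \<or> (i, Suc j) \<in> A"
    and "(i, Suc j) \<in> A \<Longrightarrow> (Suc i, j) \<in> A \<Longrightarrow> (i, j) \<in> A \<or> (Suc i, Suc j) \<in> A"
proof -
  have contra: False
    if H: "H \<subseteq> vert_adj (insert c A)" and W: "W \<subseteq> horiz_adj (insert c A)" and Z: "\<And>a. \<not> odd_deg H W a"
      and c: "c \<notin> A" and d: "d \<notin> A" "d \<noteq> c" "v \<in> cell_at d"
      and jump: "\<And>(u :: point \<Rightarrow> bool) x. (\<And>i j. (u (i, j) \<noteq> u (Suc i, j)) \<longleftrightarrow> (i, j) \<in> H) \<Longrightarrow>
        (\<And>i j. (u (i, j) \<noteq> u (i, Suc j)) \<longleftrightarrow> (i, j) \<in> W) \<Longrightarrow> x \<in> cell_at c \<Longrightarrow> x \<noteq> v \<Longrightarrow> u x \<noteq> u v"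
    for H W c d v
  proof -
    obtain u :: "point \<Rightarrow> bool" where "\<forall>i j. (u (i, j) \<noteq> u (Suc i, j)) \<longleftrightarrow> (i, j) \<in> H"
      "\<forall>i j. (u (i, j) \<noteq> u (i, Suc j)) \<longleftrightarrow> (i, j) \<in> W"
      "\<forall>a x y. a \<notin> insert c A \<longrightarrow> x \<in> cell_at a \<longrightarrow> y \<in> cell_at a \<longrightarrow> u x = u y"
      using cycle_potential[OF Z H W] by blast
    note u = this[rule_format]
    show False
    proof (rule separated_contradiction[OF conn, of "cell_at c" "cell_at d" v u])
      show "cell_at c \<in> cells - P" "cell_at d \<in> cells - P" using c d A by (auto simp: cells_def)
      show "cell_at d \<noteq> cell_at c" using d(2) inj_cell_at by (auto dest: injD)
      show "u x = u y" if C: "C \<in> cells - P" "C \<noteq> cell_at c" "x \<in> C" "y \<in> C" for C x y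
      proof -
        obtain a where "C = cell_at a" using C(1) by (auto simp: cells_def)
        then show ?thesis using u(3)[of a x y] C A by auto
      qed
      show "u x \<noteq> u v" if "x \<in> cell_at c" "x \<noteq> v" for x
        by (rule jump[OF _ _ that]) (rule u)+
    qed (rule d)
  qed
  show "(Suc i, j) \<in> A \<or> (i, Suc j) \<in> A" if ne: "(i, j) \<in> A" "(Suc i, Suc j) \<in> A"
  proof (rule ccontr)
    assume "\<not> ?thesis"
    then have o: "(Suc i, j) \<notin> A" "(i, Suc j) \<notin> A" by auto
    obtain H W where HW: "H \<subseteq> vert_adj A" "W \<subseteq> horiz_adj A"
      "\<And>a. odd_deg H W a \<longleftrightarrow> (a = (i, j)) \<noteq> (a = (Suc i, Suc j))"
      using path_boundary[OF connA[OF ne]] by blast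
    have fresh: "(Suc i, j) \<notin> H" "(Suc i, Suc j) \<notin> H" "(Suc i, j) \<notin> W" "(Suc (Suc i), j) \<notin> W"
      using HW(1,2) o by (auto simp: vert_adj_def horiz_adj_def)
    show False
    \<comment> \<open>Here \<open>c\<close> is the lower right cell, joined to the cell above it and
      to the one on its left; \<open>v\<close> is its upper left vertex and \<open>d\<close> the
      upper left cell.\<close>
    proof (rule contra[of "insert (Suc i, Suc j) H" "(Suc i, j)" "insert (Suc i, j) W" "(i, Suc j)" "(Suc i, Suc j)"])
      show "insert (Suc i, Suc j) H \<subseteq> vert_adj (insert (Suc i, j) A)"
        "insert (Suc i, j) W \<subseteq> horiz_adj (insert (Suc i, j) A)"
        using HW(1,2) ne by (auto simp: vert_adj_def horiz_adj_def)
      show "\<not> odd_deg (insert (Suc i, Suc j) H) (insert (Suc i, j) W) a" for a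
        using HW(3)[of a] fresh by (cases a) (auto split: if_splits)
      show "u x \<noteq> u (Suc i, Suc j)"
        if u: "\<And>k l. (u (k, l) \<noteq> u (Suc k, l)) \<longleftrightarrow> (k, l) \<in> insert (Suc i, Suc j) H"
          "\<And>k l. (u (k, l) \<noteq> u (k, Suc l)) \<longleftrightarrow> (k, l) \<in> insert (Suc i, j) W"
          and x: "x \<in> cell_at (Suc i, j)" "x \<noteq> (Suc i, Suc j)" for u :: "point \<Rightarrow> bool" and x
        using u(1)[of "Suc i" "Suc j"] u(1)[of "Suc i" j] u(2)[of "Suc i" j] u(2)[of "Suc (Suc i)" j] fresh x
        by (auto simp: cell_at_eq)
    qed (use o in \<open>auto simp: cell_at_eq\<close>)
  qed
  show "(i, j) \<in> A \<or> (Suc i, Suc j) \<in> A" if ne: "(i, Suc j) \<in> A" "(Suc i, j) \<in> A"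
  proof (rule ccontr)
    assume "\<not> ?thesis"
    then have o: "(i, j) \<notin> A" "(Suc i, Suc j) \<notin> A" by auto
    obtain H W where HW: "H \<subseteq> vert_adj A" "W \<subseteq> horiz_adj A"
      "\<And>a. odd_deg H W a \<longleftrightarrow> (a = (i, Suc j)) \<noteq> (a = (Suc i, j))"
      using path_boundary[OF connA[OF ne]] by blast
    have fresh: "(Suc i, Suc j) \<notin> H" "(Suc i, Suc (Suc j)) \<notin> H" "(Suc i, Suc j) \<notin> W" "(Suc (Suc i), Suc j) \<notin> W"
      using HW(1,2) o by (auto simp: vert_adj_def horiz_adj_def)
    show False
    \<comment> \<open>Here \<open>c\<close> is the upper right cell, joined to the cell below it and
      to the one on its left; \<open>v\<close> is its lower left vertex and \<open>d\<close> the
      lower left cell.\<close>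
    proof (rule contra[of "insert (Suc i, Suc j) H" "(Suc i, Suc j)" "insert (Suc i, Suc j) W" "(i, j)" "(Suc i, Suc j)"])
      show "insert (Suc i, Suc j) H \<subseteq> vert_adj (insert (Suc i, Suc j) A)"
        "insert (Suc i, Suc j) W \<subseteq> horiz_adj (insert (Suc i, Suc j) A)"
        using HW(1,2) ne by (auto simp: vert_adj_def horiz_adj_def)
      show "\<not> odd_deg (insert (Suc i, Suc j) H) (insert (Suc i, Suc j) W) a" for a
        using HW(3)[of a] fresh by (cases a) (auto split: if_splits)
      show "u x \<noteq> u (Suc i, Suc j)"
        if u: "\<And>k l. (u (k, l) \<noteq> u (Suc k, l)) \<longleftrightarrow> (k, l) \<in> insert (Suc i, Suc j) H"
          "\<And>k l. (u (k, l) \<noteq> u (k, Suc l)) \<longleftrightarrow> (k, l) \<in> insert (Suc i, Suc j) W"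
          and x: "x \<in> cell_at (Suc i, Suc j)" "x \<noteq> (Suc i, Suc j)" for u :: "point \<Rightarrow> bool" and x
        using u(1)[of "Suc i" "Suc j"] u(1)[of "Suc i" "Suc (Suc j)"] u(2)[of "Suc i" "Suc j"]
          u(2)[of "Suc (Suc i)" "Suc j"] fresh x
        by (auto simp: cell_at_eq)
    qed (use o in \<open>auto simp: cell_at_eq\<close>)
  qed
qed

lemma adj_rel_connected:
  assumes "polyomino P" and A: "A = {a. cell_at a \<in> P}" and "a \<in> A" "b \<in> A"
  shows "(a, b) \<in> (adj_rel A)\<^sup>*"
proof -
  obtain Cs where Cs: "cell_path Cs (cell_at a) (cell_at b)" "set Cs \<subseteq> P"
    using assms unfolding polyomino_def path_connected_cells_def by blast
  have ne: "Cs \<noteq> []" "Cs ! 0 = cell_at a" "Cs ! (length Cs - 1) = cell_at b" "distinct Cs" "set Cs \<subseteq> cells"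
    using Cs(1) unfolding cell_path_def by (auto simp: hd_conv_nth last_conv_nth)
  have "\<forall>c. Cs ! n = cell_at c \<longrightarrow> (a, c) \<in> (adj_rel A)\<^sup>*" if "n < length Cs" for n
    using that
  proof (induction n)
    case 0
    then show ?case using ne(2) inj_cell_at by (auto dest: injD)
  next
    case (Suc n)
    show ?case
    proof (intro allI impI)
      fix c assume c: "Cs ! Suc n = cell_at c"
      have "Cs ! n \<in> cells" using ne(5) Suc.prems by (meson Suc_lessD nth_mem subsetD)
      then obtain d where d: "Cs ! n = cell_at d" by (auto simp: cells_def)
      have "cell_at d \<noteq> cell_at c"
        using nth_eq_iff_index_eq[OF ne(4), of n "Suc n"] Suc.prems c d by simp
      moreover have "cell_at d \<inter> cell_at c \<in> edges (cell_at d)"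
        using Cs(1) Suc.prems unfolding cell_path_def c[symmetric] d[symmetric] by blast
      ultimately have "adjacent d c" using cell_at_common_edge by blast
      moreover have "cell_at d \<in> P" "cell_at c \<in> P"
        using Cs(2) Suc.prems unfolding c[symmetric] d[symmetric] by (meson Suc_lessD nth_mem subsetD)+
      ultimately have "(d, c) \<in> adj_rel A" by (simp add: adj_rel_def A)
      moreover have "(a, d) \<in> (adj_rel A)\<^sup>*" using Suc.IH[OF Suc_lessD[OF Suc.prems]] d by blast
      ultimately show "(a, c) \<in> (adj_rel A)\<^sup>*" by (rule rtrancl_into_rtrancl[rotated])
    qed
  qed
  then show ?thesis using ne(1,3) by (meson diff_less length_greater_0_conv zero_less_one)
qed

section \<open>Strips of cells\<close>

definition run_start :: "nat set \<Rightarrow> nat \<Rightarrow> nat" where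
  "run_start X q = (LEAST j. j \<le> q \<and> {j..q} \<subseteq> X)"

text \<open>The end is exclusive, so it is also the coordinate of the far side of the last cell in
  the run.\<close>

definition run_end :: "nat set \<Rightarrow> nat \<Rightarrow> nat" where
  "run_end X j = (LEAST k. j \<le> k \<and> k \<notin> X)"

lemma run_start:
  assumes "q \<in> X" "0 \<notin> X"
  shows "run_start X q \<le> q" "{run_start X q..q} \<subseteq> X" "run_start X q \<in> X" "run_start X q - 1 \<notin> X"
proof -
  let ?s = "run_start X q"
  have ex: "q \<le> q \<and> {q..q} \<subseteq> X" using assms(1) by simp
  have s: "?s \<le> q \<and> {?s..q} \<subseteq> X" unfolding run_start_def using LeastI[of "\<lambda>j. j \<le> q \<and> {j..q} \<subseteq> X" q] ex by blast
  then show "?s \<le> q" "{?s..q} \<subseteq> X" by blast+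
  show X: "?s \<in> X" using s by auto
  show "?s - 1 \<notin> X"
  proof
    assume *: "?s - 1 \<in> X"
    \<comment> \<open>Without \<open>0\<close> in \<open>X\<close> the start is positive, so the
      truncated subtraction yields a genuine predecessor.\<close>
    have pos: "?s > 0" using X assms(2) by (metis gr0I)
    have "{?s - 1..q} \<subseteq> insert (?s - 1) {?s..q}" by auto
    then have "{?s - 1..q} \<subseteq> X" using * s by blast
    then have "?s \<le> ?s - 1" using s unfolding run_start_def by (intro Least_le) auto
    then show False using pos by simp
  qed
qed

lemma run_start_eqI:
  assumes "q \<in> X" "0 \<notin> X" "j \<le> q" "{j..q} \<subseteq> X" "j - 1 \<notin> X"
  shows "run_start X q = j"
proof (rule antisym)
  show "run_start X q \<le> j" unfolding run_start_def by (rule Least_le) (use assms in blast)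
  note s = run_start[OF assms(1,2)]
  show "j \<le> run_start X q"
  proof (rule ccontr)
    assume "\<not> j \<le> run_start X q"
    then have "j - 1 \<in> {run_start X q..q}" using assms(3) by auto
    then show False using s(2) assms(5) by blast
  qed
qed

lemma run_end:
  assumes "finite X" "j \<in> X"
  shows "j < run_end X j" "{j..<run_end X j} \<subseteq> X" "run_end X j \<notin> X"
proof -
  let ?e = "run_end X j"
  obtain m where m: "\<forall>x\<in>X. x < m" using assms(1) finite_nat_set_iff_bounded by auto
  have "j \<le> m \<and> m \<notin> X" using m assms(2) by (auto simp: less_imp_le)
  then have e: "j \<le> ?e \<and> ?e \<notin> X" unfolding run_end_def by (rule LeastI)
  then show "?e \<notin> X" by blast
  show "j < ?e" using e assms(2) by (metis le_neq_implies_less)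
  show "{j..<?e} \<subseteq> X"
  proof
    fix k assume k: "k \<in> {j..<?e}"
    show "k \<in> X"
    proof (rule ccontr)
      assume "k \<notin> X"
      then have "?e \<le> k" unfolding run_end_def by (intro Least_le) (use k in auto)
      then show False using k by simp
    qed
  qed
qed

lemma run_eq:
  assumes "finite X" "0 \<notin> X" "j \<in> X" "j - 1 \<notin> X"
  shows "{q \<in> X. run_start X q = j} = {j..<run_end X j}"
proof
  note e = run_end[OF assms(1,3)]
  show "{q \<in> X. run_start X q = j} \<subseteq> {j..<run_end X j}"
  proof
    fix q assume "q \<in> {q \<in> X. run_start X q = j}"
    then have q: "q \<in> X" "run_start X q = j" by auto
    note s = run_start[OF q(1) assms(2), unfolded q(2)]
    have "q < run_end X j"
    proof (rule ccontr)
      assume "\<not> q < run_end X j"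
      then have "run_end X j \<in> {j..q}" using e(1) by simp
      then show False using s(2) e(3) by blast
    qed
    then show "q \<in> {j..<run_end X j}" using s(1) by simp
  qed
  show "{j..<run_end X j} \<subseteq> {q \<in> X. run_start X q = j}"
  proof
    fix q assume q: "q \<in> {j..<run_end X j}"
    have "{j..q} \<subseteq> {j..<run_end X j}" using q by auto
    then have "{j..q} \<subseteq> X" using e(2) by blast
    then show "q \<in> {q \<in> X. run_start X q = j}" using run_start_eqI[of q X j] assms q by auto
  qed
qed

section \<open>Signs on a bipartite graph\<close>

lemma dominant_sum_pos:
  fixes f :: "'a \<Rightarrow> int"
  assumes S: "finite S" "card S \<le> K" and B: "0 < B" "\<And>x. x \<in> S \<Longrightarrow> - B \<le> f x"
    and x: "x \<in> S" "int (K + 1) * B \<le> f x"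
  shows "0 < sum f S"
proof -
  have "- (int (card (S - {x})) * B) \<le> sum f (S - {x})"
    using sum_bounded_below[of "S - {x}" "- B" f] B(2) by simp
  moreover have "int (card (S - {x})) * B \<le> int K * B"
    using S B(1) card_Diff1_le[of S x] by (intro mult_right_mono) auto
  moreover have "int (K + 1) * B = int K * B + B" by (simp add: algebra_simps)
  ultimately have "0 < f x + sum f (S - {x})" using x(2) B(1) by linarith
  then show ?thesis using sum.remove[OF S(1) x(1), of f] by simp
qed

text \<open>The edges \<open>a\<close> of a bipartite graph join \<open>vs a\<close> to \<open>hs a\<close>. Every edge takes the sign wanted by
  its end of higher rank, with a magnitude that decreases quickly with the rank of its lower end.\<close>

lemma bipartite_signs:
  fixes rank :: "'n \<Rightarrow> nat"
  assumes A: "finite A" and ne: "\<And>a. a \<in> A \<Longrightarrow> rank (vs a) \<noteq> rank (hs a)"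
  shows "\<exists>\<delta> :: 'a \<Rightarrow> int.
    (\<forall>a\<in>A. rank (hs a) < rank (vs a) \<longrightarrow> 0 < (\<Sum>b\<in>{b \<in> A. vs b = vs a}. \<delta> b)) \<and>
    (\<forall>a\<in>A. rank (vs a) < rank (hs a) \<longrightarrow> (\<Sum>b\<in>{b \<in> A. hs b = hs a}. \<delta> b) < 0)"
proof -
  obtain N where N: "\<And>a. a \<in> A \<Longrightarrow> rank (vs a) \<le> N \<and> rank (hs a) \<le> N"
  proof
    show "rank (vs a) \<le> (\<Sum>a\<in>A. rank (vs a) + rank (hs a)) \<and> rank (hs a) \<le> (\<Sum>a\<in>A. rank (vs a) + rank (hs a))"
      if "a \<in> A" for a
      using member_le_sum[OF that, of "\<lambda>a. rank (vs a) + rank (hs a)"] A by auto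
  qed
  define M where "M = int (card A + 1)"
  have M: "1 \<le> M" "0 < M" by (simp_all add: M_def)
  have step: "int (card A + 1) * M ^ (N - t) \<le> M ^ (N - s)" if "s < t" "t \<le> N" for s t
  proof -
    have "int (card A + 1) * M ^ (N - t) = M ^ Suc (N - t)" by (simp add: M_def)
    also have "\<dots> \<le> M ^ (N - s)" by (rule power_increasing) (use that M in auto)
    finally show ?thesis .
  qed
  \<comment> \<open>At a node, the edges to lower nodes have the wanted sign. Those to higher nodes
    may have the wrong one, but all of them have magnitude \<open>M\<close> to the power
    \<open>N\<close> minus the rank of the node, which is smaller by the factor
    \<open>card A + 1\<close> than that of any edge going down. One edge going down therefore
    outweighs them all.\<close>
  define \<delta> where "\<delta> a = (if rank (hs a) < rank (vs a) then M ^ (N - rank (hs a)) else - (M ^ (N - rank (vs a))))" for a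
  have card: "finite {b \<in> A. Q b}" "card {b \<in> A. Q b} \<le> card A" for Q
    using A by (auto intro: card_mono)
  show ?thesis
  proof (intro exI[of _ \<delta>] conjI ballI impI)
    fix a assume a: "a \<in> A" "rank (hs a) < rank (vs a)"
    show "0 < (\<Sum>b\<in>{b \<in> A. vs b = vs a}. \<delta> b)"
    proof (rule dominant_sum_pos[OF card])
      show "0 < M ^ (N - rank (vs a))" using M by simp
      show "- (M ^ (N - rank (vs a))) \<le> \<delta> b" if "b \<in> {b \<in> A. vs b = vs a}" for b
      proof -
        have "0 \<le> M ^ (N - rank (hs b))" "0 \<le> M ^ (N - rank (vs a))" using M by simp_all
        then show ?thesis using that unfolding \<delta>_def by auto
      qed
      show "int (card A + 1) * M ^ (N - rank (vs a)) \<le> \<delta> a"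
        unfolding \<delta>_def using a N step by simp
    qed (use a in simp)
  next
    fix a assume a: "a \<in> A" "rank (vs a) < rank (hs a)"
    have "0 < (\<Sum>b\<in>{b \<in> A. hs b = hs a}. - \<delta> b)"
    proof (rule dominant_sum_pos[OF card])
      show "0 < M ^ (N - rank (hs a))" using M by simp
      show "- (M ^ (N - rank (hs a))) \<le> - \<delta> b" if "b \<in> {b \<in> A. hs b = hs a}" for b
      proof -
        have "0 \<le> M ^ (N - rank (vs b))" "0 \<le> M ^ (N - rank (hs a))" using M by simp_all
        then show ?thesis using that unfolding \<delta>_def by auto
      qed
      show "int (card A + 1) * M ^ (N - rank (hs a)) \<le> - \<delta> a"
        unfolding \<delta>_def using a N step by simp
    qed (use a in simp)
    then show "(\<Sum>b\<in>{b \<in> A. hs b = hs a}. \<delta> b) < 0" by (simp add: sum_negf)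
  qed
qed

section \<open>Strips, their selected vertices and their ranks\<close>

definition column :: "point set \<Rightarrow> nat \<Rightarrow> nat set" where "column A i = {j. (i, j) \<in> A}"
definition row :: "point set \<Rightarrow> nat \<Rightarrow> nat set" where "row A j = {i. (i, j) \<in> A}"

text \<open>A maximal strip of cells is represented by its orientation (\<open>True\<close> for vertical) and its
  first cell.\<close>

type_synonym strip = "bool \<times> point"

fun vstrip :: "point set \<Rightarrow> point \<Rightarrow> strip" where
  "vstrip A (i, j) = (True, (i, run_start (column A i) j))"

fun hstrip :: "point set \<Rightarrow> point \<Rightarrow> strip" where
  "hstrip A (i, j) = (False, (run_start (row A j) i, j))"

text \<open>A cell begins a vertical strip iff it is not the upper cell of a vertical adjacency, and
  likewise for horizontal ones. This form makes \<open>card_strips\<close> immediate: each adjacency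
  costs one strip.\<close>

definition strips :: "point set \<Rightarrow> strip set" where
  "strips A = Pair True ` (A - vert_adj A) \<union> Pair False ` (A - horiz_adj A)"

fun upper_right :: "point set \<Rightarrow> strip \<Rightarrow> point" where
  "upper_right A (True, (i, j)) = (Suc i, run_end (column A i) j)"
| "upper_right A (False, (i, j)) = (run_end (row A j) i, Suc j)"

text \<open>The Boolean \<open>c\<close> numbers the two selected vertices, and \<open>trail\<close>
  lists the other diagonal. The generator of the strip is thus, up to sign, the lead monomial minus
  the trail monomial.\<close>

fun lead :: "point set \<Rightarrow> strip \<Rightarrow> bool \<Rightarrow> point" where
  "lead A (True, a) c = (if c then a else upper_right A (True, a))"
| "lead A (False, a) c = (let b = upper_right A (False, a) in if c then (fst a, snd b) else (fst b, snd a))"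

fun trail :: "point set \<Rightarrow> strip \<Rightarrow> bool \<Rightarrow> point" where
  "trail A (False, a) c = (if c then a else upper_right A (False, a))"
| "trail A (True, a) c = (let b = upper_right A (True, a) in if c then (fst a, snd b) else (fst b, snd a))"

locale cell_corners =
  fixes A :: "point set"
  assumes finite: "finite A" and pos: "A \<subseteq> {1..} \<times> {1..}"
begin

lemma zero: "0 \<notin> column A i" "0 \<notin> row A j"
  using pos by (auto simp: column_def row_def)

lemma fin: "finite (column A i)" "finite (row A j)"
proof -
  have "column A i \<subseteq> snd ` A" "row A j \<subseteq> fst ` A" by (force simp: column_def row_def)+
  then show "finite (column A i)" "finite (row A j)" using finite finite_subset by blast+
qed

lemma vstart_iff: "(i, j) \<in> A - vert_adj A \<longleftrightarrow> j \<in> column A i \<and> j - 1 \<notin> column A i"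
proof (cases j)
  case 0 then show ?thesis using zero(1)[of i] by (auto simp: column_def)
next
  case (Suc k) then show ?thesis by (auto simp: column_def vert_adj_def)
qed

lemma hstart_iff: "(i, j) \<in> A - horiz_adj A \<longleftrightarrow> i \<in> row A j \<and> i - 1 \<notin> row A j"
proof (cases i)
  case 0 then show ?thesis using zero(2)[of j] by (auto simp: row_def)
next
  case (Suc k) then show ?thesis by (auto simp: row_def horiz_adj_def)
qed

lemma strip_mem:
  assumes "a \<in> A" shows "vstrip A a \<in> strips A" "hstrip A a \<in> strips A"
proof -
  obtain i j where a: "a = (i, j)" by (cases a)
  have "j \<in> column A i" "i \<in> row A j" using assms a by (auto simp: column_def row_def)
  then show "vstrip A a \<in> strips A" "hstrip A a \<in> strips A"
    using run_start(3,4)[of j "column A i"] run_start(3,4)[of i "row A j"] zero vstart_iff hstart_iff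
    unfolding a strips_def by auto
qed

lemma vstrip_cells:
  assumes "(True, (i, j)) \<in> strips A"
  defines "e \<equiv> run_end (column A i) j"
  shows "{b \<in> A. vstrip A b = (True, (i, j))} = {i} \<times> {j..<e}" "j < e" "(i, e) \<notin> A"
proof -
  have "(i, j) \<in> A - vert_adj A" using assms by (auto simp: strips_def)
  then have j: "j \<in> column A i" "j - 1 \<notin> column A i" using vstart_iff by auto
  show "j < e" "(i, e) \<notin> A" using run_end(1,3)[OF fin(1) j(1)] by (auto simp: e_def column_def)
  have "{b \<in> A. vstrip A b = (True, (i, j))} = {i} \<times> {q \<in> column A i. run_start (column A i) q = j}"
    by (auto simp: column_def)
  then show "{b \<in> A. vstrip A b = (True, (i, j))} = {i} \<times> {j..<e}"
    unfolding e_def run_eq[OF fin(1) zero(1) j] .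
qed

lemma hstrip_cells:
  assumes "(False, (i, j)) \<in> strips A"
  defines "e \<equiv> run_end (row A j) i"
  shows "{b \<in> A. hstrip A b = (False, (i, j))} = {i..<e} \<times> {j}" "i < e" "(e, j) \<notin> A"
proof -
  have "(i, j) \<in> A - horiz_adj A" using assms by (auto simp: strips_def)
  then have j: "i \<in> row A j" "i - 1 \<notin> row A j" using hstart_iff by auto
  show "i < e" "(e, j) \<notin> A" using run_end(1,3)[OF fin(2) j(1)] by (auto simp: e_def row_def)
  have "{b \<in> A. hstrip A b = (False, (i, j))} = {q \<in> row A j. run_start (row A j) q = i} \<times> {j}"
    by (auto simp: row_def)
  then show "{b \<in> A. hstrip A b = (False, (i, j))} = {i..<e} \<times> {j}"
    unfolding e_def run_eq[OF fin(2) zero(2) j] .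
qed

text \<open>A walk through adjacent cells thus becomes a walk in the bipartite graph of strips,
  which \<open>strip_rank\<close> exploits.\<close>

lemma same_strip:
  assumes "(a, b) \<in> adj_rel A"
  shows "vstrip A a = vstrip A b \<or> hstrip A a = hstrip A b"
proof -
  have v: "vstrip A (i, j) = vstrip A (i, Suc j)" if "(i, j) \<in> A" "(i, Suc j) \<in> A" for i j
  proof -
    have j: "j \<in> column A i" "Suc j \<in> column A i" using that by (auto simp: column_def)
    note s = run_start[OF j(1) zero(1)]
    have "{run_start (column A i) j..Suc j} \<subseteq> insert (Suc j) {run_start (column A i) j..j}" by auto
    then have "run_start (column A i) (Suc j) = run_start (column A i) j"
      using s j(2) by (intro run_start_eqI zero) auto
    then show ?thesis by simp
  qed
  have h: "hstrip A (i, j) = hstrip A (Suc i, j)" if "(i, j) \<in> A" "(Suc i, j) \<in> A" for i j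
  proof -
    have j: "i \<in> row A j" "Suc i \<in> row A j" using that by (auto simp: row_def)
    note s = run_start[OF j(1) zero(2)]
    have "{run_start (row A j) i..Suc i} \<subseteq> insert (Suc i) {run_start (row A j) i..i}" by auto
    then have "run_start (row A j) (Suc i) = run_start (row A j) i"
      using s j(2) by (intro run_start_eqI zero) auto
    then show ?thesis by simp
  qed
  have "a \<in> A" "b \<in> A" "adjacent a b" using assms by (auto simp: adj_rel_def)
  from this(3) show ?thesis
    by (cases rule: adjacent_cases) (use v h \<open>a \<in> A\<close> \<open>b \<in> A\<close> in metis)+
qed

lemma card_strips: "card (strips A) + card (vert_adj A) + card (horiz_adj A) = 2 * card A"
proof -
  have "card (strips A) = card (A - vert_adj A) + card (A - horiz_adj A)"
    unfolding strips_def
    by (subst card_Un_disjoint) (auto simp: finite card_image inj_on_def)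
  moreover have "card (A - vert_adj A) + card (vert_adj A) = card A" "card (A - horiz_adj A) + card (horiz_adj A) = card A"
    using adj_subset finite by (metis card_Diff_subset card_mono finite_subset le_add_diff_inverse2)+
  ultimately show ?thesis by linarith
qed

lemma finite_strips: "finite (strips A)"
  by (simp add: strips_def finite)

text \<open>The cells around \<open>v\<close> are those at \<open>(k, l)\<close>,
  \<open>(k, Suc l)\<close>, \<open>(Suc k, Suc l)\<close> and \<open>(Suc k, l)\<close>, in
  clockwise order. In each of the four cases a cell of the strip is followed clockwise by a cell
  outside \<open>A\<close>.\<close>

lemma lead_cases:
  assumes "x \<in> strips A" "lead A x c = v"
  shows "\<exists>k l. v = (Suc k, Suc l) \<and>
    (if fst x then (if c then vstrip A (Suc k, Suc l) = x \<and> (Suc k, Suc l) \<in> A \<and> (Suc k, l) \<notin> A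
                    else vstrip A (k, l) = x \<and> (k, l) \<in> A \<and> (k, Suc l) \<notin> A)
     else (if c then hstrip A (Suc k, l) = x \<and> (Suc k, l) \<in> A \<and> (k, l) \<notin> A
                    else hstrip A (k, Suc l) = x \<and> (k, Suc l) \<in> A \<and> (Suc k, Suc l) \<notin> A))"
proof -
  obtain o' i j where x: "x = (o', (i, j))" by (cases x) auto
  have ij: "(i, j) \<in> A" "o' \<Longrightarrow> (i, j) \<notin> vert_adj A" "\<not> o' \<Longrightarrow> (i, j) \<notin> horiz_adj A"
    using assms(1) unfolding x strips_def by auto
  have "0 < i" "0 < j" using ij(1) pos by auto
  then obtain i' j' where S: "i = Suc i'" "j = Suc j'" by (metis gr0_implies_Suc)
  show ?thesis
  proof (cases o')
    case True
    note r = vstrip_cells[of i j, OF assms(1)[unfolded x, simplified True]]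
    obtain e where e: "run_end (column A i) j = Suc e" using r(2) by (metis less_imp_Suc_add)
    have xT: "x = (True, (i, j))" using x True by simp
    have "(i, j) \<in> {b \<in> A. vstrip A b = x}" "(i, e) \<in> {b \<in> A. vstrip A b = x}"
      unfolding xT r(1) using r(2) e by auto
    then have m: "vstrip A (i, j) = x" "vstrip A (i, e) = x" "(i, e) \<in> A" by blast+
    have low: "(i, j') \<notin> A" using ij(1) ij(2)[OF True] S by (auto simp: vert_adj_def)
    show ?thesis
    proof (cases c)
      case c: True
      then have "v = (Suc i', Suc j')" using assms(2) x True S by simp
      then show ?thesis using m low ij(1) True c x S by (intro exI[of _ i'] exI[of _ j']) simp
    next
      case c: False
      then have "v = (Suc i, Suc e)" using assms(2) x True e by simp
      then show ?thesis using m r(3) True c x e by (intro exI[of _ i] exI[of _ e]) simp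
    qed
  next
    case False
    note r = hstrip_cells[of i j, OF assms(1)[unfolded x, simplified False]]
    obtain e where e: "run_end (row A j) i = Suc e" using r(2) by (metis less_imp_Suc_add)
    have xF: "x = (False, (i, j))" using x False by simp
    have "(i, j) \<in> {b \<in> A. hstrip A b = x}" "(e, j) \<in> {b \<in> A. hstrip A b = x}"
      unfolding xF r(1) using r(2) e by auto
    then have m: "hstrip A (i, j) = x" "hstrip A (e, j) = x" "(e, j) \<in> A" by blast+
    have low: "(i', j) \<notin> A" using ij(1) ij(3)[OF False] S by (auto simp: horiz_adj_def)
    show ?thesis
    proof (cases c)
      case c: True
      then have "v = (Suc i', Suc j)" using assms(2) x False S by simp
      then show ?thesis using m low ij(1) False c x S by (intro exI[of _ i'] exI[of _ j]) simp
    next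
      case c: False
      then have "v = (Suc e, Suc j')" using assms(2) x False e S by simp
      then show ?thesis using m r(3) False c x e S by (intro exI[of _ e] exI[of _ j']) simp
    qed
  qed
qed

text \<open>The place of the passage around \<open>v\<close> determines the strip and the Boolean.
  Two passages among four cells would make cells inside and outside \<open>A\<close> alternate,
  which is the corner contact excluded by \<open>pinch\<close>.\<close>

lemma lead_inj:
  assumes pinch: "\<And>i j. (i, j) \<in> A \<Longrightarrow> (Suc i, Suc j) \<in> A \<Longrightarrow> (Suc i, j) \<in> A \<or> (i, Suc j) \<in> A"
    "\<And>i j. (i, Suc j) \<in> A \<Longrightarrow> (Suc i, j) \<in> A \<Longrightarrow> (i, j) \<in> A \<or> (Suc i, Suc j) \<in> A"
    and x: "x \<in> strips A" and y: "y \<in> strips A" and eq: "lead A x c = lead A y d"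
  shows "x = y \<and> c = d"
proof -
  obtain k l where *: "lead A y d = (Suc k, Suc l)"
    "if fst x then (if c then vstrip A (Suc k, Suc l) = x \<and> (Suc k, Suc l) \<in> A \<and> (Suc k, l) \<notin> A
                    else vstrip A (k, l) = x \<and> (k, l) \<in> A \<and> (k, Suc l) \<notin> A)
     else (if c then hstrip A (Suc k, l) = x \<and> (Suc k, l) \<in> A \<and> (k, l) \<notin> A
                    else hstrip A (k, Suc l) = x \<and> (k, Suc l) \<in> A \<and> (Suc k, Suc l) \<notin> A)"
    using lead_cases[OF x eq] by blast
  have "if fst y then (if d then vstrip A (Suc k, Suc l) = y \<and> (Suc k, Suc l) \<in> A \<and> (Suc k, l) \<notin> A
                    else vstrip A (k, l) = y \<and> (k, l) \<in> A \<and> (k, Suc l) \<notin> A)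
     else (if d then hstrip A (Suc k, l) = y \<and> (Suc k, l) \<in> A \<and> (k, l) \<notin> A
                    else hstrip A (k, Suc l) = y \<and> (k, Suc l) \<in> A \<and> (Suc k, Suc l) \<notin> A)"
    using lead_cases[OF y *(1)] by auto
  then show ?thesis
    using *(2) pinch[of k l] by (auto split: if_splits simp del: vstrip.simps hstrip.simps)
qed

lemma strip_inner_interval:
  assumes A: "A = {a. cell_at a \<in> P}" and x: "x \<in> strips A"
  shows "inner_interval P (snd x) (upper_right A x)"
proof -
  obtain o' i j where xo: "x = (o', (i, j))" by (cases x) auto
  have "(i, j) \<in> A" using x unfolding xo strips_def by auto
  then have v: "(i, j) \<in> vertices P" unfolding vertices_def A by (auto simp: cell_at_eq intro!: bexI[of _ "cell_at (i, j)"])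
  have main: "inner_interval P (i, j) (k, l)"
    if kl: "i < k" "j < l" and B: "{i..<k} \<times> {j..<l} \<subseteq> A" for k l
  proof -
    have "(k - 1, l - 1) \<in> A" using B kl by auto
    moreover have "(k, l) \<in> cell_at (k - 1, l - 1)" using kl by (simp add: in_cell_at)
    ultimately have "(k, l) \<in> vertices P" unfolding vertices_def A by blast
    moreover have "C \<in> P" if C: "C \<in> cells" "C \<subseteq> {(i, j)..(k, l)}" for C
    proof -
      obtain p q where pq: "C = cell_at (p, q)" using C(1) unfolding cells_def by auto
      have "(p, q) \<in> {(i, j)..(k, l)}" "(Suc p, Suc q) \<in> {(i, j)..(k, l)}" using C(2) unfolding pq cell_at_eq by auto
      then have "(p, q) \<in> {i..<k} \<times> {j..<l}" by (auto simp: less_eq_prod_def)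
      then show ?thesis using B unfolding pq A by blast
    qed
    ultimately show ?thesis using v kl unfolding inner_interval_def proper_def by auto
  qed
  show ?thesis
  proof (cases o')
    case True
    note r = vstrip_cells[of i j, OF x[unfolded xo, simplified True]]
    have "{i..<Suc i} \<times> {j..<run_end (column A i) j} \<subseteq> A" using r(1) by auto
    then show ?thesis using main[OF lessI r(2)] xo True by simp
  next
    case False
    note r = hstrip_cells[of i j, OF x[unfolded xo, simplified False]]
    have "{i..<run_end (row A j) i} \<times> {j..<Suc j} \<subseteq> A" using r(1) by auto
    then show ?thesis using main[OF r(2) lessI] xo False by simp
  qed
qed

text \<open>Breadth-first search from the cell \<open>a0\<close>, with \<open>hstrip A a0\<close> as
  root. On a shortest walk to a cell \<open>a\<close> of \<open>x\<close>, the cell before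
  \<open>a\<close> is not on \<open>x\<close>; so the strip that it shares with \<open>a\<close> is
  the other strip of \<open>a\<close>, and that one is nearer.\<close>

lemma strip_rank:
  assumes a0: "a0 \<in> A" and conn: "\<And>a. a \<in> A \<Longrightarrow> (a0, a) \<in> (adj_rel A)\<^sup>*"
  obtains rank :: "strip \<Rightarrow> nat"
  where "\<And>a. a \<in> A \<Longrightarrow> rank (vstrip A a) \<noteq> rank (hstrip A a)"
    "\<And>x. x \<in> strips A \<Longrightarrow> x \<noteq> hstrip A a0 \<Longrightarrow>
      \<exists>a\<in>A. x = vstrip A a \<and> rank (hstrip A a) < rank x \<or> x = hstrip A a \<and> rank (vstrip A a) < rank x"
proof -
  define on where "on x a \<longleftrightarrow> x = vstrip A a \<or> x = hstrip A a" for x a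
  define reach where "reach m x \<longleftrightarrow> (\<exists>a\<in>A. on x a \<and> (a0, a) \<in> adj_rel A ^^ m)" for m x
  define dist where "dist x = (LEAST m. reach m x)" for x
  \<comment> \<open>Two crossing strips may have equal distance; the orientation breaks the tie, and
    the factor 2 keeps it from overriding the distance.\<close>
  define rank where "rank x = 2 * dist x + of_bool (fst x)" for x
  have vh: "fst (vstrip A a)" "\<not> fst (hstrip A a)" for a by (cases a; simp)+
  have dist_le: "dist x \<le> m" if "reach m x" for x m
    unfolding dist_def using that by (rule Least_le)
  have on_ex: "\<exists>a\<in>A. on x a" if x: "x \<in> strips A" for x
  proof -
    obtain o' i j where xo: "x = (o', (i, j))" by (cases x) auto
    show ?thesis
    proof (cases o')
      case True
      note r = vstrip_cells[of i j, OF x[unfolded xo, simplified True]]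
      have "o' = True" using True by simp
      then have "(i, j) \<in> {b \<in> A. vstrip A b = x}" unfolding xo by (simp only: r(1)) (use r(2) in auto)
      then have "(i, j) \<in> A" "vstrip A (i, j) = x" by blast+
      then show ?thesis unfolding on_def by blast
    next
      case False
      note r = hstrip_cells[of i j, OF x[unfolded xo, simplified False]]
      have "o' = False" using False by simp
      then have "(i, j) \<in> {b \<in> A. hstrip A b = x}" unfolding xo by (simp only: r(1)) (use r(2) in auto)
      then have "(i, j) \<in> A" "hstrip A (i, j) = x" by blast+
      then show ?thesis unfolding on_def by blast
    qed
  qed
  show thesis
  proof
    show "rank (vstrip A a) \<noteq> rank (hstrip A a)" if "a \<in> A" for a
      unfolding rank_def using vh[of a] by simp presburger
    fix x assume x: "x \<in> strips A" "x \<noteq> hstrip A a0"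
    obtain b where b: "b \<in> A" "on x b" using on_ex[OF x(1)] by blast
    then obtain n where "(a0, b) \<in> adj_rel A ^^ n" using conn rtrancl_imp_relpow by blast
    then have "reach n x" using b unfolding reach_def by blast
    then have "reach (dist x) x" unfolding dist_def by (rule LeastI)
    then obtain a where a: "a \<in> A" "on x a" "(a0, a) \<in> adj_rel A ^^ dist x" unfolding reach_def by blast
    have other: "\<exists>a\<in>A. x = vstrip A a \<and> rank (hstrip A a) < rank x \<or> x = hstrip A a \<and> rank (vstrip A a) < rank x" if y: "y \<noteq> x" "on y a" "rank y < rank x" for y
    proof -
      have "x = vstrip A a \<and> y = hstrip A a \<or> x = hstrip A a \<and> y = vstrip A a"
        using y(1,2) a(2) unfolding on_def by blast
      then show ?thesis using a(1) y(3) by blast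
    qed
    show "\<exists>a\<in>A. x = vstrip A a \<and> rank (hstrip A a) < rank x \<or> x = hstrip A a \<and> rank (vstrip A a) < rank x"
    proof (cases "dist x")
      case 0
      then have "a = a0" using a(3) by simp
      then have xv: "x = vstrip A a" using a(2) x(2) unfolding on_def by blast
      have "reach 0 (hstrip A a)" unfolding reach_def on_def using a0 \<open>a = a0\<close> by auto
      then have "dist (hstrip A a) = 0" using dist_le by blast
      then have "rank (hstrip A a) < rank x" unfolding rank_def xv using vh[of a] by simp
      then show ?thesis using xv a(1) by blast
    next
      case (Suc k)
      then obtain b where b: "(a0, b) \<in> adj_rel A ^^ k" "(b, a) \<in> adj_rel A" using a(3) by auto
      have bA: "b \<in> A" using b(2) by (auto simp: adj_rel_def)
      have "\<not> on x b"
      proof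
        assume "on x b"
        then have "reach k x" using b(1) bA unfolding reach_def by blast
        then show False using dist_le[of k x] Suc by simp
      qed
      moreover obtain y where y: "on y a" "on y b" using same_strip[OF b(2)] unfolding on_def by metis
      ultimately have "y \<noteq> x" by blast
      have "reach k y" using y(2) b(1) bA unfolding reach_def by blast
      then have "dist y \<le> k" by (rule dist_le)
      then have "rank y < rank x" unfolding rank_def Suc by (cases "fst y") auto
      then show ?thesis by (rule other[OF \<open>y \<noteq> x\<close> y(1)])
    qed
  qed
qed

end

section \<open>Vertex weights from signs on cells\<close>

lemma prefix_sum_rectangle:
  fixes \<delta> :: "nat \<times> nat \<Rightarrow> int"
  defines "w \<equiv> \<lambda>(i, j). \<Sum>p<i. \<Sum>q<j. \<delta> (p, q)"
  assumes "i \<le> k" "j \<le> l"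
  shows "w (i, j) + w (k, l) = w (i, l) + w (k, j) + (\<Sum>a\<in>{i..<k} \<times> {j..<l}. \<delta> a)"
proof -
  have split: "sum f {..<n} = sum f {..<m} + sum f {m..<n}" if "m \<le> n" for f :: "nat \<Rightarrow> int" and m n
    using that by (simp add: sum.atLeastLessThan_concat flip: atLeast0LessThan)
  have "(\<Sum>a\<in>{i..<k} \<times> {j..<l}. \<delta> a) = (\<Sum>p=i..<k. \<Sum>q=j..<l. \<delta> (p, q))"
    by (simp add: sum.cartesian_product)
  moreover have "(\<Sum>p<k. \<Sum>q<l. \<delta> (p, q)) = (\<Sum>p<i. \<Sum>q<l. \<delta> (p, q)) + (\<Sum>p=i..<k. \<Sum>q<l. \<delta> (p, q))"
    "(\<Sum>p<k. \<Sum>q<j. \<delta> (p, q)) = (\<Sum>p<i. \<Sum>q<j. \<delta> (p, q)) + (\<Sum>p=i..<k. \<Sum>q<j. \<delta> (p, q))"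
    using split[OF assms(2)] by blast+
  moreover have "(\<Sum>p=i..<k. \<Sum>q<l. \<delta> (p, q)) = (\<Sum>p=i..<k. \<Sum>q<j. \<delta> (p, q)) + (\<Sum>p=i..<k. \<Sum>q=j..<l. \<delta> (p, q))"
    by (simp add: split[OF assms(3)] sum.distrib)
  ultimately show ?thesis unfolding w_def by simp
qed

context cell_corners
begin

text \<open>By \<open>prefix_sum_rectangle\<close> the diagonal of a strip outweighs its
  anti-diagonal by the sum of \<open>\<delta>\<close> over its cells. The signs from
  \<open>bipartite_signs\<close> make this positive for vertical and negative for horizontal strips,
  which favours \<open>lead\<close> in both cases.\<close>

lemma strip_weights:
  assumes a0: "a0 \<in> A" and conn: "\<And>a. a \<in> A \<Longrightarrow> (a0, a) \<in> (adj_rel A)\<^sup>*" and V: "finite V"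
    and corners: "\<And>x c. x \<in> strips A \<Longrightarrow> lead A x c \<in> V \<and> trail A x c \<in> V"
  obtains w :: "point \<Rightarrow> nat" where "\<And>x. x \<in> strips A - {hstrip A a0} \<Longrightarrow>
    w (trail A x True) + w (trail A x False) < w (lead A x True) + w (lead A x False)"
proof -
  obtain rank :: "strip \<Rightarrow> nat" where rank: "\<And>a. a \<in> A \<Longrightarrow> rank (vstrip A a) \<noteq> rank (hstrip A a)"
    "\<And>x. x \<in> strips A \<Longrightarrow> x \<noteq> hstrip A a0 \<Longrightarrow>
      \<exists>a\<in>A. x = vstrip A a \<and> rank (hstrip A a) < rank x \<or> x = hstrip A a \<and> rank (vstrip A a) < rank x"
    using strip_rank[OF a0 conn] by metis
  have "\<exists>\<delta> :: point \<Rightarrow> int. (\<forall>a\<in>A. rank (hstrip A a) < rank (vstrip A a) \<longrightarrow> 0 < (\<Sum>b\<in>{b \<in> A. vstrip A b = vstrip A a}. \<delta> b)) \<and>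
      (\<forall>a\<in>A. rank (vstrip A a) < rank (hstrip A a) \<longrightarrow> (\<Sum>b\<in>{b \<in> A. hstrip A b = hstrip A a}. \<delta> b) < 0)"
    using rank(1) by (intro bipartite_signs finite)
  then obtain \<delta> :: "point \<Rightarrow> int" where "(\<forall>a\<in>A. rank (hstrip A a) < rank (vstrip A a) \<longrightarrow> 0 < (\<Sum>b\<in>{b \<in> A. vstrip A b = vstrip A a}. \<delta> b)) \<and>
      (\<forall>a\<in>A. rank (vstrip A a) < rank (hstrip A a) \<longrightarrow> (\<Sum>b\<in>{b \<in> A. hstrip A b = hstrip A a}. \<delta> b) < 0)" ..
  note \<delta> = this[THEN conjunct1, rule_format] this[THEN conjunct2, rule_format]
  define w where "w = (\<lambda>(i, j). \<Sum>p<i. \<Sum>q<j. \<delta> (p, q))"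
  note rect = prefix_sum_rectangle[of _ _ _ _ \<delta>, folded w_def]
  have strict: "w (trail A x True) + w (trail A x False) < w (lead A x True) + w (lead A x False)"
    if x: "x \<in> strips A" "x \<noteq> hstrip A a0" for x
  proof -
    obtain o' i j where xo: "x = (o', (i, j))" by (cases x) auto
    obtain a where a: "a \<in> A" "x = vstrip A a \<and> rank (hstrip A a) < rank x \<or> x = hstrip A a \<and> rank (vstrip A a) < rank x"
      using rank(2)[OF x] by blast
    have vh: "fst (vstrip A a)" "\<not> fst (hstrip A a)" by (cases a; simp)+
    show ?thesis
    proof (cases o')
      case True
      then have "x \<noteq> hstrip A a" using vh(2) xo by (metis fst_conv)
      then have "x = vstrip A a" "rank (hstrip A a) < rank (vstrip A a)" using a(2) by auto
      then have "0 < (\<Sum>b\<in>{b \<in> A. vstrip A b = (True, (i, j))}. \<delta> b)" using \<delta>(1)[OF a(1)] xo True by simp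
      moreover note r = vstrip_cells[of i j, OF x(1)[unfolded xo, simplified True]]
      ultimately have "0 < (\<Sum>b\<in>{i..<Suc i} \<times> {j..<run_end (column A i) j}. \<delta> b)"
        unfolding r(1) by simp
      then show ?thesis using rect[of i "Suc i" j "run_end (column A i) j"] r(2)
        xo True by (simp add: Let_def)
    next
      case False
      then have "x \<noteq> vstrip A a" using vh(1) xo by (metis fst_conv)
      then have "x = hstrip A a" "rank (vstrip A a) < rank (hstrip A a)" using a(2) by auto
      then have "(\<Sum>b\<in>{b \<in> A. hstrip A b = (False, (i, j))}. \<delta> b) < 0" using \<delta>(2)[OF a(1)] xo False by simp
      moreover note r = hstrip_cells[of i j, OF x(1)[unfolded xo, simplified False]]
      ultimately have "(\<Sum>b\<in>{i..<run_end (row A j) i} \<times> {j..<Suc j}. \<delta> b) < 0"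
        unfolding r(1) by simp
      then show ?thesis using rect[of i "run_end (row A j) i" j "Suc j"] r(2)
        xo False by (simp add: Let_def)
    qed
  qed
  \<comment> \<open>Adding \<open>C\<close> makes the weights on \<open>V\<close> nonnegative. Both
    sides of the comparison have two vertices, so both grow by \<open>2 * C\<close>.\<close>
  define C where "C = (\<Sum>v\<in>V. \<bar>w v\<bar>)"
  have C: "0 \<le> w v + C" if "v \<in> V" for v
    using member_le_sum[OF that, of "\<lambda>v. \<bar>w v\<bar>"] V unfolding C_def by simp
  show thesis
  proof
    fix x assume x: "x \<in> strips A - {hstrip A a0}"
    then have "x \<in> strips A" by blast
    note c = corners[OF this]
    have "int (nat (w v + C)) = w v + C" if "v \<in> V" for v using C[OF that] by simp
    then have "int (nat (w (trail A x True) + C) + nat (w (trail A x False) + C)) <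
        int (nat (w (lead A x True) + C) + nat (w (lead A x False) + C))"
      using c[of True] c[of False] strict[of x] x by simp
    then show "nat (w (trail A x True) + C) + nat (w (trail A x False) + C) <
        nat (w (lead A x True) + C) + nat (w (lead A x False) + C)" by (simp only: of_nat_less_iff)
  qed
qed

end

section \<open>The polyomino ideal\<close>

lemma lex_total:
  "length xs = length ys \<Longrightarrow> xs = ys \<or> (xs, ys) \<in> lex less_than \<or> (ys, xs) \<in> lex less_than"
  by (induction xs ys rule: list_induct2) auto

lemma lex_add:
  fixes xs ys zs :: "nat list"
  assumes "(xs, ys) \<in> lex less_than" "length zs = length xs"
  shows "(map2 (+) xs zs, map2 (+) ys zs) \<in> lex less_than"
  using assms
proof (induction xs arbitrary: ys zs)
  case (Cons x xs)
  then show ?case by (cases ys; cases zs) (auto dest: lex_take_index)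
qed simp

lemma lex_not_less_zeros:
  fixes xs :: "nat list"
  shows "(xs, map (\<lambda>_. 0) vs) \<notin> lex less_than"
proof (induction vs arbitrary: xs)
  case (Cons v vs)
  then show ?case by (cases xs) auto
qed simp

text \<open>Weights are compared first, ties are broken lexicographically along an enumeration of
  \<open>V\<close>. All lists have the same length, so the order is well-founded as
  \<open>lex less_than\<close> is.\<close>

lemma weight_order_exists:
  fixes w :: "'v \<Rightarrow> nat"
  assumes V: "finite V"
  shows "\<exists>r. monomial_well_order V r \<and>
    (\<forall>u\<in>monomials V. \<forall>v\<in>monomials V. exponent_map w u < exponent_map w v \<longrightarrow> (u, v) \<in> r)"
proof -
  obtain vs where vs: "set vs = V" using finite_list[OF V] by blast
  define L :: "'v monomial \<Rightarrow> nat list" where "L u = exponent_map w u # map (Poly_Mapping.lookup u) vs" for u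
  define r where "r = {(u, v). u \<in> monomials V \<and> v \<in> monomials V \<and> (u = v \<or> (L u, L v) \<in> lex less_than)}"
  have L_add: "L (u + v) = map2 (+) (L u) (L v)" for u v
    by (simp add: L_def exponent_map_add lookup_add map2_map_map)
  \<comment> \<open>The entry \<open>undefined\<close> only fills the position of the weight, to
    give the list of zeros the right length.\<close>
  have L_zero: "L 0 = map (\<lambda>_. 0) (undefined # vs)" by (simp add: L_def)
  have L_inj: "u = v" if "u \<in> monomials V" "v \<in> monomials V" "L u = L v" for u v
  proof (rule poly_mapping_eqI)
    fix x
    show "Poly_Mapping.lookup u x = Poly_Mapping.lookup v x"
    proof (cases "x \<in> V")
      case True then show ?thesis using that(3) vs by (simp add: L_def)
    next
      case False
      then have "x \<notin> Poly_Mapping.keys u" "x \<notin> Poly_Mapping.keys v" using that(1,2) by (auto simp: monomials_def)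
      then show ?thesis by (simp add: in_keys_iff)
    qed
  qed
  have wf_lex: "wf (lex less_than)" by (rule wf_lex) simp
  have trans: "(xs, zs) \<in> lex less_than" if "(xs, ys) \<in> lex less_than" "(ys, zs) \<in> lex less_than" for xs ys zs :: "nat list"
    using lex_transI[OF trans_less_than] that by (rule transD)
  have asym: "(ys, xs) \<notin> lex less_than" if "(xs, ys) \<in> lex less_than" for xs ys :: "nat list"
    using wf_not_sym[OF wf_lex that] .
  have len: "length (L u) = length (L v)" for u v by (simp add: L_def)
  have order: "monomial_order V r"
    unfolding monomial_order_def
  proof (intro conjI ballI allI impI)
    have "r \<subseteq> monomials V \<times> monomials V" by (auto simp: r_def)
    moreover have "refl_on (monomials V) r" by (auto simp: r_def refl_on_def)
    moreover have "trans r" unfolding trans_def r_def using trans by blast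
    moreover have "antisym r" unfolding antisym_def r_def using asym by blast
    moreover have "total_on (monomials V) r" unfolding total_on_def r_def using lex_total[OF len] L_inj by blast
    ultimately show "linear_order_on (monomials V) r" unfolding order_on_defs by blast
    show "(0, u) \<in> r" if "u \<in> monomials V" for u
    proof -
      have "(L u, L 0) \<notin> lex less_than" unfolding L_zero by (rule lex_not_less_zeros)
      then show ?thesis using lex_total[OF len[of 0 u]] L_inj[of 0 u] that unfolding r_def by auto
    qed
    show "(u + x, v + x) \<in> r" if "x \<in> monomials V" "(u, v) \<in> r" for u v x
      using that lex_add[of "L u" "L v" "L x"] len[of x u] unfolding r_def by (auto simp: L_add)
  qed
  have "r - Id \<subseteq> inv_image (lex less_than) L" unfolding r_def by auto
  then have "wf (r - Id)" by (rule wf_subset[OF wf_inv_image[OF wf_lex]])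
  with order have "monomial_well_order V r" by unfold_locales
  moreover have "(u, v) \<in> r" if "u \<in> monomials V" "v \<in> monomials V" "exponent_map w u < exponent_map w v" for u v
    using that unfolding r_def L_def by simp
  ultimately show ?thesis by blast
qed

text \<open>The relation of a cell in \<open>A\<close> forces the exponent at its upper right
  vertex; every other vertex gets a coordinate of its own. The subtraction calls for integer
  exponents. Vertices are encoded as numbers because \<open>primeideal_push_kernel\<close> needs
  linearly ordered exponents, whereas points carry the componentwise order.\<close>

fun toric :: "point set \<Rightarrow> nat \<Rightarrow> nat \<Rightarrow> (nat \<Rightarrow>\<^sub>0 int)" where
  "toric A (Suc i) (Suc j) = (if (i, j) \<in> A then toric A (Suc i) j + toric A i (Suc j) - toric A i j
     else Poly_Mapping.single (prod_encode (Suc i, Suc j)) 1)"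
| "toric A 0 j = Poly_Mapping.single (prod_encode (0, j)) 1"
| "toric A (Suc i) 0 = Poly_Mapping.single (prod_encode (Suc i, 0)) 1"

text \<open>The relations of the unit cells telescope, first upwards within a column of the
  rectangle, then across its columns.\<close>

lemma toric_rectangle:
  assumes "i \<le> k" "j \<le> l" "{i..<k} \<times> {j..<l} \<subseteq> A"
  shows "toric A i j + toric A k l = toric A i l + toric A k j"
proof -
  have strip: "toric A p j + toric A (Suc p) l = toric A p l + toric A (Suc p) j"
    if "{p} \<times> {j..<l} \<subseteq> A" for p
    using assms(2) that
  proof (induction l rule: dec_induct)
    case (step l)
    have "{p} \<times> {j..<l} \<subseteq> A" using step.prems by auto
    then have *: "toric A p j + toric A (Suc p) l = toric A p l + toric A (Suc p) j" by (rule step.IH)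
    have "(p, l) \<in> A" using step by auto
    then have "toric A (Suc p) (Suc l) = toric A (Suc p) l + toric A p (Suc l) - toric A p l" by simp
    then have "toric A p l + toric A (Suc p) (Suc l) = toric A (Suc p) l + toric A p (Suc l)"
      by (simp del: toric.simps)
    then have "toric A p l + toric A (Suc p) (Suc l) + (toric A p j + toric A (Suc p) l) =
      toric A (Suc p) l + toric A p (Suc l) + (toric A p l + toric A (Suc p) j)" by (simp only: *)
    then show ?case by (simp add: algebra_simps del: toric.simps)
  qed simp
  show ?thesis
    using assms(1,3)
  proof (induction k rule: dec_induct)
    case (step k)
    have "{i..<k} \<times> {j..<l} \<subseteq> A" "{k} \<times> {j..<l} \<subseteq> A" using step by auto
    then have "toric A i j + toric A k l = toric A i l + toric A k j"
      "toric A k j + toric A (Suc k) l = toric A k l + toric A (Suc k) j" using step.IH strip by blast+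
    then have "toric A i j + toric A k l + (toric A k j + toric A (Suc k) l) =
      toric A i l + toric A k j + (toric A k l + toric A (Suc k) j)" by (simp only:)
    then show ?case by (simp add: algebra_simps del: toric.simps)
  qed simp
qed

section \<open>The inner binomials as a minimal system of generators\<close>

definition corner :: "point \<Rightarrow> point \<Rightarrow> point monomial" where
  "corner a b = Poly_Mapping.single a 1 + Poly_Mapping.single b 1"

lemma inner_binomial_single:
  "inner_binomial a b = Poly_Mapping.single (corner a b) 1 -
     (Poly_Mapping.single (corner (fst a, snd b) (fst b, snd a)) 1 :: (point, 'k::field) mpoly)"
  by (simp add: inner_binomial_def var_def monomial_poly_def mult_single corner_def)

lemma keys_corner [simp]: "Poly_Mapping.keys (corner a b) = {a, b}"
  by (auto simp: corner_def keys_add_nat)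

lemma corner_eq_iff: "corner a b = corner c d \<longleftrightarrow> a = c \<and> b = d \<or> a = d \<and> b = c"
proof
  assume "corner a b = corner c d"
  then have "{a, b} = {c, d}" by (metis keys_corner)
  then show "a = c \<and> b = d \<or> a = d \<and> b = c" by (simp add: doubleton_eq_iff)
qed (auto simp: corner_def add.commute)

lemma monomial_degree_corner [simp]: "monomial_degree (corner a b) = 2"
  by (simp add: corner_def monomial_degree_add) (simp add: monomial_degree_def)

lemma exponent_map_corner: "exponent_map E (corner a b) = E a + E b"
  by (simp add: corner_def exponent_map_add)

lemma inner_interval_corners:
  assumes "inner_interval P a b"
  shows "a \<in> vertices P" "b \<in> vertices P" "(fst a, snd b) \<in> vertices P" "(fst b, snd a) \<in> vertices P"
    "fst a < fst b" "snd a < snd b" "\<And>x y. fst a \<le> x \<Longrightarrow> x < fst b \<Longrightarrow> snd a \<le> y \<Longrightarrow> y < snd b \<Longrightarrow> cell_at (x, y) \<in> P"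
proof -
  show "a \<in> vertices P" "b \<in> vertices P" and ab: "fst a < fst b" "snd a < snd b"
    using assms by (auto simp: inner_interval_def proper_def)
  show cell: "cell_at (x, y) \<in> P" if "fst a \<le> x" "x < fst b" "snd a \<le> y" "y < snd b" for x y
  proof -
    have "cell_at (x, y) \<subseteq> {a..b}" using that by (auto simp: cell_at_eq less_eq_prod_def)
    then show ?thesis using assms by (auto simp: inner_interval_def cells_def)
  qed
  have "cell_at (fst a, snd b - 1) \<in> P" "cell_at (fst b - 1, snd a) \<in> P" using ab by (auto intro!: cell)
  moreover have "(fst a, snd b) \<in> cell_at (fst a, snd b - 1)" "(fst b, snd a) \<in> cell_at (fst b - 1, snd a)"
    using ab by (auto simp: in_cell_at)
  ultimately show "(fst a, snd b) \<in> vertices P" "(fst b, snd a) \<in> vertices P" unfolding vertices_def by blast+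
qed

lemma corner_in_monomials: "corner a b \<in> monomials V \<longleftrightarrow> a \<in> V \<and> b \<in> V"
  by (simp add: monomials_def)

lemma lookup_inner_binomial:
  "Poly_Mapping.lookup (inner_binomial a b :: (point, 'k::field) mpoly) t =
    (if t = corner a b then 1 else 0) - (if t = corner (fst a, snd b) (fst b, snd a) then 1 else 0)"
  by (simp add: inner_binomial_single lookup_minus lookup_single when_def eq_commute)

text \<open>The coordinates grow together along a diagonal and in opposite directions along an
  anti-diagonal. So the diagonal monomial of an inner interval occurs in its own binomial
  only.\<close>

lemma inner_interval_corner_neq:
  assumes "inner_interval P a b" "inner_interval P c d"
  shows "corner a b \<noteq> corner (fst c, snd d) (fst d, snd c)"
    and "corner a b = corner c d \<Longrightarrow> a = c \<and> b = d"
  using inner_interval_corners(5,6)[OF assms(1)] inner_interval_corners(5,6)[OF assms(2)]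
  by (auto simp: corner_eq_iff)

lemma keys_inner_binomial:
  assumes "inner_interval P a b"
  shows "Poly_Mapping.keys (inner_binomial a b :: (point, 'k::field) mpoly) =
    {corner a b, corner (fst a, snd b) (fst b, snd a)}"
  using inner_interval_corner_neq(1)[OF assms assms]
  by (auto simp: in_keys_iff lookup_inner_binomial split: if_splits)

lemma inner_binomial_carrier:
  assumes "inner_interval P a b"
  shows "(inner_binomial a b :: (point, 'k::field) mpoly) \<in> carrier (poly_ring (vertices P))"
  using inner_interval_corners(1-4)[OF assms] by (simp add: keys_inner_binomial[OF assms] corner_in_monomials)

text \<open>Any distinct inner binomials thereby belong to one minimal system. A generator cannot be
  dropped: the ideal \<open>K\<close> contains all the others but excludes its diagonal
  monomial.\<close>

lemma inner_binomials_minimal: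
  fixes P :: "cell set"
  defines "G \<equiv> {inner_binomial a b | a b. inner_interval P a b} :: (point, 'k::field) mpoly set"
  shows "minimal_homogeneous_generators (vertices P) (polyomino_ideal P) G"
  unfolding minimal_homogeneous_generators_def
proof (intro conjI allI impI)
  interpret cring "poly_ring (vertices P) :: (point, 'k) mpoly ring" by (rule poly_ring_cring)
  have car: "G \<subseteq> carrier (poly_ring (vertices P))" unfolding G_def using inner_binomial_carrier by blast
  have hom: "homogeneous g" if g: "g \<in> G" for g
  proof -
    obtain a b where "g = inner_binomial a b" "inner_interval P a b" using g unfolding G_def by blast
    then have "\<forall>m\<in>Poly_Mapping.keys g. monomial_degree m = 2" by (auto simp: keys_inner_binomial)
    then show ?thesis unfolding homogeneous_def by blast
  qed
  show "homogeneous_generators (vertices P) (polyomino_ideal P) G"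
    unfolding homogeneous_generators_def polyomino_ideal_def G_def[symmetric] using car hom by blast
  fix H assume H: "H \<subset> G"
  then obtain g where g: "g \<in> G" "g \<notin> H" by blast
  then obtain a b where ab: "g = inner_binomial a b" "inner_interval P a b" unfolding G_def by blast
  define K where "K = {f \<in> carrier (poly_ring (vertices P) :: (point, 'k) mpoly ring).
    \<forall>t\<in>Poly_Mapping.keys f. 2 \<le> monomial_degree t \<and> t \<noteq> corner a b}"
  have K_mult: "x * f \<in> K" if f: "f \<in> K" and x: "x \<in> carrier (poly_ring (vertices P))" for f x
  proof -
    have "x * f \<in> carrier (poly_ring (vertices P))" using poly_ring_closed(2)[OF x] f unfolding K_def by blast
    moreover have "2 \<le> monomial_degree t \<and> t \<noteq> corner a b" if t: "t \<in> Poly_Mapping.keys (x * f)" for t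
    proof -
      obtain s u where su: "t = s + u" "s \<in> Poly_Mapping.keys x" "u \<in> Poly_Mapping.keys f"
        using keys_mult[of x f] t by blast
      have u: "2 \<le> monomial_degree u" "u \<noteq> corner a b" using f su(3) unfolding K_def by auto
      \<comment> \<open>The terms of \<open>f\<close> have degree at least 2, so a quadratic term of
        \<open>x * f\<close> is already a term of \<open>f\<close>.\<close>
      have "t \<noteq> corner a b"
      proof
        assume eq: "t = corner a b"
        then have "monomial_degree s + monomial_degree u = 2" using su(1) monomial_degree_corner by (metis monomial_degree_add)
        then have "monomial_degree s = 0" using u(1) by simp
        then have "s = 0" using monomial_degree_ge[of s] by (intro poly_mapping_eqI) simp
        then show False using eq su(1) u(2) by simp
      qed
      then show ?thesis using u(1) su(1) by (simp add: monomial_degree_add)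
    qed
    ultimately show ?thesis unfolding K_def by blast
  qed
  have "ideal K (poly_ring (vertices P))"
  proof (rule idealI)
    have inv: "\<ominus>\<^bsub>poly_ring (vertices P)\<^esub> f = - f" if "f \<in> carrier (poly_ring (vertices P))" for f :: "(point, 'k) mpoly"
      by (rule minus_equality) (use that in auto)
    show "subgroup K (add_monoid (poly_ring (vertices P)))"
    proof (rule add.subgroupI)
      show "K \<subseteq> carrier (poly_ring (vertices P))" unfolding K_def by blast
      have "0 \<in> K" unfolding K_def by simp
      then show "K \<noteq> {}" by blast
      show "\<ominus>\<^bsub>poly_ring (vertices P)\<^esub> f \<in> K" if f: "f \<in> K" for f
      proof -
        have "\<ominus>\<^bsub>poly_ring (vertices P)\<^esub> f = - f" using f inv unfolding K_def by blast
        then show ?thesis using f unfolding K_def by simp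
      qed
      show "f \<oplus>\<^bsub>poly_ring (vertices P)\<^esub> h \<in> K" if "f \<in> K" "h \<in> K" for f h
      proof -
        have "f + h \<in> carrier (poly_ring (vertices P))"
          using that poly_ring_closed(1) unfolding K_def by blast
        then show ?thesis using that Poly_Mapping.keys_add[of f h] unfolding K_def by auto
      qed
    qed
    show "x \<otimes>\<^bsub>poly_ring (vertices P)\<^esub> f \<in> K" if "f \<in> K" "x \<in> carrier (poly_ring (vertices P))" for f x
      using K_mult[OF that] by simp
    show "f \<otimes>\<^bsub>poly_ring (vertices P)\<^esub> x \<in> K" if "f \<in> K" "x \<in> carrier (poly_ring (vertices P))" for f x
      using K_mult[OF that] by (simp add: mult.commute)
  qed (rule ring_axioms)
  moreover have "H \<subseteq> K"
  proof
    fix h assume h: "h \<in> H"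
    then obtain c d where cd: "h = inner_binomial c d" "inner_interval P c d" using H unfolding G_def by blast
    have "corner a b \<noteq> corner c d"
      using inner_interval_corner_neq(2)[OF ab(2) cd(2)] ab(1) cd(1) g(2) h by auto
    then have "\<forall>t\<in>Poly_Mapping.keys h. 2 \<le> monomial_degree t \<and> t \<noteq> corner a b"
      using inner_interval_corner_neq(1)[OF ab(2) cd(2)] unfolding cd(1) keys_inner_binomial[OF cd(2)] by auto
    then show "h \<in> K" unfolding K_def cd(1) using inner_binomial_carrier[OF cd(2)] by blast
  qed
  ultimately have "Idl\<^bsub>poly_ring (vertices P)\<^esub> H \<subseteq> K" by (rule genideal_minimal)
  moreover have "g \<notin> K" unfolding K_def ab(1) using keys_inner_binomial[OF ab(2)] by auto
  moreover have "g \<in> polyomino_ideal P"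
    unfolding polyomino_ideal_def G_def[symmetric] using genideal_self[OF car] g(1) by blast
  ultimately show "Idl\<^bsub>poly_ring (vertices P)\<^esub> H \<noteq> polyomino_ideal P" by blast
qed

lemma homogeneous_ideal_polyomino_ideal:
  "homogeneous_ideal (vertices P) (polyomino_ideal P :: (point, 'k::field) mpoly set)"
proof -
  interpret cring "poly_ring (vertices P) :: (point, 'k) mpoly ring" by (rule poly_ring_cring)
  note G = inner_binomials_minimal[of P, where ?'k = 'k, unfolded minimal_homogeneous_generators_def, THEN conjunct1]
  have "ideal (polyomino_ideal P) (poly_ring (vertices P) :: (point, 'k) mpoly ring)"
    unfolding polyomino_ideal_def using G unfolding homogeneous_generators_def by (intro genideal_ideal) blast
  then show ?thesis unfolding homogeneous_ideal_def using G by blast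
qed

text \<open>The kernel of \<open>x\<^sub>v \<mapsto> t ^ toric v\<close> is a prime ideal that contains all inner binomials. The
  variables of those vertices that are not the upper right corner of a cell are mapped to
  independent Laurent monomials.\<close>

lemma ideal_height_polyomino_ideal_le:
  assumes A: "A = {a. cell_at a \<in> P}" "finite A" and V: "finite (vertices P)"
  shows "ideal_height (poly_ring (vertices P)) (polyomino_ideal P :: (point, 'k::field) mpoly set) \<le> enat (card A)"
proof -
  let ?V = "vertices P"
  define E where "E = (\<lambda>(i, j). toric A i j)"
  define h where "h = (exponent_map E :: point monomial \<Rightarrow> (nat \<Rightarrow>\<^sub>0 int))"
  define p where "p = {f \<in> carrier (poly_ring ?V). push h f = (0 :: (nat \<Rightarrow>\<^sub>0 int) \<Rightarrow>\<^sub>0 'k)}"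
  \<comment> \<open>Each cell removes its own upper right vertex, so \<open>U\<close> has
    \<open>card A\<close> vertices fewer than the polyomino.\<close>
  define U where "U = ?V - (\<lambda>(i, j). (Suc i, Suc j)) ` A"
  interpret cring "poly_ring ?V :: (point, 'k) mpoly ring" by (rule poly_ring_cring)
  have h: "h (u + v) = h u + h v" "h 0 = 0" for u v unfolding h_def by (simp_all add: exponent_map_add)
  have prime: "primeideal p (poly_ring ?V)" unfolding p_def by (rule primeideal_push_kernel[OF h])
  have "inner_binomial a b \<in> p" if ab: "inner_interval P a b" for a b
  proof -
    note c = inner_interval_corners[OF ab]
    have "{fst a..<fst b} \<times> {snd a..<snd b} \<subseteq> A" using c(7) unfolding A(1) by auto
    then have "E a + E b = E (fst a, snd b) + E (fst b, snd a)"
      using toric_rectangle[of "fst a" "fst b" "snd a" "snd b" A] c(5,6) unfolding E_def by (simp add: case_prod_unfold)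
    then have "push h (inner_binomial a b :: (point, 'k) mpoly) = 0"
      unfolding inner_binomial_single diff_conv_add_uminus push_add push_uminus push_single h_def exponent_map_corner by simp
    then show ?thesis unfolding p_def using inner_binomial_carrier[OF ab] by blast
  qed
  then have sub: "polyomino_ideal P \<subseteq> p"
    unfolding polyomino_ideal_def by (intro genideal_minimal primeideal.axioms(1)[OF prime]) blast
  have "ideal_height (poly_ring ?V) (polyomino_ideal P :: (point, 'k) mpoly set) \<le> prime_height (poly_ring ?V) p"
    unfolding ideal_height_def by (rule INF_lower) (use prime sub in blast)
  also have "\<dots> \<le> enat (card ?V - card U)"
    unfolding p_def
  proof (rule prime_height_push_kernel_le[OF V])
    show "U \<subseteq> ?V" unfolding U_def by blast
    have E_U: "E v = Poly_Mapping.single (prod_encode v) 1" if "v \<in> U" for v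
    proof -
      obtain i j where v: "v = (i, j)" by (cases v)
      show ?thesis
      proof (cases "i = 0 \<or> j = 0")
        case True then show ?thesis unfolding v E_def by (cases i; cases j) auto
      next
        case False
        then obtain k l where kl: "i = Suc k" "j = Suc l" by (metis not0_implies_Suc)
        have "(k, l) \<notin> A" using that unfolding U_def v kl by force
        then show ?thesis unfolding v kl E_def by simp
      qed
    qed
    show "inj_on h (monomials U)"
    proof (rule inj_onI)
      fix m n assume mn: "m \<in> monomials U" "n \<in> monomials U" "h m = h n"
      \<comment> \<open>On \<open>U\<close> the vectors \<open>E v\<close> are distinct unit
        vectors, so the exponents of a monomial are the coordinates of its image.\<close>
      have look: "Poly_Mapping.lookup (h m) (prod_encode v) = int (Poly_Mapping.lookup m v)" if "m \<in> monomials U" for m v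
      proof -
        have "h m = (\<Sum>x\<in>Poly_Mapping.keys m. Poly_Mapping.single (prod_encode x) (int (Poly_Mapping.lookup m x)))"
          unfolding h_def exponent_map_def
        proof (rule sum.cong)
          fix x assume "x \<in> Poly_Mapping.keys m"
          then have "E x = Poly_Mapping.single (prod_encode x) 1" using that E_U unfolding monomials_def by blast
          then show "of_nat (Poly_Mapping.lookup m x) * E x = Poly_Mapping.single (prod_encode x) (int (Poly_Mapping.lookup m x))"
            by (simp add: mult_single flip: single_of_nat)
        qed simp
        then have "Poly_Mapping.lookup (h m) (prod_encode v) =
            (\<Sum>x\<in>Poly_Mapping.keys m. if x = v then int (Poly_Mapping.lookup m v) else 0)"
          by (auto simp: lookup_sum lookup_single when_def intro!: sum.cong)
        then show ?thesis by (simp add: in_keys_iff)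
      qed
      show "m = n" using look[OF mn(1)] look[OF mn(2)] mn(3) by (intro poly_mapping_eqI) simp
    qed
  qed
  also have "card ?V - card U = card A"
  proof -
    have sub: "(\<lambda>(i, j). (Suc i, Suc j)) ` A \<subseteq> ?V"
      unfolding vertices_def A by (auto simp: cell_at_eq intro!: bexI[of _ "cell_at _"])
    have "card ((\<lambda>(i, j). (Suc i, Suc j)) ` A) = card A" by (rule card_image) (auto simp: inj_on_def)
    then show ?thesis unfolding U_def
      using card_Diff_subset[OF finite_imageI[OF A(2)] sub] card_mono[OF V sub] by simp
  qed
  finally show ?thesis .
qed

theorem theorem3p6:
  fixes P :: "cell set"
  assumes "simple_polyomino P" and "thin P"
  shows "konig_type (vertices P) (polyomino_ideal P :: (point, 'k::field) mpoly set)"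
proof -
  let ?V = "vertices P"
  have poly: "polyomino P" and compl: "path_connected_cells (cells - P)"
    using assms(1) by (auto simp: simple_polyomino_def)
  then have P: "P \<noteq> {}" "finite P" "P \<subseteq> cells" "?V \<subseteq> {1..} \<times> {1..}" by (auto simp: polyomino_def)
  define A where "A = {a. cell_at a \<in> P}"
  have finA: "finite A" using finite_vimageI[OF P(2) inj_cell_at] unfolding A_def vimage_def .
  obtain C where "C \<in> P" using P(1) by blast
  moreover from this obtain a0 where "C = cell_at a0" using P(3) unfolding cells_def by blast
  ultimately have a0: "a0 \<in> A" unfolding A_def by simp
  have "A \<subseteq> ?V" unfolding A_def vertices_def by (auto simp: cell_at_eq)
  then have pos: "A \<subseteq> {1..} \<times> {1..}" using P(4) by blast
  have "finite C" if "C \<in> P" for C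
    using that P(3) unfolding cells_def by (auto simp: cell_at_eq)
  then have V: "finite ?V" using P(2) unfolding vertices_def by blast
  interpret cell_corners A by unfold_locales (rule finA, rule pos)
  note conn = adj_rel_connected[OF poly A_def]
  note inner = strip_inner_interval[OF A_def]
  have corners: "lead A x c \<in> ?V \<and> trail A x c \<in> ?V" if x: "x \<in> strips A" for x c
  proof -
    note ic = inner_interval_corners(1-4)[OF inner[OF x]]
    show ?thesis using ic by (cases x; cases "fst x") (auto simp: Let_def)
  qed
  obtain w :: "point \<Rightarrow> nat" where w: "\<And>x. x \<in> strips A - {hstrip A a0} \<Longrightarrow>
    w (trail A x True) + w (trail A x False) < w (lead A x True) + w (lead A x False)"
    using strip_weights[OF a0 conn[OF a0] V corners] by metis
  obtain r where r: "monomial_well_order ?V r" and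
    rw: "\<forall>u\<in>monomials ?V. \<forall>v\<in>monomials ?V. exponent_map w u < exponent_map w v \<longrightarrow> (u, v) \<in> r"
    using weight_order_exists[OF V] by blast
  interpret monomial_well_order ?V r by (rule r)
  \<comment> \<open>By \<open>card_strips\<close>, strips and adjacencies together number
    \<open>2 * card A\<close>, and there are fewer adjacencies than cells.\<close>
  have "card A < card (strips A)"
    using card_adj_less[OF compl assms(2) A_def finA _ pos] a0 card_strips by fastforce
  then have "card A \<le> card (strips A - {hstrip A a0})"
    using finite_strips strip_mem(2)[OF a0] by simp
  then obtain S where S: "S \<subseteq> strips A - {hstrip A a0}" "card S = card A" "finite S"
    using obtain_subset_with_card_n by metis
  define f where "f x = (inner_binomial (snd x) (upper_right A x) :: (point, 'k) mpoly)" for x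
  define m where "m x = corner (lead A x True) (lead A x False)" for x
  have lm: "leading_monomial r (f x) = m x" "f x \<in> carrier (poly_ring ?V) - {0}" if x: "x \<in> S" for x
  proof -
    have xs: "x \<in> strips A" using x S by blast
    define t where "t = corner (trail A x True) (trail A x False)"
    \<comment> \<open>For a horizontal strip \<open>m x\<close> has coefficient \<open>- 1\<close>
      in \<open>f x\<close>; \<open>initial\<close> replaces the coefficient by
      \<open>1\<close>.\<close>
    have keys: "Poly_Mapping.keys (f x) = {m x, t}"
      unfolding f_def keys_inner_binomial[OF inner[OF xs]] m_def t_def
      by (cases x; cases "fst x") (auto simp: Let_def)
    then show "f x \<in> carrier (poly_ring ?V) - {0}" using inner_binomial_carrier[OF inner[OF xs]] unfolding f_def by auto
    have "m x \<in> monomials ?V" "t \<in> monomials ?V" unfolding m_def t_def corner_in_monomials using corners[OF xs] by auto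
    moreover have "exponent_map w t < exponent_map w (m x)"
      unfolding m_def t_def exponent_map_corner by (rule w) (use x S(1) in blast)
    ultimately have "(t, m x) \<in> r" "(m x, m x) \<in> r" using rw reflD by blast+
    then show "leading_monomial r (f x) = m x" by (intro leading_monomial_eqI) (auto simp: keys)
  qed
  have disj: "Poly_Mapping.keys (m x) \<inter> Poly_Mapping.keys (m y) = {}" if xy: "x \<in> S" "y \<in> S" "x \<noteq> y" for x y
  proof -
    have xs: "x \<in> strips A" "y \<in> strips A" using xy(1,2) S by blast+
    have "lead A x c \<noteq> lead A y d" for c d
      using lead_inj[OF no_pinch[OF compl A_def conn] xs, of c d] xy(3) by blast
    then show ?thesis unfolding m_def by auto
  qed
  have inj: "inj_on f S"
  proof (rule inj_onI, rule ccontr)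
    fix x y assume xy: "x \<in> S" "y \<in> S" "f x = f y" "x \<noteq> y"
    then have "m x = m y" using lm(1) by metis
    then show False using disj[OF xy(1,2,4)] by (simp add: m_def)
  qed
  obtain xs where xs: "set xs = S" "distinct xs" using finite_distinct_list[OF S(3)] by blast
  have len: "length (map f xs) = card A" using distinct_card[OF xs(2)] xs(1) S(2) by simp
  have lc: "leading_coprime (map f xs)"
    unfolding leading_coprime_def sorted_wrt_iff_nth_less
  proof (intro conjI allI impI)
    show "set (map f xs) \<subseteq> carrier (poly_ring ?V) - {0}" using lm(2) xs(1) by auto
    fix i j assume ij: "i < j" "j < length (map f xs)"
    then have "xs ! i \<in> S" "xs ! j \<in> S" "xs ! i \<noteq> xs ! j" using xs nth_eq_iff_index_eq[OF xs(2), of i j] by auto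
    then show "Poly_Mapping.keys (leading_monomial r (map f xs ! i)) \<inter>
        Poly_Mapping.keys (leading_monomial r (map f xs ! j)) = {}"
      using disj lm(1) ij by simp
  qed
  let ?G = "{inner_binomial a b | a b. inner_interval P a b} :: (point, 'k) mpoly set"
  have "f x \<in> ?G" if "x \<in> S" for x
    using inner[of x] that S(1) unfolding f_def by blast
  then have sub: "set (map f xs) \<subseteq> ?G" using xs(1) by auto
  have min: "minimal_homogeneous_generators ?V (polyomino_ideal P) ?G" by (rule inner_binomials_minimal)
  interpret R: cring "poly_ring ?V :: (point, 'k) mpoly ring" by (rule poly_ring_cring)
  have "?G \<subseteq> polyomino_ideal P"
    unfolding polyomino_ideal_def by (rule R.genideal_self) (use inner_binomial_carrier in blast)
  then have "set (map f xs) \<subseteq> polyomino_ideal P" using sub by blast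
  then have "enat (card A) \<le> ideal_height (poly_ring ?V) (polyomino_ideal P :: (point, 'k) mpoly set)"
    using leading_coprime_le_ideal_height[OF lc] unfolding len by blast
  then have height: "ideal_height (poly_ring ?V) (polyomino_ideal P :: (point, 'k) mpoly set) = enat (length (map f xs))"
    unfolding len using ideal_height_polyomino_ideal_le[OF A_def finA V] by (rule antisym[rotated])
  have reg: "regular_sequence (poly_ring ?V) (map (initial r) (map f xs))"
  proof (rule leading_coprime_regular_sequence[OF lc])
    fix g assume "g \<in> set (map f xs)"
    then obtain x where "x \<in> S" "g = f x" using xs(1) by auto
    then have "Poly_Mapping.keys (leading_monomial r g) \<noteq> {}" using lm(1) by (simp add: m_def)
    then show "leading_monomial r g \<noteq> 0" by auto
  qed
  have dist: "distinct (map f xs)" using xs inj by (simp add: distinct_map)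
  show ?thesis
    unfolding konig_type_def
    using homogeneous_ideal_polyomino_ideal height min dist sub order reg by blast
qed

end
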